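(* Let $(Q,N,C_1,C_2,\dots)$ be a real-valued random vector with $N\in\mathbb{N}=\{0,1,2,\dots\}$, and for $\gamma>0$ let $\rho_\gamma = E\left[\sum_{i=1}^N |C_i|^\gamma\right]$. Suppose that for some $\beta>1$ we have $E[|Q|^\beta]<\infty$ and $E\left[\left(\sum_{i=1}^N |C_i|\right)^\beta\right]<\infty$, and in addition that either (i) $\max\{\rho_1,\rho_\beta\}<1$, or (ii) $\beta=2$, $\rho_1=1$, $\rho_\beta<1$ and $E[Q]=0$. Let $F_k$ be the distribution function of $R^{(k)}$ and let $\hat F_{k,m}$ be the empirical distribution function of the level-$k$ sample pool of size $m$ produced by the iterative bootstrap algorithm (both defined in the context). Then, for any $\alpha\in(1,2)$ with $\alpha\le\beta$, there exists a constant $K_\alpha<\infty$ such that for all integers $k\ge 0$ and $m\ge 1$, $$E\left[d_1(\hat F_{k,m},F_k)\right]\le K_\alpha\, m^{-1+1/\alpha}\sum_{i=0}^k \rho_1^i,$$ where $d_1$ is the Kantorovich-Rubinstein distance.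
   Context: **The process $R^{(k)}$.** The components of the generic branching vector $(Q,N,C_1,C_2,\dots)$ may be arbitrarily dependent on each other. Let $\mathbb{N}_+=\{1,2,\dots\}$ and $U=\bigcup_{k\ge 0}(\mathbb{N}_+)^k$, the set of finite sequences of positive integers, with $(\mathbb{N}_+)^0=\{\emptyset\}$; $(\mathbf i,j)$ denotes concatenation. Let $\{(Q_{\mathbf i},N_{\mathbf i},C_{(\mathbf i,1)},C_{(\mathbf i,2)},\dots)\}_{\mathbf i\in U}$ be i.i.d. copies of the generic branching vector. Set $A_0=\{\emptyset\}$ and $A_n=\{(\mathbf i,j)\in U:\mathbf i\in A_{n-1},\ 1\le j\le N_{\mathbf i}\}$ for $n\ge1$; set $\Pi_\emptyset=1$ and $\Pi_{(\mathbf i,j)}=C_{(\mathbf i,j)}\Pi_{\mathbf i}$. Define $$R^{(k)}=\sum_{j=0}^k\sum_{\mathbf i\in A_j}Q_{\mathbf i}\Pi_{\mathbf i},\qquad k\ge 0.$$ The laws satisfy $R^{(0)}\stackrel{\mathcal D}{=}Q$ and $R^{(k)}\stackrel{\mathcal D}{=}\sum_{r=1}^N C_rR^{(k-1)}_r+Q$ for $k\ge1$, where $\{R^{(k-1)}_r\}_{r\ge1}$ are i.i.d. copies of $R^{(k-1)}$ independent of $(Q,N,C_1,C_2,\dots)$. $F_k(x)=P(R^{(k)}\le x)$. **The iterative bootstrap algorithm.** Fix $m\in\mathbb{N}_+$. The sample pools $\mathcal P^{(j,m)}=(\hat R^{(j,m)}_1,\dots,\hat R^{(j,m)}_m)$,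 $j\ge 0$, are generated as follows. - Level $0$: $\hat R^{(0,m)}_i=Q_i$, $i=1,\dots,m$, where $Q_1,\dots,Q_m$ are i.i.d. copies of $Q$. - Level $j\ge1$: take $m$ fresh i.i.d. copies $\{(Q_i,N_i,C_{(i,1)},C_{(i,2)},\dots)\}_{i=1}^m$ of the generic branching vector, independent of everything else, and set $$\hat R^{(j,m)}_i=\sum_{r=1}^{N_i}C_{(i,r)}\hat R^{(j-1,m)}_{(i,r)}+Q_i,\qquad i=1,\dots,m,$$ where the $\hat R^{(j-1,m)}_{(i,r)}$ are sampled uniformly with replacement from the pool $\mathcal P^{(j-1,m)}$ (i.e., $\hat R^{(j-1,m)}_{(i,r)}=\hat R^{(j-1,m)}_{J(i,r)}$ with indices $J(i,r)$ i.i.d. uniform on $\{1,\dots,m\}$, independent of everything else). The empirical distribution function of the pool is $\hat F_{k,m}(x)=\frac1m\sum_{i=1}^m 1(\hat R^{(k,m)}_i\le x)$. **Kantorovich-Rubinstein distance.** For probability measures $\mu,\nu$ on $\mathbb{R}$, $d_1(\mu,\nu)=\inf_{\pi}\int_{\mathbb{R}\times\mathbb{R}}|x-y|\,d\pi(x,y)$, the infimum over joint probability measures $\pi$ on $\mathbb{R}\times\mathbb{R}$ with marginals $\mu$ and $\nu$. For distribution functions $F,G$, $d_1(F,G)$ denotes the distance between the corresponding probability measures; it equals $\int_{-\infty}^\infty|F(x)-G(x)|\,dx$. *)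

theory Defs
  imports "HOL-Probability.Probability"
begin

text \<open>
  A value \<open>(q, n, c)\<close> of the branching vector \<open>(Q, N, C\<^sub>1, C\<^sub>2, \<dots>)\<close>; only the components
  \<open>c r\<close> with \<open>r \<ge> 1\<close> carry information.
\<close>

type_synonym bvec = "real \<times> nat \<times> (nat \<Rightarrow> real)"

abbreviation Qof :: "bvec \<Rightarrow> real" where "Qof v \<equiv> fst v"
abbreviation Nof :: "bvec \<Rightarrow> nat" where "Nof v \<equiv> fst (snd v)"
abbreviation Cof :: "bvec \<Rightarrow> nat \<Rightarrow> real" where "Cof v \<equiv> snd (snd v)"

definition bvec_space :: "bvec measure" where
  "bvec_space = borel \<Otimes>\<^sub>M (count_space UNIV \<Otimes>\<^sub>M (\<Pi>\<^sub>M r\<in>{1::nat..}. borel))"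

definition bvec_law ::
  "'a measure \<Rightarrow> ('a \<Rightarrow> real) \<Rightarrow> ('a \<Rightarrow> nat) \<Rightarrow> (nat \<Rightarrow> 'a \<Rightarrow> real) \<Rightarrow> bvec measure" where
  "bvec_law M Q N C = distr M bvec_space (\<lambda>\<omega>. (Q \<omega>, N \<omega>, \<lambda>r\<in>{1..}. C r \<omega>))"

definition rho :: "'a measure \<Rightarrow> ('a \<Rightarrow> nat) \<Rightarrow> (nat \<Rightarrow> 'a \<Rightarrow> real) \<Rightarrow> real \<Rightarrow> ennreal" where
  "rho M N C \<gamma> = (\<integral>\<^sup>+\<omega>. ennreal (\<Sum>i=1..N \<omega>. \<bar>C i \<omega>\<bar> powr \<gamma>) \<partial>M)"

definition iid_family :: "'s measure \<Rightarrow> 'b measure \<Rightarrow> ('i \<Rightarrow> 's \<Rightarrow> 'b) \<Rightarrow> 'i set \<Rightarrow> bool" where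
  "iid_family S L X I \<longleftrightarrow>
     prob_space.indep_vars S (\<lambda>_. L) X I \<and> (\<forall>i\<in>I. distr S L (X i) = L)"

text \<open>
  The word \<open>(i\<^sub>1, \<dots>, i\<^sub>n)\<close> of \<open>U\<close> is represented by the reversed list \<open>[i\<^sub>n, \<dots>, i\<^sub>1]\<close>, so that
  the concatenation \<open>(w, j)\<close> is \<open>j # w\<close>. The coefficient \<open>C\<^bsub>(w, j)\<^esub>\<close> is the \<open>j\<close>-th component of
  the vector attached to \<open>w\<close>.
\<close>

definition words :: "nat list set" where
  "words = {w. set w \<subseteq> {1..}}"

primrec generation :: "(nat list \<Rightarrow> bvec) \<Rightarrow> nat \<Rightarrow> nat list set" where
  "generation v 0 = {[]}"
| "generation v (Suc n) = {j # w | j w. w \<in> generation v n \<and> 1 \<le> j \<and> j \<le> Nof (v w)}"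

primrec weight :: "(nat list \<Rightarrow> bvec) \<Rightarrow> nat list \<Rightarrow> real" where
  "weight v [] = 1"
| "weight v (j # w) = Cof (v w) j * weight v w"

definition tree_sum :: "(nat list \<Rightarrow> bvec) \<Rightarrow> nat \<Rightarrow> real" where
  "tree_sum v k = (\<Sum>j\<le>k. \<Sum>w\<in>generation v j. Qof (v w) * weight v w)"

definition R_df :: "'t measure \<Rightarrow> (nat list \<Rightarrow> 't \<Rightarrow> bvec) \<Rightarrow> nat \<Rightarrow> real \<Rightarrow> real" where
  "R_df T V k x = \<P>(\<omega> in T. tree_sum (\<lambda>w. V w \<omega>) k \<le> x)"

definition generated_events :: "'s measure \<Rightarrow> 'b measure \<Rightarrow> ('s \<Rightarrow> 'b) \<Rightarrow> 's set set" where
  "generated_events S L X = {X -` A \<inter> space S | A. A \<in> sets L}"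

text \<open>
  Randomness driving the bootstrap with pool size \<open>m\<close>: the initial values \<open>Q0 i\<close>, the vectors
  \<open>W (j, i)\<close> of level \<open>j \<ge> 1\<close>, and the resampling indices \<open>J (j, i, r)\<close>, which select from the
  pool of level \<open>j - 1\<close> the value used for the \<open>r\<close>-th summand of member \<open>i\<close> at level \<open>j\<close>.
  The last clause makes the three families mutually independent; \<open>indep_vars\<close> does not apply
  because their values have different types.
\<close>

definition bootstrap_input ::
  "'s measure \<Rightarrow> real measure \<Rightarrow> bvec measure \<Rightarrow> nat \<Rightarrow> (nat \<Rightarrow> 's \<Rightarrow> real) \<Rightarrow>
   (nat \<times> nat \<Rightarrow> 's \<Rightarrow> bvec) \<Rightarrow> (nat \<times> nat \<times> nat \<Rightarrow> 's \<Rightarrow> nat) \<Rightarrow> bool" where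
  "bootstrap_input S LQ L m Q0 W J \<longleftrightarrow>
     (let I0 = {1..m}; IW = {1..} \<times> {1..m}; IJ = {1..} \<times> {1..m} \<times> {1..};
          U = measure_pmf (pmf_of_set {1..m});
          X0 = (\<lambda>\<omega>. \<lambda>i\<in>I0. Q0 i \<omega>); XW = (\<lambda>\<omega>. \<lambda>p\<in>IW. W p \<omega>); XJ = (\<lambda>\<omega>. \<lambda>p\<in>IJ. J p \<omega>);
          M0 = (\<Pi>\<^sub>M i\<in>I0. LQ); MW = (\<Pi>\<^sub>M p\<in>IW. L); MJ = (\<Pi>\<^sub>M p\<in>IJ. U)
      in prob_space S \<and>
         iid_family S LQ Q0 I0 \<and> iid_family S L W IW \<and> iid_family S U J IJ \<and>
         prob_space.indep_sets S
           (\<lambda>n. [generated_events S M0 X0, generated_events S MW XW, generated_events S MJ XJ] ! n)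
           {..<3})"

primrec pool ::
  "(nat \<Rightarrow> real) \<Rightarrow> (nat \<times> nat \<Rightarrow> bvec) \<Rightarrow> (nat \<times> nat \<times> nat \<Rightarrow> nat) \<Rightarrow> nat \<Rightarrow> nat \<Rightarrow> real" where
  "pool q0 w \<iota> 0 i = q0 i"
| "pool q0 w \<iota> (Suc j) i =
     (\<Sum>r=1..Nof (w (Suc j, i)). Cof (w (Suc j, i)) r * pool q0 w \<iota> j (\<iota> (Suc j, i, r)))
     + Qof (w (Suc j, i))"

definition empirical_df :: "nat \<Rightarrow> (nat \<Rightarrow> real) \<Rightarrow> real \<Rightarrow> real" where
  "empirical_df m y x = (\<Sum>i=1..m. if y i \<le> x then 1 else 0) / real m"

definition couplings :: "real measure \<Rightarrow> real measure \<Rightarrow> (real \<times> real) measure set" where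
  "couplings \<mu> \<nu> = {\<pi>. prob_space \<pi> \<and> sets \<pi> = sets (borel \<Otimes>\<^sub>M borel) \<and>
     distr \<pi> borel fst = \<mu> \<and> distr \<pi> borel snd = \<nu>}"

definition KR_dist :: "real measure \<Rightarrow> real measure \<Rightarrow> ennreal" where
  "KR_dist \<mu> \<nu> = (INF \<pi>\<in>couplings \<mu> \<nu>. \<integral>\<^sup>+(x, y). ennreal \<bar>x - y\<bar> \<partial>\<pi>)"

text \<open>
  \<open>interval_measure F\<close> is the probability measure with distribution function \<open>F\<close>.
\<close>

definition d1 :: "(real \<Rightarrow> real) \<Rightarrow> (real \<Rightarrow> real) \<Rightarrow> ennreal" where
  "d1 F G = KR_dist (interval_measure F) (interval_measure G)"

end

theory Submission
  imports Defs
begin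

text \<open>
  The distance is controlled through the area between distribution functions, which dominates
  \<open>d1\<close> by the quantile coupling. Write \<open>\<Phi> \<nu>\<close> for the law of \<open>\<Sum>\<^sub>r C\<^sub>r X\<^sub>r + Q\<close> with the \<open>X\<^sub>r\<close> i.i.d. with
  law \<open>\<nu>\<close>, so that \<open>R\<^bsup>(k)\<^esup>\<close> has law \<open>\<Phi>\<^sup>k\<close> applied to the law of \<open>Q\<close>. Given the pool of level \<open>k\<close> with
  empirical law \<open>\<nu>\<close>, the next pool is an i.i.d. sample from \<open>\<Phi> \<nu>\<close>. Feeding a coupling of \<open>\<nu>\<close> and
  \<open>\<mu>\<close> into the same branching vectors gives, on average, \<open>\<rho>\<^sub>1\<close> times the distance of \<open>\<nu>\<close> and \<open>\<mu>\<close> as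
  an upper bound for the distance to an i.i.d. sample from \<open>\<Phi> \<mu>\<close>. The latter sample
  is at mean distance \<open>O(m\<^bsup>-1+1/\<alpha>\<^esup>)\<close> from \<open>\<Phi> \<mu>\<close>, uniformly in the level, because the \<open>\<alpha>\<close>-th moments of the
  \<open>R\<^bsup>(k)\<^esup>\<close> are bounded. Summing this recursion over the levels gives the geometric sum.
\<close>

subsection \<open>Maps between product measures\<close>

text \<open>The estimates are made for \<open>area_dist\<close>: being an integral over the line, it
  is measurable in the pool and can be exchanged with expectations, which an infimum over couplings
  does not offer directly. The rate has one source: the empirical frequency of an event of
  probability p deviates in mean by at most sqrt(p/m) and by at most 2p. For p of order
  |x|^(-\<alpha>) the two bounds cross, up to constants, at |x| = m^(1/\<alpha>). The delicate point
  is a moment bound uniform in the level. Under (i) the recursion for the \<alpha>-th moment has to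
  contract, so no fixed constant may multiply rho_\<alpha>: the expansion of the \<alpha>-th power
  keeps the diagonal with coefficient 1 and pays for the rest with first moments, and Q is split off
  with an adjustable convex weight. Under (ii) the recursion for first moments does not contract
  because rho_1 = 1; centering makes the summands orthogonal, and the second moment obeys an affine
  recursion with factor rho_2. The spaces of the statement are replaced by product measures built
  from the law of the branching vector. Conditioning on the first k levels is then an application of
  Fubini's theorem.\<close>

lemma indep_vars_PiM_components:
  assumes "I \<noteq> {}" "\<And>i. i \<in> I \<Longrightarrow> prob_space (M i)"
  shows "prob_space.indep_vars (PiM I M) M (\<lambda>i \<omega>. \<omega> i) I"
proof -
  interpret prob_space "PiM I M" using assms by (intro prob_space_PiM) auto
  have "distr (PiM I M) (PiM I M) (\<lambda>x. \<lambda>i\<in>I. x i) = distr (PiM I M) (PiM I M) (\<lambda>x. x)"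
    by (intro distr_cong) (auto simp: space_PiM PiE_def extensional_restrict)
  also have "\<dots> = PiM I (\<lambda>i. distr (PiM I M) (M i) (\<lambda>\<omega>. \<omega> i))"
    by (subst distr_id) (auto intro!: PiM_cong simp: distr_PiM_component assms)
  finally show ?thesis
    using assms by (subst indep_vars_iff_distr_eq_PiM') auto
qed

text \<open>Images of independent coordinates are independent, so the joint law is the product of
  its marginals. Arguing by independence covers infinite index sets such as \<open>{1..}\<close>,
  which occur for the summands of one pool member.\<close>

lemma distr_PiM_map:
  assumes "I \<noteq> {}" and P: "\<And>i. i \<in> I \<Longrightarrow> prob_space (M i)"
    and f: "\<And>i. i \<in> I \<Longrightarrow> f i \<in> measurable (M i) (N i)"
  shows "distr (PiM I M) (PiM I N) (\<lambda>\<omega>. \<lambda>i\<in>I. f i (\<omega> i)) = PiM I (\<lambda>i. distr (M i) (N i) (f i))"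
proof -
  interpret prob_space "PiM I M" using P by (intro prob_space_PiM) auto
  have ind: "indep_vars N (\<lambda>i \<omega>. f i (\<omega> i)) I"
    by (rule indep_vars_compose2[OF indep_vars_PiM_components]) (use assms in auto)
  have rv: "(\<lambda>\<omega>. f i (\<omega> i)) \<in> measurable (PiM I M) (N i)" if "i \<in> I" for i
    using f[OF that] that by (rule measurable_compose[OF measurable_component_singleton, rotated])
  have "distr (PiM I M) (N i) (\<lambda>\<omega>. f i (\<omega> i)) = distr (M i) (N i) (f i)" if "i \<in> I" for i
    using distr_distr[of "f i" "M i" "N i" "\<lambda>\<omega>. \<omega> i" "PiM I M"] f[OF that] that
    by (simp add: comp_def distr_PiM_component P)
  then show ?thesis
    using indep_vars_iff_distr_eq_PiM'[OF assms(1) rv] ind by (simp cong: PiM_cong)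
qed

text \<open>Disjoint blocks of coordinates are independent. This separates old levels of the
  bootstrap from the newest one, and the root of the tree from everything above it.\<close>

lemma distr_PiM_split:
  assumes "I \<noteq> {}" and P: "\<And>i. i \<in> I \<Longrightarrow> prob_space (M i)"
    and AB: "A \<inter> B = {}" "A \<subseteq> I" "B \<subseteq> I"
  shows "distr (PiM I M) (PiM A M \<Otimes>\<^sub>M PiM B M) (\<lambda>\<omega>. (restrict \<omega> A, restrict \<omega> B)) = PiM A M \<Otimes>\<^sub>M PiM B M"
proof -
  interpret prob_space "PiM I M" using P by (intro prob_space_PiM) auto
  have *: "distr (PiM I M) (PiM K M) (\<lambda>\<omega>. restrict \<omega> K) = PiM K M" if "K \<subseteq> I" for K
    using distr_PiM_reindex[of I M "\<lambda>x. x" K, OF P] that by (auto simp: restrict_def)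
  show ?thesis
    using indep_var_restrict[OF indep_vars_PiM_components[OF assms(1) P] AB]
    by (simp add: indep_var_distribution_eq * AB)
qed

text \<open>Injectivity makes the images of \<open>B\<close> under the maps \<open>h a\<close>
  disjoint, hence independent blocks, and each block is an injectively reindexed i.i.d. family. Used
  to sort resampling indices by pool member, and tree vertices by their first-generation
  ancestor.\<close>

lemma distr_PiM_group:
  assumes P: "prob_space L" and "A \<noteq> {}" "B \<noteq> {}"
    and inj: "inj_on (\<lambda>(a, b). h a b) (A \<times> B)" and h: "\<And>a b. a \<in> A \<Longrightarrow> b \<in> B \<Longrightarrow> h a b \<in> I"
  shows "distr (\<Pi>\<^sub>M i\<in>I. L) (\<Pi>\<^sub>M a\<in>A. \<Pi>\<^sub>M b\<in>B. L) (\<lambda>\<omega>. \<lambda>a\<in>A. \<lambda>b\<in>B. \<omega> (h a b)) = (\<Pi>\<^sub>M a\<in>A. \<Pi>\<^sub>M b\<in>B. L)"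
proof -
  interpret prob_space "\<Pi>\<^sub>M i\<in>I. L" using P by (intro prob_space_PiM) auto
  have I: "I \<noteq> {}" using assms by auto
  have hinj: "h a b = h a' b' \<longleftrightarrow> a = a' \<and> b = b'" if "a \<in> A" "a' \<in> A" "b \<in> B" "b' \<in> B" for a a' b b'
    using inj that by (fastforce simp: inj_on_def)
  have "indep_vars (\<lambda>a. \<Pi>\<^sub>M i\<in>h a ` B. L) (\<lambda>a \<omega>. restrict (\<lambda>i. \<omega> i) (h a ` B)) A"
    by (rule indep_vars_restrict[OF indep_vars_PiM_components[OF I P]])
       (use h hinj in \<open>auto simp: disjoint_family_on_def\<close>)
  then have "indep_vars (\<lambda>a. \<Pi>\<^sub>M b\<in>B. L)
      (\<lambda>a \<omega>. (\<lambda>\<omega>'. \<lambda>b\<in>B. \<omega>' (h a b)) (restrict (\<lambda>i. \<omega> i) (h a ` B))) A"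
    by (rule indep_vars_compose2) (rule measurable_restrict, auto)
  also have "?this \<longleftrightarrow> indep_vars (\<lambda>a. \<Pi>\<^sub>M b\<in>B. L) (\<lambda>a \<omega>. \<lambda>b\<in>B. \<omega> (h a b)) A"
    by (intro indep_vars_cong) (auto simp: fun_eq_iff)
  finally have ind: "indep_vars (\<lambda>a. \<Pi>\<^sub>M b\<in>B. L) (\<lambda>a \<omega>. \<lambda>b\<in>B. \<omega> (h a b)) A" .
  have rv: "(\<lambda>\<omega>. \<lambda>b\<in>B. \<omega> (h a b)) \<in> measurable (\<Pi>\<^sub>M i\<in>I. L) (\<Pi>\<^sub>M b\<in>B. L)" if "a \<in> A" for a
    using h that by (auto intro!: measurable_restrict measurable_component_singleton)
  have "distr (\<Pi>\<^sub>M i\<in>I. L) (\<Pi>\<^sub>M b\<in>B. L) (\<lambda>\<omega>. \<lambda>b\<in>B. \<omega> (h a b)) = (\<Pi>\<^sub>M b\<in>B. L)" if "a \<in> A" for a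
    using distr_PiM_reindex[of I "\<lambda>_. L" "h a" B, OF P] h hinj that by (auto simp: inj_on_def)
  then show ?thesis
    using indep_vars_iff_distr_eq_PiM'[OF assms(2) rv] ind by (simp cong: PiM_cong)
qed

text \<open>For finite \<open>I\<close> it suffices to test boxes. The indicator of a box is a
  product over \<open>i\<close>; with \<open>a\<close> fixed its factors depend on different
  coordinates of \<open>b\<close>, and the remaining factors on different coordinates of
  \<open>a\<close>, so both integrals factorize.\<close>

lemma distr_pair_PiM_zip:
  fixes A :: "'a measure" and B :: "'b measure" and I :: "'i set"
  assumes fin: "finite I" and PA: "prob_space A" and PB: "prob_space B"
    and Z[measurable]: "(\<lambda>(a, b). Z a b) \<in> measurable (A \<Otimes>\<^sub>M B) N"
  shows "distr ((\<Pi>\<^sub>M i\<in>I. A) \<Otimes>\<^sub>M (\<Pi>\<^sub>M i\<in>I. B)) (\<Pi>\<^sub>M i\<in>I. N) (\<lambda>(a, b). \<lambda>i\<in>I. Z (a i) (b i))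
       = (\<Pi>\<^sub>M i\<in>I. distr (A \<Otimes>\<^sub>M B) N (\<lambda>(a, b). Z a b))"
proof -
  interpret A: prob_space A by fact
  interpret B: prob_space B by fact
  interpret AB: pair_prob_space A B ..
  interpret PA: product_prob_space "\<lambda>_::'i. A" ..
  interpret PB: product_prob_space "\<lambda>_::'i. B" ..
  interpret PAB: pair_prob_space "\<Pi>\<^sub>M i\<in>I. A" "\<Pi>\<^sub>M i\<in>I. B" ..
  interpret ND: prob_space "distr (A \<Otimes>\<^sub>M B) N (\<lambda>(a, b). Z a b)"
    by (rule AB.prob_space_distr) simp
  interpret PN: product_prob_space "\<lambda>_::'i. distr (A \<Otimes>\<^sub>M B) N (\<lambda>(a, b). Z a b)" ..
  have Zm[measurable (raw)]: "(\<lambda>x. Z (f x) (g x)) \<in> measurable S N"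
    if "f \<in> measurable S A" "g \<in> measurable S B" for f g and S :: "'z measure"
    using measurable_compose[OF measurable_Pair[OF that] Z] by simp
  have m[measurable]: "(\<lambda>(a, b). \<lambda>i\<in>I. Z (a i) (b i)) \<in> measurable ((\<Pi>\<^sub>M i\<in>I. A) \<Otimes>\<^sub>M (\<Pi>\<^sub>M i\<in>I. B)) (\<Pi>\<^sub>M i\<in>I. N)"
    unfolding split_beta by (intro measurable_restrict Zm) measurable
  show ?thesis
  proof (rule PN.PiM_eqI[OF fin])
    show "sets (distr ((\<Pi>\<^sub>M i\<in>I. A) \<Otimes>\<^sub>M (\<Pi>\<^sub>M i\<in>I. B)) (\<Pi>\<^sub>M i\<in>I. N) (\<lambda>(a, b). \<lambda>i\<in>I. Z (a i) (b i)))
      = sets (\<Pi>\<^sub>M i\<in>I. distr (A \<Otimes>\<^sub>M B) N (\<lambda>(a, b). Z a b))"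
      by (simp cong: sets_PiM_cong)
    fix E assume "\<And>i. i \<in> I \<Longrightarrow> E i \<in> sets (distr (A \<Otimes>\<^sub>M B) N (\<lambda>(a, b). Z a b))"
    then have E[measurable]: "E i \<in> sets N" if "i \<in> I" for i using that by simp
    have PE[measurable]: "Pi\<^sub>E I E \<in> sets (\<Pi>\<^sub>M i\<in>I. N)"
      by (intro sets_PiM_I_finite fin) (use E in auto)
    have "emeasure (distr ((\<Pi>\<^sub>M i\<in>I. A) \<Otimes>\<^sub>M (\<Pi>\<^sub>M i\<in>I. B)) (\<Pi>\<^sub>M i\<in>I. N) (\<lambda>(a, b). \<lambda>i\<in>I. Z (a i) (b i))) (Pi\<^sub>E I E)
       = (\<integral>\<^sup>+x. indicator (Pi\<^sub>E I E) ((\<lambda>(a, b). \<lambda>i\<in>I. Z (a i) (b i)) x) \<partial>((\<Pi>\<^sub>M i\<in>I. A) \<Otimes>\<^sub>M (\<Pi>\<^sub>M i\<in>I. B)))"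
      by (subst nn_integral_indicator[symmetric, where M="distr _ _ _"], simp, subst nn_integral_distr) auto
    also have "\<dots> = (\<integral>\<^sup>+a. \<integral>\<^sup>+b. indicator (Pi\<^sub>E I E) (\<lambda>i\<in>I. Z (a i) (b i)) \<partial>(\<Pi>\<^sub>M i\<in>I. B) \<partial>(\<Pi>\<^sub>M i\<in>I. A))"
      by (subst PB.nn_integral_fst[symmetric, where f="\<lambda>x. indicator (Pi\<^sub>E I E) ((\<lambda>(a, b). \<lambda>i\<in>I. Z (a i) (b i)) x)"]) auto
    also have "\<dots> = (\<integral>\<^sup>+a. \<integral>\<^sup>+b. (\<Prod>i\<in>I. indicator (E i) (Z (a i) (b i))) \<partial>(\<Pi>\<^sub>M i\<in>I. B) \<partial>(\<Pi>\<^sub>M i\<in>I. A))"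
      using fin by (intro nn_integral_cong) (auto simp: indicator_def PiE_iff prod_zero_iff Bex_def intro!: prod.neutral)
    also have "\<dots> = (\<integral>\<^sup>+a. (\<Prod>i\<in>I. \<integral>\<^sup>+b. indicator (E i) (Z (a i) b) \<partial>B) \<partial>(\<Pi>\<^sub>M i\<in>I. A))"
    proof (intro nn_integral_cong PB.product_nn_integral_prod fin)
      fix a i assume "a \<in> space (\<Pi>\<^sub>M i\<in>I. A)" "i \<in> I"
      then have [measurable]: "a i \<in> space A" "E i \<in> sets N" by (auto simp: space_PiM)
      show "(\<lambda>b. indicator (E i) (Z (a i) b)) \<in> borel_measurable B" by measurable
    qed
    also have "\<dots> = (\<Prod>i\<in>I. \<integral>\<^sup>+a. \<integral>\<^sup>+b. indicator (E i) (Z a b) \<partial>B \<partial>A)"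
    proof (intro PA.product_nn_integral_prod fin)
      fix i assume "i \<in> I"
      then have [measurable]: "E i \<in> sets N" by auto
      show "(\<lambda>a. \<integral>\<^sup>+b. indicator (E i) (Z a b) \<partial>B) \<in> borel_measurable A" by measurable
    qed
    also have "\<dots> = (\<Prod>i\<in>I. emeasure (distr (A \<Otimes>\<^sub>M B) N (\<lambda>(a, b). Z a b)) (E i))"
    proof (intro prod.cong refl)
      fix i assume "i \<in> I"
      then have [measurable]: "E i \<in> sets N" by auto
      have "emeasure (distr (A \<Otimes>\<^sub>M B) N (\<lambda>(a, b). Z a b)) (E i)
          = (\<integral>\<^sup>+x. indicator (E i) ((\<lambda>(a, b). Z a b) x) \<partial>(A \<Otimes>\<^sub>M B))"
        by (subst nn_integral_indicator[symmetric, where M="distr _ _ _"], simp, subst nn_integral_distr) auto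
      also have "\<dots> = (\<integral>\<^sup>+a. \<integral>\<^sup>+b. indicator (E i) (Z a b) \<partial>B \<partial>A)"
        by (subst B.nn_integral_fst[symmetric, where f="\<lambda>x. indicator (E i) ((\<lambda>(a, b). Z a b) x)"]) auto
      finally show "(\<integral>\<^sup>+a. \<integral>\<^sup>+b. indicator (E i) (Z a b) \<partial>B \<partial>A)
        = emeasure (distr (A \<Otimes>\<^sub>M B) N (\<lambda>(a, b). Z a b)) (E i)" by simp
    qed
    finally show "emeasure (distr ((\<Pi>\<^sub>M i\<in>I. A) \<Otimes>\<^sub>M (\<Pi>\<^sub>M i\<in>I. B)) (\<Pi>\<^sub>M i\<in>I. N) (\<lambda>(a, b). \<lambda>i\<in>I. Z (a i) (b i))) (Pi\<^sub>E I E)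
      = (\<Prod>i\<in>I. emeasure (distr (A \<Otimes>\<^sub>M B) N (\<lambda>(a, b). Z a b)) (E i))" .
  qed
qed

subsection \<open>The area between distribution functions\<close>

text \<open>The L1 distance of distribution functions, which is the explicit form of the
  Kantorovich-Rubinstein distance on the line.\<close>

definition area_dist :: "(real \<Rightarrow> real) \<Rightarrow> (real \<Rightarrow> real) \<Rightarrow> ennreal" where
  "area_dist F G = (\<integral>\<^sup>+x. ennreal \<bar>F x - G x\<bar> \<partial>lborel)"

lemma area_dist_triangle:
  assumes [measurable]: "F \<in> borel_measurable borel" "G \<in> borel_measurable borel" "H \<in> borel_measurable borel"
  shows "area_dist F H \<le> area_dist F G + area_dist G H"
proof -
  have "area_dist F H \<le> (\<integral>\<^sup>+x. ennreal \<bar>F x - G x\<bar> + ennreal \<bar>G x - H x\<bar> \<partial>lborel)"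
    unfolding area_dist_def by (intro nn_integral_mono) (simp flip: ennreal_plus)
  also have "\<dots> = area_dist F G + area_dist G H"
    unfolding area_dist_def by (rule nn_integral_add) auto
  finally show ?thesis .
qed

text \<open>The two step functions differ exactly on the interval between \<open>a\<close> and
  \<open>b\<close>. This turns distances of points into areas, for the cost of a coupling as well as
  for empirical distribution functions.\<close>

lemma nn_integral_abs_indicator_diff:
  fixes a b :: real
  shows "(\<integral>\<^sup>+x. ennreal \<bar>indicator {a..} x - indicator {b..} x\<bar> \<partial>lborel) = ennreal \<bar>a - b\<bar>"
proof (induction a b rule: linorder_wlog)
  case (le a b)
  have "(\<integral>\<^sup>+x. ennreal \<bar>indicator {a..} x - indicator {b..} x\<bar> \<partial>lborel) = (\<integral>\<^sup>+x. indicator {a..<b} x \<partial>lborel)"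
    using le by (intro nn_integral_cong) (auto simp: indicator_def)
  also have "\<dots> = ennreal \<bar>a - b\<bar>" using le by simp
  finally show ?case .
next
  case (sym a b)
  then show ?case by (simp add: abs_minus_commute)
qed

lemma (in finite_borel_measure) borel_measurable_cdf [measurable]: "cdf M \<in> borel_measurable borel"
  by (intro borel_measurable_mono monoI cdf_nondecreasing)

text \<open>
  The quantile functions of both laws are evaluated at the same uniform variable; the cost is then
  the area between the two graphs, computed along the other axis.
\<close>

lemma quantile_coupling:
  assumes \<mu>: "real_distribution \<mu>" and \<nu>: "real_distribution \<nu>"
  obtains \<pi> where "\<pi> \<in> couplings \<mu> \<nu>"
    and "(\<integral>\<^sup>+(x, y). ennreal \<bar>x - y\<bar> \<partial>\<pi>) = area_dist (cdf \<mu>) (cdf \<nu>)"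
proof -
  interpret \<mu>: cdf_distribution \<mu> unfolding cdf_distribution_def by fact
  interpret \<nu>: cdf_distribution \<nu> unfolding cdf_distribution_def by fact
  let ?\<Omega> = "restrict_space lborel {0<..<1} :: real measure"
  interpret \<Omega>: prob_space ?\<Omega>
    by (auto simp add: emeasure_restrict_space space_restrict_space intro!: prob_spaceI)
  let ?X = "\<lambda>u. Inf {x. u \<le> cdf \<mu> x}" and ?Y = "\<lambda>u. Inf {x. u \<le> cdf \<nu> x}"
  have X[measurable]: "?X \<in> borel_measurable ?\<Omega>" and Y[measurable]: "?Y \<in> borel_measurable ?\<Omega>"
    using \<mu>.measurable_CI \<nu>.measurable_CI by (simp_all cong: measurable_cong_sets)
  define \<pi> where "\<pi> = distr ?\<Omega> (borel \<Otimes>\<^sub>M borel) (\<lambda>u. (?X u, ?Y u))"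
  have "prob_space \<pi>" unfolding \<pi>_def by (rule \<Omega>.prob_space_distr) simp
  moreover have "distr \<pi> borel fst = \<mu>" "distr \<pi> borel snd = \<nu>"
    unfolding \<pi>_def by (subst distr_distr; simp add: comp_def \<mu>.distr_I_eq_M \<nu>.distr_I_eq_M)+
  ultimately have "\<pi> \<in> couplings \<mu> \<nu>" by (simp add: couplings_def \<pi>_def)
  interpret P: pair_sigma_finite ?\<Omega> lborel ..
  have "(\<integral>\<^sup>+(x, y). ennreal \<bar>x - y\<bar> \<partial>\<pi>) = (\<integral>\<^sup>+u. ennreal \<bar>?X u - ?Y u\<bar> \<partial>?\<Omega>)"
    unfolding \<pi>_def by (subst nn_integral_distr) auto
  also have "\<dots> = (\<integral>\<^sup>+u. \<integral>\<^sup>+x. ennreal \<bar>indicator {?X u..} x - indicator {?Y u..} x\<bar> \<partial>lborel \<partial>?\<Omega>)"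
    by (simp add: nn_integral_abs_indicator_diff)
  \<comment> \<open>The quantile function and the distribution function form a Galois connection:
    \<open>?X u \<le> x\<close> iff \<open>u \<le> cdf \<mu> x\<close>. The integrand thereby
    becomes an indicator difference in \<open>u\<close>, ready for Fubini.\<close>
  also have "\<dots> = (\<integral>\<^sup>+u. \<integral>\<^sup>+x. ennreal \<bar>indicator {..cdf \<mu> x} u - indicator {..cdf \<nu> x} u\<bar> \<partial>lborel \<partial>?\<Omega>)"
  proof (intro nn_integral_cong)
    fix u x :: real assume "u \<in> space ?\<Omega>"
    then have "?X u \<le> x \<longleftrightarrow> u \<le> cdf \<mu> x" "?Y u \<le> x \<longleftrightarrow> u \<le> cdf \<nu> x"
      using \<mu>.pseudoinverse[of u x] \<nu>.pseudoinverse[of u x] by (simp_all only: space_restrict_space) auto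
    then show "ennreal \<bar>indicator {?X u..} x - indicator {?Y u..} x\<bar>
        = ennreal \<bar>indicator {..cdf \<mu> x} u - indicator {..cdf \<nu> x} u\<bar>"
      by (simp only: indicator_def atLeast_iff atMost_iff)
  qed
  also have "\<dots> = (\<integral>\<^sup>+x. \<integral>\<^sup>+u. ennreal \<bar>indicator {..cdf \<mu> x} u - indicator {..cdf \<nu> x} u\<bar> \<partial>?\<Omega> \<partial>lborel)"
  proof (rule P.Fubini'[symmetric])
    have [measurable]: "(\<lambda>x. fst x) \<in> borel_measurable (?\<Omega> \<Otimes>\<^sub>M lborel)"
      by (rule measurable_compose[OF measurable_fst]) (simp add: measurable_restrict_space1)
    show "(\<lambda>(u, x). ennreal \<bar>indicator {..cdf \<mu> x} u - indicator {..cdf \<nu> x} u\<bar>) \<in> borel_measurable (?\<Omega> \<Otimes>\<^sub>M lborel)"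
      unfolding split_beta indicator_def atMost_iff by measurable
  qed
  also have "\<dots> = (\<integral>\<^sup>+x. ennreal \<bar>cdf \<mu> x - cdf \<nu> x\<bar> \<partial>lborel)"
  proof (rule nn_integral_cong)
    fix x
    have *: "(\<integral>\<^sup>+u. ennreal \<bar>indicator {..a} u - indicator {..b} u\<bar> \<partial>?\<Omega>) = ennreal \<bar>a - b\<bar>"
      if "0 \<le> a" "a \<le> 1" "0 \<le> b" "b \<le> 1" for a b :: real
      using that
    proof (induction a b rule: linorder_wlog)
      case (le a b)
      have "(\<integral>\<^sup>+u. ennreal \<bar>indicator {..a} u - indicator {..b} u\<bar> \<partial>?\<Omega>)
         = (\<integral>\<^sup>+u. ennreal \<bar>indicator {..a} u - indicator {..b} u\<bar> * indicator {0<..<1} u \<partial>lborel)"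
        by (subst nn_integral_restrict_space) auto
      \<comment> \<open>If \<open>b = 1\<close>, the interval contains the endpoint 1 that the open
        unit interval omits; a single point is a null set.\<close>
      also have "\<dots> = (\<integral>\<^sup>+u. indicator {a<..b} u \<partial>lborel)"
        using le AE_lborel_singleton[of 1] by (intro nn_integral_cong_AE) (auto simp: indicator_def)
      also have "\<dots> = ennreal \<bar>a - b\<bar>" using le by simp
      finally show ?case .
    next
      case (sym a b)
      then show ?case by (simp add: abs_minus_commute)
    qed
    show "(\<integral>\<^sup>+u. ennreal \<bar>indicator {..cdf \<mu> x} u - indicator {..cdf \<nu> x} u\<bar> \<partial>?\<Omega>) = ennreal \<bar>cdf \<mu> x - cdf \<nu> x\<bar>"
      by (rule *) (auto simp: \<mu>.cdf_nonneg \<nu>.cdf_nonneg \<mu>.cdf_bounded_prob \<nu>.cdf_bounded_prob)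
  qed
  finally have "(\<integral>\<^sup>+(x, y). ennreal \<bar>x - y\<bar> \<partial>\<pi>) = area_dist (cdf \<mu>) (cdf \<nu>)" by (simp add: area_dist_def)
  with \<open>\<pi> \<in> couplings \<mu> \<nu>\<close> show thesis by (rule that)
qed

lemma interval_measure_cdf:
  assumes "real_distribution \<mu>"
  shows "interval_measure (cdf \<mu>) = \<mu>"
proof -
  interpret real_distribution \<mu> by fact
  show ?thesis
    using cdf_nondecreasing cdf_is_right_cont cdf_lim_at_top_prob cdf_lim_at_bot
    by (intro cdf_unique assms cdf_interval_measure real_distribution_interval_measure) auto
qed

lemma d1_le_area_dist:
  assumes "real_distribution \<mu>" "real_distribution \<nu>"
  shows "d1 (cdf \<mu>) (cdf \<nu>) \<le> area_dist (cdf \<mu>) (cdf \<nu>)"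
proof -
  obtain \<pi> where "\<pi> \<in> couplings \<mu> \<nu>" "(\<integral>\<^sup>+(x, y). ennreal \<bar>x - y\<bar> \<partial>\<pi>) = area_dist (cdf \<mu>) (cdf \<nu>)"
    by (rule quantile_coupling[OF assms])
  then show ?thesis
    unfolding d1_def KR_dist_def interval_measure_cdf[OF assms(1)] interval_measure_cdf[OF assms(2)]
    by (intro INF_lower2) auto
qed

text \<open>Written as the image of a uniform index, so that resampling with replacement from the
  pool \<open>y\<close> is literally i.i.d. sampling from this law.\<close>

definition emp_law :: "nat \<Rightarrow> (nat \<Rightarrow> real) \<Rightarrow> real measure" where
  "emp_law m y = distr (measure_pmf (pmf_of_set {1..m})) borel y"

lemma real_distribution_emp_law [simp]: "real_distribution (emp_law m y)"
  unfolding emp_law_def by (rule prob_space.real_distribution_distr[OF prob_space_measure_pmf]) simp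

lemma cdf_emp_law:
  assumes "m \<ge> 1"
  shows "cdf (emp_law m y) = empirical_df m y"
proof
  fix x
  have "cdf (emp_law m y) x = measure (measure_pmf (pmf_of_set {1..m})) {i. y i \<le> x}"
    unfolding cdf_def emp_law_def by (subst measure_distr) (auto intro!: arg_cong2[where f=measure])
  also have "\<dots> = real (card ({1..m} \<inter> {i. y i \<le> x})) / real m"
    using assms by (subst measure_pmf_of_set) auto
  also have "\<dots> = empirical_df m y x"
    by (simp add: empirical_df_def sum.If_cases)
  finally show "cdf (emp_law m y) x = empirical_df m y x" .
qed

lemma empirical_df_measurable [measurable (raw)]:
  assumes [measurable]: "\<And>i. i \<in> {1..m} \<Longrightarrow> (\<lambda>\<omega>. y \<omega> i) \<in> borel_measurable M" "f \<in> borel_measurable M"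
  shows "(\<lambda>\<omega>. empirical_df m (y \<omega>) (f \<omega>)) \<in> borel_measurable M"
  unfolding empirical_df_def by measurable

text \<open>Members with equal index are paired. At each \<open>x\<close> the difference of the two
  step functions is at most the average of the differences of single steps, and a single pair of
  steps encloses the area \<open>\<bar>y i - z i\<bar>\<close>.\<close>

lemma area_dist_empirical_le:
  "area_dist (empirical_df m y) (empirical_df m z) \<le> (\<Sum>i=1..m. ennreal \<bar>y i - z i\<bar>) / of_nat m"
proof (cases "m = 0")
  case False
  have "area_dist (empirical_df m y) (empirical_df m z)
      \<le> (\<integral>\<^sup>+x. (\<Sum>i=1..m. ennreal \<bar>indicator {y i..} x - indicator {z i..} x\<bar>) / of_nat m \<partial>lborel)"
    unfolding area_dist_def
  proof (intro nn_integral_mono)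
    fix x
    have "\<bar>empirical_df m y x - empirical_df m z x\<bar>
      = \<bar>\<Sum>i=1..m. indicator {y i..} x - indicator {z i..} x\<bar> / real m"
      by (simp add: empirical_df_def indicator_def sum_subtractf of_bool_def flip: diff_divide_distrib)
    also have "\<dots> \<le> (\<Sum>i=1..m. \<bar>indicator {y i..} x - indicator {z i..} x\<bar>) / real m"
      by (intro divide_right_mono sum_abs) simp
    finally show "ennreal \<bar>empirical_df m y x - empirical_df m z x\<bar>
      \<le> (\<Sum>i=1..m. ennreal \<bar>indicator {y i..} x - indicator {z i..} x\<bar>) / of_nat m"
      using False by (subst sum_ennreal, simp)
        (simp add: ennreal_of_nat_eq_real_of_nat divide_ennreal sum_nonneg ennreal_leI)
  qed
  also have "\<dots> = (\<Sum>i=1..m. ennreal \<bar>y i - z i\<bar>) / of_nat m"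
    by (subst nn_integral_divide, measurable)
       (simp add: nn_integral_sum nn_integral_abs_indicator_diff del: sum_ennreal)
  finally show ?thesis .
qed (simp add: area_dist_def empirical_df_def)

lemma area_dist_measurable [measurable (raw)]:
  assumes [measurable]: "(\<lambda>(\<omega>, x). F \<omega> x) \<in> borel_measurable (M \<Otimes>\<^sub>M lborel)" "G \<in> borel_measurable borel"
  shows "(\<lambda>\<omega>. area_dist (F \<omega>) G) \<in> borel_measurable M"
  unfolding area_dist_def by measurable

lemma empirical_df_cong: "(\<And>i. i \<in> {1..m} \<Longrightarrow> y i = z i) \<Longrightarrow> empirical_df m y = empirical_df m z"
  by (auto simp: empirical_df_def fun_eq_iff intro!: arg_cong2[where f="(/)"] sum.cong)

lemma empirical_df_restrict: "empirical_df m (restrict y {1..m}) = empirical_df m y"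
  by (rule empirical_df_cong) simp

lemma empirical_area_dist_measurable:
  assumes F: "F \<in> borel_measurable borel"
  shows "(\<lambda>z. area_dist (empirical_df m z) F) \<in> borel_measurable (\<Pi>\<^sub>M i\<in>{1..m}. borel)"
  by (intro area_dist_measurable F)
     (auto simp: split_beta intro!: empirical_df_measurable measurable_compose[OF measurable_fst measurable_component_singleton])

subsection \<open>Empirical distributions of i.i.d. samples\<close>

lemma nn_integral_PiM_component:
  assumes "prob_space \<mu>" "i \<in> I" and [measurable]: "f \<in> borel_measurable \<mu>"
  shows "(\<integral>\<^sup>+\<omega>. f (\<omega> i) \<partial>(\<Pi>\<^sub>M i\<in>I. \<mu>)) = (\<integral>\<^sup>+x. f x \<partial>\<mu>)"
proof -
  have "(\<integral>\<^sup>+x. f x \<partial>\<mu>) = (\<integral>\<^sup>+x. f x \<partial>distr (\<Pi>\<^sub>M i\<in>I. \<mu>) \<mu> (\<lambda>\<omega>. \<omega> i))"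
    using assms by (subst distr_PiM_component) auto
  also have "\<dots> = (\<integral>\<^sup>+\<omega>. f (\<omega> i) \<partial>(\<Pi>\<^sub>M i\<in>I. \<mu>))"
    using \<open>i \<in> I\<close> by (subst nn_integral_distr) auto
  finally show ?thesis by simp
qed

lemma
  fixes f :: "'a \<Rightarrow> real"
  assumes "prob_space \<mu>" "i \<in> I" and f: "integrable \<mu> f"
  shows integrable_PiM_component: "integrable (\<Pi>\<^sub>M i\<in>I. \<mu>) (\<lambda>\<omega>. f (\<omega> i))"
    and integral_PiM_component: "(\<integral>\<omega>. f (\<omega> i) \<partial>(\<Pi>\<^sub>M i\<in>I. \<mu>)) = (\<integral>x. f x \<partial>\<mu>)"
proof -
  have \<mu>: "\<mu> = distr (\<Pi>\<^sub>M i\<in>I. \<mu>) \<mu> (\<lambda>\<omega>. \<omega> i)"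
    using assms by (subst distr_PiM_component) auto
  have [measurable]: "f \<in> borel_measurable \<mu>" using f by simp
  have c: "(\<lambda>\<omega>. \<omega> i) \<in> measurable (\<Pi>\<^sub>M i\<in>I. \<mu>) \<mu>" using \<open>i \<in> I\<close> by simp
  show "integrable (\<Pi>\<^sub>M i\<in>I. \<mu>) (\<lambda>\<omega>. f (\<omega> i))"
    using f integrable_distr[OF c, of f] \<mu> by simp
  show "(\<integral>\<omega>. f (\<omega> i) \<partial>(\<Pi>\<^sub>M i\<in>I. \<mu>)) = (\<integral>x. f x \<partial>\<mu>)"
    using integral_distr[OF c, of f] \<mu> by simp
qed

lemma indep_vars_PiM_pair:
  assumes "prob_space \<mu>" "i \<in> I" "j \<in> I" and f: "f \<in> measurable \<mu> N"
  shows "prob_space.indep_vars (\<Pi>\<^sub>M i\<in>I. \<mu>) (\<lambda>_. N) (\<lambda>i \<omega>. f (\<omega> i)) {i, j}"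
proof -
  interpret prob_space "\<Pi>\<^sub>M i\<in>I. \<mu>" using assms by (intro prob_space_PiM) auto
  show ?thesis
    using indep_vars_subset[OF indep_vars_PiM_components[of I "\<lambda>_. \<mu>"], of "{i, j}"] assms
    by (intro indep_vars_compose2[where M'="\<lambda>_. \<mu>" and X="\<lambda>i \<omega>. \<omega> i" and Y="\<lambda>_. f"]) auto
qed

lemma nn_integral_PiM_pair:
  fixes f :: "'a \<Rightarrow> ennreal"
  assumes \<mu>: "prob_space \<mu>" and ij: "i \<in> I" "j \<in> I" "i \<noteq> j" and f: "f \<in> borel_measurable \<mu>"
  shows "(\<integral>\<^sup>+\<omega>. f (\<omega> i) * f (\<omega> j) \<partial>(\<Pi>\<^sub>M i\<in>I. \<mu>)) = (\<integral>\<^sup>+x. f x \<partial>\<mu>) * (\<integral>\<^sup>+x. f x \<partial>\<mu>)"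
proof -
  interpret prob_space "\<Pi>\<^sub>M i\<in>I. \<mu>" using \<mu> by (intro prob_space_PiM) auto
  show ?thesis
    using indep_vars_nn_integral[OF _ indep_vars_PiM_pair[OF \<mu> ij(1,2) f]] ij
    by (simp add: nn_integral_PiM_component[OF \<mu> _ f])
qed

lemma
  fixes f :: "'a \<Rightarrow> real"
  assumes \<mu>: "prob_space \<mu>" and ij: "i \<in> I" "j \<in> I" "i \<noteq> j" and f: "integrable \<mu> f"
  shows integral_PiM_pair: "(\<integral>\<omega>. f (\<omega> i) * f (\<omega> j) \<partial>(\<Pi>\<^sub>M i\<in>I. \<mu>)) = (\<integral>x. f x \<partial>\<mu>) * (\<integral>x. f x \<partial>\<mu>)"
    and integrable_PiM_pair: "integrable (\<Pi>\<^sub>M i\<in>I. \<mu>) (\<lambda>\<omega>. f (\<omega> i) * f (\<omega> j))"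
proof -
  interpret prob_space "\<Pi>\<^sub>M i\<in>I. \<mu>" using \<mu> by (intro prob_space_PiM) auto
  have int: "integrable (\<Pi>\<^sub>M i\<in>I. \<mu>) (\<lambda>\<omega>. f (\<omega> k))" if "k \<in> {i, j}" for k
    using integrable_PiM_component[OF \<mu> _ f] ij that by auto
  have ind: "indep_vars (\<lambda>_. borel) (\<lambda>i \<omega>. f (\<omega> i)) {i, j}"
    using f by (intro indep_vars_PiM_pair[OF \<mu> ij(1,2)]) auto
  show "(\<integral>\<omega>. f (\<omega> i) * f (\<omega> j) \<partial>(\<Pi>\<^sub>M i\<in>I. \<mu>)) = (\<integral>x. f x \<partial>\<mu>) * (\<integral>x. f x \<partial>\<mu>)"
    using indep_vars_lebesgue_integral[OF _ ind int] ij by (simp add: integral_PiM_component[OF \<mu> _ f])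
  show "integrable (\<Pi>\<^sub>M i\<in>I. \<mu>) (\<lambda>\<omega>. f (\<omega> i) * f (\<omega> j))"
    using indep_vars_integrable[OF _ ind int] ij by simp
qed

text \<open>Independent centered variables are orthogonal, so the cross terms vanish. Two uses: the
  variance of an empirical frequency (\<open>c i = 1/m\<close>, \<open>q = 0\<close>) and the second
  moment of the smoothing transform (\<open>c\<close> the coefficients, \<open>q\<close> the value
  of Q). Integrability is carried through the induction because splitting the integral requires
  it.\<close>

lemma
  fixes f :: "'a \<Rightarrow> real" and c :: "'i \<Rightarrow> real"
  assumes \<mu>: "prob_space \<mu>" and J: "finite J" "J \<subseteq> I" and [measurable]: "f \<in> borel_measurable \<mu>"
    and f2: "integrable \<mu> (\<lambda>x. (f x)\<^sup>2)" and f0: "(\<integral>x. f x \<partial>\<mu>) = 0"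
  shows integrable_square_sum_PiM: "integrable (\<Pi>\<^sub>M i\<in>I. \<mu>) (\<lambda>\<omega>. ((\<Sum>i\<in>J. c i * f (\<omega> i)) + q)\<^sup>2)" (is ?int)
    and integral_square_sum_PiM: "(\<integral>\<omega>. ((\<Sum>i\<in>J. c i * f (\<omega> i)) + q)\<^sup>2 \<partial>(\<Pi>\<^sub>M i\<in>I. \<mu>))
      = (\<Sum>i\<in>J. (c i)\<^sup>2) * (\<integral>x. (f x)\<^sup>2 \<partial>\<mu>) + q\<^sup>2" (is ?eq)
proof -
  let ?P = "\<Pi>\<^sub>M i\<in>I. \<mu>"
  interpret prob_space ?P using \<mu> by (intro prob_space_PiM) auto
  interpret \<mu>: prob_space \<mu> by fact
  have f1: "integrable \<mu> f" by (rule \<mu>.square_integrable_imp_integrable[OF _ f2]) simp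
  have "?int \<and> ?eq" using J
  proof (induction J rule: finite_induct)
    case empty
    then show ?case by (simp add: prob_space)
  next
    case (insert k J)
    let ?S = "\<lambda>\<omega>. (\<Sum>i\<in>J. c i * f (\<omega> i)) + q"
    have k: "k \<in> I" "\<And>i. i \<in> J \<Longrightarrow> i \<in> I \<and> i \<noteq> k" using insert by auto
    have IH: "integrable ?P (\<lambda>\<omega>. (?S \<omega>)\<^sup>2)" "(\<integral>\<omega>. (?S \<omega>)\<^sup>2 \<partial>?P) = (\<Sum>i\<in>J. (c i)\<^sup>2) * (\<integral>x. (f x)\<^sup>2 \<partial>\<mu>) + q\<^sup>2"
      using insert by auto
    have cross: "(\<lambda>\<omega>. f (\<omega> k) * ?S \<omega>) = (\<lambda>\<omega>. (\<Sum>i\<in>J. c i * (f (\<omega> i) * f (\<omega> k))) + q * f (\<omega> k))"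
      by (auto simp: fun_eq_iff algebra_simps sum_distrib_left)
    have cross_int: "integrable ?P (\<lambda>\<omega>. f (\<omega> k) * ?S \<omega>)"
      unfolding cross using k
      by (intro Bochner_Integration.integrable_add Bochner_Integration.integrable_sum integrable_mult_right
          integrable_PiM_pair[OF \<mu>] integrable_PiM_component[OF \<mu>] f1) auto
    have pair: "integrable ?P (\<lambda>\<omega>. f (\<omega> i) * f (\<omega> k))" "(\<integral>\<omega>. f (\<omega> i) * f (\<omega> k) \<partial>?P) = 0" if "i \<in> J" for i
      using k(1) k(2)[OF that] integrable_PiM_pair[OF \<mu> _ _ _ f1] integral_PiM_pair[OF \<mu> _ _ _ f1] f0 by auto
    have cross0: "(\<integral>\<omega>. f (\<omega> k) * ?S \<omega> \<partial>?P) = 0"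
      unfolding cross using pair k integrable_PiM_component[OF \<mu> k(1) f1] integral_PiM_component[OF \<mu> k(1) f1] f0
      by (simp add: Bochner_Integration.integral_sum)
    have sq: "(\<lambda>\<omega>. ((\<Sum>i\<in>insert k J. c i * f (\<omega> i)) + q)\<^sup>2)
        = (\<lambda>\<omega>. (c k)\<^sup>2 * (f (\<omega> k))\<^sup>2 + 2 * c k * (f (\<omega> k) * ?S \<omega>) + (?S \<omega>)\<^sup>2)"
      using insert by (auto simp: fun_eq_iff power2_eq_square algebra_simps)
    note fk = integrable_PiM_component[OF \<mu> k(1) f2] integral_PiM_component[OF \<mu> k(1) f2]
    have "integrable ?P (\<lambda>\<omega>. ((\<Sum>i\<in>insert k J. c i * f (\<omega> i)) + q)\<^sup>2)"
      unfolding sq by (intro Bochner_Integration.integrable_add integrable_mult_right fk cross_int IH)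
    moreover have "(\<integral>\<omega>. ((\<Sum>i\<in>insert k J. c i * f (\<omega> i)) + q)\<^sup>2 \<partial>?P)
        = (c k)\<^sup>2 * (\<integral>x. (f x)\<^sup>2 \<partial>\<mu>) + ((\<Sum>i\<in>J. (c i)\<^sup>2) * (\<integral>x. (f x)\<^sup>2 \<partial>\<mu>) + q\<^sup>2)"
    proof -
      have A: "integrable ?P (\<lambda>\<omega>. (c k)\<^sup>2 * (f (\<omega> k))\<^sup>2)" by (intro integrable_mult_right fk)
      have B: "integrable ?P (\<lambda>\<omega>. 2 * c k * (f (\<omega> k) * ?S \<omega>))" by (intro integrable_mult_right cross_int)
      show ?thesis
        unfolding sq Bochner_Integration.integral_add[OF Bochner_Integration.integrable_add[OF A B] IH(1)]
          Bochner_Integration.integral_add[OF A B] IH(2)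
        by (simp only: integral_mult_right_zero fk cross0 mult_zero_right add_0_right add.assoc)
    qed
    ultimately show ?case using insert by (simp add: algebra_simps)
  qed
  then show ?int ?eq by auto
qed

text \<open>Nonnegativity of the variance of \<open>\<bar>X\<bar>\<close>.\<close>

lemma (in prob_space) expectation_abs_le_sqrt:
  fixes X :: "'a \<Rightarrow> real"
  assumes "X \<in> borel_measurable M" "integrable M (\<lambda>\<omega>. (X \<omega>)\<^sup>2)"
  shows "expectation (\<lambda>\<omega>. \<bar>X \<omega>\<bar>) \<le> sqrt (expectation (\<lambda>\<omega>. (X \<omega>)\<^sup>2))"
proof -
  have "integrable M X" by (rule square_integrable_imp_integrable) fact+
  then have "variance (\<lambda>\<omega>. \<bar>X \<omega>\<bar>) = expectation (\<lambda>\<omega>. (X \<omega>)\<^sup>2) - (expectation (\<lambda>\<omega>. \<bar>X \<omega>\<bar>))\<^sup>2"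
    using assms by (subst variance_eq) auto
  with variance_positive[of "\<lambda>\<omega>. \<bar>X \<omega>\<bar>"] show ?thesis
    by (intro real_le_rsqrt) simp
qed

text \<open>The first bound is the triangle inequality: frequency and probability both have mean p.
  The second is the standard deviation, as the variance p(1-p)/m is at most p/m. The first one is
  the better of the two when 4p is below 1/m, that is, far out in the tails.\<close>

lemma empirical_frequency_deviation:
  fixes \<mu> :: "'a measure"
  assumes \<mu>: "prob_space \<mu>" and [measurable]: "A \<in> sets \<mu>" and m: "m \<ge> 1"
  defines "dev \<equiv> (\<integral>\<^sup>+z. ennreal \<bar>(\<Sum>i=1..m. indicator A (z i)) / real m - measure \<mu> A\<bar> \<partial>(\<Pi>\<^sub>M i\<in>{1..m}. \<mu>))"
  shows "dev \<le> ennreal (2 * measure \<mu> A)" "dev \<le> ennreal (sqrt (measure \<mu> A / m))"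
proof -
  let ?P = "\<Pi>\<^sub>M i\<in>{1..m}. \<mu>" and ?p = "measure \<mu> A"
  interpret \<mu>: prob_space \<mu> by fact
  interpret prob_space ?P using \<mu> by (intro prob_space_PiM) auto
  have pm[measurable]: "(\<lambda>z. z i) \<in> measurable ?P \<mu>" if "i \<in> {1..m}" for i using that by simp
  have "dev \<le> (\<integral>\<^sup>+z. (\<Sum>i=1..m. ennreal (inverse m) * indicator A (z i)) + ennreal ?p \<partial>?P)"
    unfolding dev_def
  proof (intro nn_integral_mono)
    fix z
    have "\<bar>(\<Sum>i=1..m. indicator A (z i)) / real m - ?p\<bar> \<le> (\<Sum>i=1..m. inverse m * indicator A (z i)) + ?p"
      using m by (simp add: field_simps sum_nonneg abs_le_iff flip: sum_distrib_left sum_divide_distrib)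
    then have "ennreal \<bar>(\<Sum>i=1..m. indicator A (z i)) / real m - ?p\<bar>
        \<le> ennreal ((\<Sum>i=1..m. inverse m * indicator A (z i)) + ?p)" by (rule ennreal_leI)
    also have "\<dots> = (\<Sum>i=1..m. ennreal (inverse m * indicator A (z i))) + ennreal ?p"
      by (subst sum_ennreal) (auto intro!: ennreal_plus sum_nonneg)
    also have "\<dots> = (\<Sum>i=1..m. ennreal (inverse m) * indicator A (z i)) + ennreal ?p"
      by (simp only: ennreal_mult ennreal_indicator indicator_pos_le inverse_nonnegative_iff_nonnegative of_nat_0_le_iff)
    finally show "ennreal \<bar>(\<Sum>i=1..m. indicator A (z i)) / real m - ?p\<bar>
        \<le> (\<Sum>i=1..m. ennreal (inverse m) * indicator A (z i)) + ennreal ?p" .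
  qed
  also have "\<dots> = (\<Sum>i=1..m. ennreal (inverse m) * emeasure \<mu> A) + ennreal ?p"
  proof -
    have "(\<integral>\<^sup>+z. ennreal (inverse m) * indicator A (z i) \<partial>?P) = ennreal (inverse m) * emeasure \<mu> A" if "i \<in> {1..m}" for i
      using that by (simp add: nn_integral_cmult nn_integral_PiM_component[OF \<mu>, where f="indicator A"])
    moreover have M: "(\<lambda>z. ennreal (inverse m) * indicator A (z i)) \<in> borel_measurable ?P" if "i \<in> {1..m}" for i
      by (intro borel_measurable_times_ennreal borel_measurable_const
          measurable_compose[OF pm[OF that] borel_measurable_indicator[OF \<open>A \<in> sets \<mu>\<close>]])
    ultimately have "(\<Sum>i=1..m. \<integral>\<^sup>+z. ennreal (inverse m) * indicator A (z i) \<partial>?P) = (\<Sum>i=1..m. ennreal (inverse m) * emeasure \<mu> A)"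
      by (intro sum.cong refl)
    moreover have "(\<integral>\<^sup>+z. ennreal ?p \<partial>?P) = ennreal ?p"
      by (simp only: nn_integral_const emeasure_space_1 mult_1_right)
    ultimately show ?thesis
      using nn_integral_add[OF borel_measurable_sum[OF M] borel_measurable_const[of "ennreal ?p"], of "{1..m}" "\<lambda>i. i"] nn_integral_sum[OF M, of "{1..m}" "\<lambda>i. i"]
      by presburger
  qed
  also have "\<dots> = ennreal (2 * ?p)"
    using m by (simp add: \<mu>.emeasure_eq_measure ennreal_of_nat_eq_real_of_nat mult.assoc[symmetric]
        flip: ennreal_mult ennreal_plus)
  finally show "dev \<le> ennreal (2 * ?p)" .

  let ?f = "\<lambda>x. indicator A x - ?p"
  have [simp]: "integrable \<mu> (indicat_real A)" by (simp add: integrable_indicator_iff \<mu>.emeasure_eq_measure)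
  \<comment> \<open>Idempotence of the indicator makes the square affine in it, which yields both
    integrability and the variance.\<close>
  have sq: "(?f x)\<^sup>2 = (1 - 2 * ?p) * indicat_real A x + ?p\<^sup>2" for x
    by (simp add: indicator_def power2_eq_square algebra_simps)
  have f2: "integrable \<mu> (\<lambda>x. (?f x)\<^sup>2)" unfolding sq by simp
  have f0: "(\<integral>x. ?f x \<partial>\<mu>) = 0" by (simp add: \<mu>.prob_space)
  have v: "(\<integral>x. (?f x)\<^sup>2 \<partial>\<mu>) \<le> ?p"
    unfolding sq by (simp add: \<mu>.prob_space power2_eq_square algebra_simps)
  let ?S = "\<lambda>z. (\<Sum>i=1..m. inverse m * ?f (z i)) + 0"
  have int: "integrable ?P (\<lambda>z. (?S z)\<^sup>2)"
    by (rule integrable_square_sum_PiM[OF \<mu> _ _ _ f2 f0]) auto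
  have eq: "expectation (\<lambda>z. (?S z)\<^sup>2) = (\<Sum>i=1..m. (inverse m)\<^sup>2) * (\<integral>x. (?f x)\<^sup>2 \<partial>\<mu>) + 0\<^sup>2"
    by (rule integral_square_sum_PiM[OF \<mu> _ _ _ f2 f0]) auto
  have S: "?S z = (\<Sum>i=1..m. indicator A (z i)) / real m - ?p" for z
    using m unfolding sum_distrib_left[symmetric] sum_subtractf by (simp add: field_simps)
  have [measurable]: "?S \<in> borel_measurable ?P" by measurable
  have "integrable ?P ?S" by (rule square_integrable_imp_integrable[OF _ int]) simp
  then have "dev = ennreal (expectation (\<lambda>z. \<bar>?S z\<bar>))"
    unfolding dev_def S[symmetric] by (intro nn_integral_eq_integral) auto
  also have "\<dots> \<le> ennreal (sqrt (expectation (\<lambda>z. (?S z)\<^sup>2)))"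
    by (intro ennreal_leI expectation_abs_le_sqrt int) simp
  also have "\<dots> \<le> ennreal (sqrt (?p / m))"
    unfolding eq using m v
    by (intro ennreal_leI real_sqrt_le_mono) (simp add: power2_eq_square field_simps)
  finally show "dev \<le> ennreal (sqrt (?p / m))" .
qed


section \<open>Integrating the deviation over the line: the rate for i.i.d. samples\<close>

lemma nn_integral_even:
  fixes f :: "real \<Rightarrow> ennreal"
  assumes [measurable]: "f \<in> borel_measurable borel"
  shows "(\<integral>\<^sup>+x. f \<bar>x\<bar> \<partial>lborel) = 2 * (\<integral>\<^sup>+x. f x * indicator {0..} x \<partial>lborel)"
proof -
  have "(\<integral>\<^sup>+x. f \<bar>x\<bar> \<partial>lborel) = (\<integral>\<^sup>+x. f x * indicator {0..} x + f (- x) * indicator {0..} (- x) \<partial>lborel)"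
    using AE_lborel_singleton[of "0::real"] by (intro nn_integral_cong_AE) (auto simp: indicator_def abs_if)
  also have "\<dots> = (\<integral>\<^sup>+x. f x * indicator {0..} x \<partial>lborel) + (\<integral>\<^sup>+x. f (- x) * indicator {0..} (- x) \<partial>lborel)"
    by (rule nn_integral_add) auto
  also have "(\<integral>\<^sup>+x. f (- x) * indicator {0..} (- x) \<partial>lborel) = (\<integral>\<^sup>+x. f x * indicator {0..} x \<partial>lborel)"
    by (subst nn_integral_real_affine[where c="-1" and t=0 and f="\<lambda>x. f x * indicator {0..} x"]) auto
  finally show ?thesis by (simp add: mult_2)
qed

text \<open>
  The variance bound is used below the level \<open>m powr (1 / \<alpha>)\<close> and the first moment bound above it;
  Markov's inequality turns both into integrable powers because \<open>\<alpha> / 2 < 1 < \<alpha>\<close>.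
\<close>

lemma nn_integral_tail_powers:
  fixes \<alpha> H :: real and m :: nat
  assumes \<alpha>: "1 < \<alpha>" "\<alpha> < 2" and H: "0 \<le> H" and m: "m \<ge> 1"
  shows "(\<integral>\<^sup>+x. min (ennreal (2 * (H * \<bar>x\<bar> powr -\<alpha>))) (ennreal (sqrt (H * \<bar>x\<bar> powr -\<alpha> / m))) \<partial>lborel)
    \<le> ennreal (2 * (2 * H / (\<alpha> - 1) + sqrt H / (1 - \<alpha> / 2)) * m powr (-1 + 1 / \<alpha>))"
proof -
  \<comment> \<open>At this point \<open>x0 powr -\<alpha>\<close> equals 1/m, so the variance bound
    and the first moment bound are of the same order there. Both pieces of the integral then have
    order \<open>m powr (-1 + 1 / \<alpha>)\<close>.\<close>
  define x0 where "x0 = real m powr (1 / \<alpha>)"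
  have x0: "x0 > 0" using m by (simp add: x0_def)
  let ?f = "\<lambda>x. min (ennreal (2 * (H * x powr -\<alpha>))) (ennreal (sqrt (H * x powr -\<alpha> / m)))"
  let ?g = "\<lambda>x. ennreal (sqrt (H / m)) * (ennreal (x powr (-\<alpha> / 2)) * indicator {0..x0} x)"
  let ?h = "\<lambda>x. ennreal (2 * H) * (ennreal (x powr -\<alpha>) * indicator {x0..} x)"
  have even: "(\<integral>\<^sup>+x. ?f \<bar>x\<bar> \<partial>lborel) = 2 * (\<integral>\<^sup>+x. ?f x * indicator {0..} x \<partial>lborel)"
    by (rule nn_integral_even) simp
  have "(\<integral>\<^sup>+x. ?f x * indicator {0..} x \<partial>lborel) \<le> (\<integral>\<^sup>+x. ?g x + ?h x \<partial>lborel)"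
  proof (intro nn_integral_mono)
    fix x :: real
    consider "x < 0" | "0 \<le> x" "x \<le> x0" | "x0 < x" by linarith
    then show "?f x * indicator {0..} x \<le> ?g x + ?h x"
    proof cases
      case 2
      have "sqrt (x powr -\<alpha>) = x powr (-\<alpha> / 2)" using 2 by (simp add: powr_half_sqrt[symmetric] powr_powr)
      then have "ennreal (sqrt (H * x powr -\<alpha> / m)) = ennreal (sqrt (H / m)) * ennreal (x powr (-\<alpha> / 2))"
        using H by (simp add: real_sqrt_mult real_sqrt_divide flip: ennreal_mult)
      with 2 show ?thesis by (simp add: add_increasing2 min.coboundedI2)
    next
      case 3
      with x0 H show ?thesis by (simp add: ennreal_mult mult.assoc)
    qed auto
  qed
  also have "\<dots> = (\<integral>\<^sup>+x. ?g x \<partial>lborel) + (\<integral>\<^sup>+x. ?h x \<partial>lborel)"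
    by (rule nn_integral_add) auto
  also have "(\<integral>\<^sup>+x. ?g x \<partial>lborel) = ennreal (sqrt (H / m)) * ennreal (x0 powr (-\<alpha> / 2 + 1) / (-\<alpha> / 2 + 1))"
    using \<alpha> x0 by (subst nn_integral_cmult, simp, subst nn_integral_has_integral_lebesgue'[OF _ has_integral_powr_from_0]) auto
  also have "\<dots> = ennreal (sqrt H / (1 - \<alpha> / 2) * m powr (-1 + 1 / \<alpha>))"
  proof -
    have "x0 powr (-\<alpha> / 2 + 1) = sqrt m * m powr (-1 + 1 / \<alpha>)"
      using \<alpha> m by (simp add: x0_def powr_powr powr_half_sqrt[symmetric] field_simps flip: powr_add)
    then show ?thesis
      using \<alpha> m H by (simp add: ennreal_mult'[symmetric] real_sqrt_divide)
  qed
  also have "(\<integral>\<^sup>+x. ?h x \<partial>lborel) = ennreal (2 * H) * ennreal (- (x0 powr (-\<alpha> + 1)) / (-\<alpha> + 1))"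
    using \<alpha> x0 by (subst nn_integral_cmult, simp, subst nn_integral_has_integral_lebesgue'[OF _ has_integral_powr_to_inf]) auto
  also have "\<dots> = ennreal (2 * H / (\<alpha> - 1) * m powr (-1 + 1 / \<alpha>))"
  proof -
    have "x0 powr (-\<alpha> + 1) = m powr (-1 + 1 / \<alpha>)"
      using \<alpha> m by (simp add: x0_def powr_powr field_simps)
    moreover have "- a / (-\<alpha> + 1) = a / (\<alpha> - 1)" for a using \<alpha> by (simp add: field_simps)
    ultimately show ?thesis
      using \<alpha> m H by (simp add: ennreal_mult'[symmetric])
  qed
  finally have "2 * (\<integral>\<^sup>+x. ?f x * indicator {0..} x \<partial>lborel) \<le> 2 * (ennreal (sqrt H / (1 - \<alpha> / 2) * m powr (-1 + 1 / \<alpha>))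
      + ennreal (2 * H / (\<alpha> - 1) * m powr (-1 + 1 / \<alpha>)))"
    by (rule mult_left_mono) simp
  also have "\<dots> = ennreal (2 * (2 * H / (\<alpha> - 1) + sqrt H / (1 - \<alpha> / 2)) * m powr (-1 + 1 / \<alpha>))"
  proof -
    have sum2: "2 * (ennreal a + ennreal b) = ennreal (2 * (a + b))" if "0 \<le> a" "0 \<le> b" for a b
      using that ennreal_mult[of 2 "a + b"] by simp
    show ?thesis
      using \<alpha> H by (subst sum2) (auto intro!: arg_cong[where f=ennreal] simp: algebra_simps add_divide_distrib)
  qed
  finally show ?thesis unfolding even .
qed

text \<open>Fubini moves the expectation inside the integral over \<open>x\<close>, where the
  frequency of a single tail event is compared with its probability. The law enters the bound only
  through \<open>H\<close>, which later gives one constant for all levels.\<close>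

lemma area_dist_empirical_moment_bound:
  fixes \<alpha> H :: real and m :: nat
  assumes \<mu>: "real_distribution \<mu>" and \<alpha>: "1 < \<alpha>" "\<alpha> < 2" and H: "0 \<le> H" and m: "m \<ge> 1"
    and mom: "(\<integral>\<^sup>+x. ennreal (\<bar>x\<bar> powr \<alpha>) \<partial>\<mu>) \<le> ennreal H"
  shows "(\<integral>\<^sup>+z. area_dist (empirical_df m z) (cdf \<mu>) \<partial>(\<Pi>\<^sub>M i\<in>{1..m}. \<mu>))
    \<le> ennreal (2 * (2 * H / (\<alpha> - 1) + sqrt H / (1 - \<alpha> / 2)) * m powr (-1 + 1 / \<alpha>))"
proof -
  let ?P = "\<Pi>\<^sub>M i\<in>{1..m}. \<mu>"
  interpret \<mu>: real_distribution \<mu> by fact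
  interpret P: prob_space ?P using \<mu>.prob_space_axioms by (intro prob_space_PiM) auto
  interpret PL: pair_sigma_finite lborel ?P ..
  have [measurable]: "(\<lambda>z. z i) \<in> borel_measurable ?P" if "i \<in> {1..m}" for i
    using measurable_compose[OF measurable_component_singleton[OF that] measurable_ident_sets[OF \<mu>.events_eq_borel]] .
  have tail: "measure \<mu> {y. \<bar>x\<bar> \<le> \<bar>y\<bar>} \<le> H * \<bar>x\<bar> powr -\<alpha>" if "x \<noteq> 0" for x
  proof -
    have "emeasure \<mu> {y. \<bar>x\<bar> \<le> \<bar>y\<bar>} = (\<integral>\<^sup>+y. indicator {y. \<bar>x\<bar> \<le> \<bar>y\<bar>} y \<partial>\<mu>)" by simp
    also have "\<dots> \<le> (\<integral>\<^sup>+y. ennreal (\<bar>x\<bar> powr -\<alpha>) * ennreal (\<bar>y\<bar> powr \<alpha>) \<partial>\<mu>)"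
    proof (intro nn_integral_mono)
      fix y
      have "1 \<le> \<bar>x\<bar> powr -\<alpha> * \<bar>y\<bar> powr \<alpha>" if "\<bar>x\<bar> \<le> \<bar>y\<bar>"
        using powr_mono2[of \<alpha> "\<bar>x\<bar>" "\<bar>y\<bar>"] \<alpha> \<open>x \<noteq> 0\<close> that by (simp add: powr_minus field_simps)
      then show "indicator {y. \<bar>x\<bar> \<le> \<bar>y\<bar>} y \<le> ennreal (\<bar>x\<bar> powr -\<alpha>) * ennreal (\<bar>y\<bar> powr \<alpha>)"
        by (auto simp: indicator_def simp flip: ennreal_mult ennreal_1 intro!: ennreal_leI)
    qed
    also have "\<dots> \<le> ennreal (\<bar>x\<bar> powr -\<alpha>) * ennreal H"
      by (subst nn_integral_cmult, simp) (intro mult_left_mono mom, simp)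
    finally show ?thesis
      using H by (simp add: \<mu>.emeasure_eq_measure mult.commute flip: ennreal_mult)
  qed
  have dev: "(\<integral>\<^sup>+z. ennreal \<bar>empirical_df m z x - cdf \<mu> x\<bar> \<partial>?P)
      \<le> min (ennreal (2 * (H * \<bar>x\<bar> powr -\<alpha>))) (ennreal (sqrt (H * \<bar>x\<bar> powr -\<alpha> / m)))" if "x \<noteq> 0" for x
  proof -
    \<comment> \<open>For positive \<open>x\<close> the event \<open>y \<le> x\<close> is not rare,
      but its complement is; passing to the complement leaves the absolute deviation unchanged. On
      both sides the event used lies in the region controlled by Markov's inequality.\<close>
    define A where "A = (if x < 0 then {..x} else {x<..})"
    have A[measurable]: "A \<in> sets \<mu>" by (simp add: A_def)
    have eq: "\<bar>empirical_df m z x - cdf \<mu> x\<bar> = \<bar>(\<Sum>i=1..m. indicator A (z i)) / real m - measure \<mu> A\<bar>" for z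
    proof (cases "x < 0")
      case True
      then show ?thesis by (simp add: empirical_df_def A_def cdf_def indicator_def of_bool_def)
    next
      case False
      have "empirical_df m z x = 1 - (\<Sum>i=1..m. indicator A (z i)) / real m"
      proof -
        have "(\<Sum>i=1..m. (if z i \<le> x then 1 else 0)) = (\<Sum>i=1..m. 1 - indicator A (z i) :: real)"
          using False by (intro sum.cong) (auto simp: A_def indicator_def)
        with m show ?thesis by (simp add: empirical_df_def sum_subtractf diff_divide_distrib)
      qed
      moreover have "cdf \<mu> x = 1 - measure \<mu> A"
        using \<mu>.prob_compl[of "{..x}"] False by (simp add: A_def cdf_def Compl_atMost[symmetric] Compl_eq_Diff_UNIV)
      ultimately show ?thesis by simp
    qed
    have "A \<subseteq> {y. \<bar>x\<bar> \<le> \<bar>y\<bar>}" by (auto simp: A_def)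
    then have "measure \<mu> A \<le> measure \<mu> {y. \<bar>x\<bar> \<le> \<bar>y\<bar>}" by (intro \<mu>.finite_measure_mono) auto
    also note tail[OF that]
    finally have pA: "measure \<mu> A \<le> H * \<bar>x\<bar> powr -\<alpha>" .
    show ?thesis
      unfolding eq
    proof (rule min.boundedI)
      note empirical_frequency_deviation(1)[OF \<mu>.prob_space_axioms A m]
      also have "ennreal (2 * measure \<mu> A) \<le> ennreal (2 * (H * \<bar>x\<bar> powr -\<alpha>))"
        using pA by (intro ennreal_leI) simp
      finally show "(\<integral>\<^sup>+z. ennreal \<bar>(\<Sum>i=1..m. indicator A (z i)) / real m - measure \<mu> A\<bar> \<partial>?P) \<le> \<dots>" .
      note empirical_frequency_deviation(2)[OF \<mu>.prob_space_axioms A m]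
      also have "ennreal (sqrt (measure \<mu> A / m)) \<le> ennreal (sqrt (H * \<bar>x\<bar> powr -\<alpha> / m))"
        using pA by (intro ennreal_leI real_sqrt_le_mono divide_right_mono) auto
      finally show "(\<integral>\<^sup>+z. ennreal \<bar>(\<Sum>i=1..m. indicator A (z i)) / real m - measure \<mu> A\<bar> \<partial>?P) \<le> \<dots>" .
    qed
  qed
  have "(\<integral>\<^sup>+z. area_dist (empirical_df m z) (cdf \<mu>) \<partial>?P)
      = (\<integral>\<^sup>+x. \<integral>\<^sup>+z. ennreal \<bar>empirical_df m z x - cdf \<mu> x\<bar> \<partial>?P \<partial>lborel)"
    unfolding area_dist_def
  proof (rule PL.Fubini')
    show "(\<lambda>(x, z). ennreal \<bar>empirical_df m z x - cdf \<mu> x\<bar>) \<in> borel_measurable (lborel \<Otimes>\<^sub>M ?P)"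
      unfolding split_beta by measurable
  qed
  \<comment> \<open>The point 0 has to be left out: \<open>0 powr -\<alpha>\<close> is 0, so the
    bound would claim that there is no deviation at all.\<close>
  also have "\<dots> \<le> (\<integral>\<^sup>+x. min (ennreal (2 * (H * \<bar>x\<bar> powr -\<alpha>))) (ennreal (sqrt (H * \<bar>x\<bar> powr -\<alpha> / m))) \<partial>lborel)"
    using AE_lborel_singleton[of "0::real"] by (intro nn_integral_mono_AE) (rule AE_mp, assumption, intro AE_I2 impI dev)
  also note nn_integral_tail_powers[OF \<alpha> H m]
  finally show ?thesis .
qed

subsection \<open>The smoothing transform\<close>

lemma Qof_measurable [measurable]: "Qof \<in> borel_measurable bvec_space"
  and Nof_measurable [measurable]: "Nof \<in> measurable bvec_space (count_space UNIV)"
  and Cof_component_measurable: "r \<ge> 1 \<Longrightarrow> (\<lambda>v. Cof v r) \<in> borel_measurable bvec_space"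
  unfolding bvec_space_def
  by (simp_all add: measurable_compose[OF measurable_snd measurable_fst]
      measurable_compose[OF measurable_compose[OF measurable_snd measurable_snd] measurable_component_singleton])

definition branch :: "bvec \<Rightarrow> (nat \<Rightarrow> real) \<Rightarrow> real" where
  "branch v x = (\<Sum>r=1..Nof v. Cof v r * x r) + Qof v"

text \<open>The smoothing transform, written \<Phi> in the overview, with the branching vector
  distributed according to \<open>L\<close>.\<close>

definition smooth :: "bvec measure \<Rightarrow> real measure \<Rightarrow> real measure" where
  "smooth L \<nu> = distr (L \<Otimes>\<^sub>M (\<Pi>\<^sub>M r\<in>{1..}. \<nu>)) borel (\<lambda>(v, x). branch v x)"

text \<open>The quantity \<open>rho\<close> expressed through the law of the branching vector, so
  that the original probability space disappears from the estimates.\<close>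

definition lrho :: "bvec measure \<Rightarrow> real \<Rightarrow> ennreal" where
  "lrho L \<gamma> = (\<integral>\<^sup>+v. ennreal (\<Sum>i=1..Nof v. \<bar>Cof v i\<bar> powr \<gamma>) \<partial>L)"

text \<open>The number of summands is random but takes countably many values; for each fixed value
  the sum is finite and measurable.\<close>

lemma random_sum_measurable:
  fixes f :: "nat \<Rightarrow> 'a \<Rightarrow> 'b :: {second_countable_topology, topological_comm_monoid_add}"
  assumes v: "v \<in> measurable M bvec_space" and f: "\<And>r. r \<ge> 1 \<Longrightarrow> f r \<in> borel_measurable M"
  shows "(\<lambda>\<omega>. \<Sum>r=1..Nof (v \<omega>). f r \<omega>) \<in> borel_measurable M"
  by (rule measurable_compose_countable[OF _ measurable_compose[OF v Nof_measurable]])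
     (use f in auto)

lemma branch_measurable:
  assumes v: "v \<in> measurable M bvec_space" and x: "\<And>r. r \<ge> 1 \<Longrightarrow> (\<lambda>\<omega>. x \<omega> r) \<in> borel_measurable M"
  shows "(\<lambda>\<omega>. branch (v \<omega>) (x \<omega>)) \<in> borel_measurable M"
  unfolding branch_def
  by (intro borel_measurable_add random_sum_measurable[OF v] borel_measurable_times x
      measurable_compose[OF v Qof_measurable] measurable_compose[OF v Cof_component_measurable]) auto

lemma branch_cong: "(\<And>r. r \<ge> 1 \<Longrightarrow> x r = y r) \<Longrightarrow> branch v x = branch v y"
  by (simp add: branch_def)

lemma sets_smooth [simp, measurable_cong]: "sets (smooth L \<nu>) = sets borel"
  and space_smooth [simp]: "space (smooth L \<nu>) = UNIV"
  by (simp_all add: smooth_def)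

text \<open>Moments, tree and bootstrap depend on the branching vector through its law alone. The
  generic vector, the tree and the pools may live on three unrelated spaces; this law is what they
  share.\<close>

locale branching_law =
  fixes L :: "bvec measure"
  assumes prob_L: "prob_space L" and sets_L [measurable_cong]: "sets L = sets bvec_space"
begin

sublocale L: prob_space L by (rule prob_L)

lemma id_measurable: "(\<lambda>v. v) \<in> measurable L bvec_space"
  by (rule measurable_ident_sets[OF sets_L])

lemma fst_measurable: "fst \<in> measurable (L \<Otimes>\<^sub>M M) bvec_space"
  by (rule measurable_compose[OF measurable_fst id_measurable])

lemma Cof_power_sum_measurable [measurable]: "(\<lambda>v. \<Sum>i=1..Nof v. \<bar>Cof v i\<bar> powr \<gamma>) \<in> borel_measurable L"
proof (rule random_sum_measurable[OF id_measurable])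
  fix r :: nat assume "r \<ge> 1"
  then have [measurable]: "(\<lambda>v. Cof v r) \<in> borel_measurable L"
    by (intro measurable_compose[OF id_measurable Cof_component_measurable])
  show "(\<lambda>v. \<bar>Cof v r\<bar> powr \<gamma>) \<in> borel_measurable L" by measurable
qed

lemma Cof_sum_measurable [measurable]: "(\<lambda>v. \<Sum>i=1..Nof v. \<bar>Cof v i\<bar>) \<in> borel_measurable L"
  by (intro random_sum_measurable[OF id_measurable] borel_measurable_abs
      measurable_compose[OF id_measurable Cof_component_measurable])

lemma Qof_measurable_L [measurable]: "Qof \<in> borel_measurable L"
  by (rule measurable_compose[OF id_measurable Qof_measurable])

lemma branch_pair_measurable:
  assumes f: "f \<in> borel_measurable P"
  shows "(\<lambda>(v, p). branch v (\<lambda>r. f (p r))) \<in> borel_measurable (L \<Otimes>\<^sub>M (\<Pi>\<^sub>M r\<in>{1..}. P))"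
  unfolding split_beta
  by (intro branch_measurable fst_measurable
      measurable_compose[OF measurable_compose[OF measurable_snd measurable_component_singleton[of _ _ "\<lambda>_. P"]] f]) auto

text \<open>Applying \<open>f\<close> to i.i.d. copies gives i.i.d. copies of the image. The
  transform of an image law can therefore be realized on the source: on a coupling with
  \<open>f\<close> a projection, on resampling indices with \<open>f\<close> the pool, on subtrees
  with \<open>f\<close> their tree sum.\<close>

lemma smooth_distr:
  assumes P: "prob_space P" and f: "f \<in> borel_measurable P"
  shows "smooth L (distr P borel f) = distr (L \<Otimes>\<^sub>M (\<Pi>\<^sub>M r\<in>{1..}. P)) borel (\<lambda>(v, p). branch v (\<lambda>r. f (p r)))"
proof -
  let ?K = "{1::nat..}"
  let ?g = "\<lambda>p. \<lambda>r\<in>?K. f (p r)"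
  have g: "?g \<in> measurable (\<Pi>\<^sub>M r\<in>?K. P) (\<Pi>\<^sub>M r\<in>?K. borel)"
    by (intro measurable_restrict measurable_compose[OF measurable_component_singleton[of _ _ "\<lambda>_. P"] f]) auto
  interpret PK: prob_space "\<Pi>\<^sub>M r\<in>?K. P" using P by (intro prob_space_PiM)
  have *: "(\<Pi>\<^sub>M r\<in>?K. distr P borel f) = distr (\<Pi>\<^sub>M r\<in>?K. P) (\<Pi>\<^sub>M r\<in>?K. borel) ?g"
    using distr_PiM_map[of ?K "\<lambda>_. P" "\<lambda>_. f" "\<lambda>_. borel"] P f by auto
  have "L \<Otimes>\<^sub>M (\<Pi>\<^sub>M r\<in>?K. distr P borel f)
      = distr L L (\<lambda>v. v) \<Otimes>\<^sub>M distr (\<Pi>\<^sub>M r\<in>?K. P) (\<Pi>\<^sub>M r\<in>?K. borel) ?g"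
    unfolding * distr_id by (rule refl)
  also have "\<dots> = distr (L \<Otimes>\<^sub>M (\<Pi>\<^sub>M r\<in>?K. P)) (L \<Otimes>\<^sub>M (\<Pi>\<^sub>M r\<in>?K. borel)) (\<lambda>(v, p). (v, ?g p))"
    using prob_space_imp_sigma_finite[OF PK.prob_space_distr[OF g]] g
    by (intro pair_measure_distr) auto
  finally have eq: "L \<Otimes>\<^sub>M (\<Pi>\<^sub>M r\<in>?K. distr P borel f) = \<dots>" .
  have g': "(\<lambda>(v, p). (v, ?g p)) \<in> measurable (L \<Otimes>\<^sub>M (\<Pi>\<^sub>M r\<in>?K. P)) (L \<Otimes>\<^sub>M (\<Pi>\<^sub>M r\<in>?K. borel))"
    unfolding split_beta using g by measurable
  show ?thesis
    unfolding smooth_def eq using branch_pair_measurable[of "\<lambda>x. x" borel]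
    by (subst distr_distr[OF _ g']) (auto simp: comp_def split_beta intro!: distr_cong branch_cong)
qed

lemma prob_space_smooth: "prob_space \<nu> \<Longrightarrow> sets \<nu> = sets borel \<Longrightarrow> prob_space (smooth L \<nu>)"
proof -
  assume \<nu>: "prob_space \<nu>" "sets \<nu> = sets borel"
  then interpret PK: prob_space "\<Pi>\<^sub>M r\<in>{1::nat..}. \<nu>" by (intro prob_space_PiM)
  interpret pair_prob_space L "\<Pi>\<^sub>M r\<in>{1::nat..}. \<nu>" ..
  show ?thesis
    unfolding smooth_def using branch_pair_measurable[OF measurable_ident_sets[OF \<nu>(2)]]
    by (intro prob_space_distr) simp
qed

lemma real_distribution_smooth: "real_distribution \<nu> \<Longrightarrow> real_distribution (smooth L \<nu>)"
  by (simp add: real_distribution_def real_distribution_axioms_def prob_space_smooth)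

text \<open>The common vector makes Q cancel. The coupled pairs are independent of that vector, so
  each coefficient contributes its absolute value times the cost of one pair, and averaging over the
  vector produces \<open>lrho L 1\<close>.\<close>

lemma smooth_coupling:
  assumes \<nu>: "real_distribution \<nu>" and \<mu>: "real_distribution \<mu>"
  obtains \<kappa> where "\<kappa> \<in> couplings (smooth L \<nu>) (smooth L \<mu>)"
    and "(\<integral>\<^sup>+(x, y). ennreal \<bar>x - y\<bar> \<partial>\<kappa>) \<le> lrho L 1 * area_dist (cdf \<nu>) (cdf \<mu>)"
proof -
  obtain \<pi> where \<pi>: "\<pi> \<in> couplings \<nu> \<mu>"
    and cost: "(\<integral>\<^sup>+(x, y). ennreal \<bar>x - y\<bar> \<partial>\<pi>) = area_dist (cdf \<nu>) (cdf \<mu>)"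
    by (rule quantile_coupling[OF assms])
  have "prob_space \<pi>" and sets_\<pi>: "sets \<pi> = sets (borel \<Otimes>\<^sub>M borel)"
    and marg: "distr \<pi> borel fst = \<nu>" "distr \<pi> borel snd = \<mu>"
    using \<pi> by (auto simp: couplings_def)
  let ?P = "\<Pi>\<^sub>M r\<in>{1::nat..}. \<pi>"
  interpret \<pi>: prob_space \<pi> by fact
  interpret PK: prob_space ?P using \<pi>.prob_space_axioms by (intro prob_space_PiM)
  interpret LP: pair_prob_space L ?P ..
  have fs[measurable]: "fst \<in> borel_measurable \<pi>" "snd \<in> borel_measurable \<pi>"
    by (simp_all add: sets_\<pi> cong: measurable_cong_sets)
  let ?B = "\<lambda>f (v, p). branch v (\<lambda>r. f (p r))"
  let ?h = "\<lambda>x. (?B fst x, ?B snd x)"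
  note B = branch_pair_measurable[OF fs(1)] branch_pair_measurable[OF fs(2)]
  have h: "?h \<in> measurable (L \<Otimes>\<^sub>M ?P) (borel \<Otimes>\<^sub>M borel)" using B by (intro measurable_Pair) auto
  define \<kappa> where "\<kappa> = distr (L \<Otimes>\<^sub>M ?P) (borel \<Otimes>\<^sub>M borel) ?h"
  have "prob_space \<kappa>" unfolding \<kappa>_def by (rule LP.prob_space_distr[OF h])
  moreover have "distr \<kappa> borel fst = smooth L \<nu>" "distr \<kappa> borel snd = smooth L \<mu>"
    unfolding \<kappa>_def marg[symmetric] smooth_distr[OF \<pi>.prob_space_axioms fs(1)] smooth_distr[OF \<pi>.prob_space_axioms fs(2)]
    by (subst distr_distr[OF _ h]; simp add: comp_def)+
  ultimately have "\<kappa> \<in> couplings (smooth L \<nu>) (smooth L \<mu>)" by (simp add: couplings_def \<kappa>_def)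
  have "(\<integral>\<^sup>+(x, y). ennreal \<bar>x - y\<bar> \<partial>\<kappa>) = (\<integral>\<^sup>+x. ennreal \<bar>?B fst x - ?B snd x\<bar> \<partial>(L \<Otimes>\<^sub>M ?P))"
    unfolding \<kappa>_def by (subst nn_integral_distr[OF h]) (auto simp: split_beta)
  also have "\<dots> = (\<integral>\<^sup>+v. \<integral>\<^sup>+p. ennreal \<bar>branch v (\<lambda>r. fst (p r)) - branch v (\<lambda>r. snd (p r))\<bar> \<partial>?P \<partial>L)"
    using B by (subst PK.nn_integral_fst[symmetric]) auto
  also have "\<dots> \<le> (\<integral>\<^sup>+v. \<integral>\<^sup>+p. (\<Sum>r=1..Nof v. ennreal \<bar>Cof v r\<bar> * ennreal \<bar>fst (p r) - snd (p r)\<bar>) \<partial>?P \<partial>L)"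
  proof (intro nn_integral_mono)
    fix v p
    have "\<bar>branch v (\<lambda>r. fst (p r)) - branch v (\<lambda>r. snd (p r))\<bar>
        = \<bar>\<Sum>r=1..Nof v. Cof v r * (fst (p r) - snd (p r))\<bar>"
      by (simp add: branch_def sum_subtractf algebra_simps)
    also have "\<dots> \<le> (\<Sum>r=1..Nof v. \<bar>Cof v r\<bar> * \<bar>fst (p r) - snd (p r)\<bar>)"
      by (rule order.trans[OF sum_abs]) (simp add: abs_mult)
    finally show "ennreal \<bar>branch v (\<lambda>r. fst (p r)) - branch v (\<lambda>r. snd (p r))\<bar>
        \<le> (\<Sum>r=1..Nof v. ennreal \<bar>Cof v r\<bar> * ennreal \<bar>fst (p r) - snd (p r)\<bar>)"
      by (simp add: ennreal_leI flip: ennreal_mult)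
  qed
  also have "\<dots> = (\<integral>\<^sup>+v. (\<Sum>r=1..Nof v. ennreal \<bar>Cof v r\<bar> * area_dist (cdf \<nu>) (cdf \<mu>)) \<partial>L)"
  proof (intro nn_integral_cong)
    fix v
    have m: "(\<lambda>x. ennreal \<bar>fst x - snd x\<bar>) \<in> borel_measurable \<pi>" by measurable
    have mc: "(\<lambda>p. ennreal \<bar>fst (p r) - snd (p r)\<bar>) \<in> borel_measurable ?P" if "r \<ge> 1" for r
      using that by (intro measurable_compose[OF measurable_component_singleton[of _ _ "\<lambda>_. \<pi>"] m]) auto
    have "(\<integral>\<^sup>+p. ennreal \<bar>fst (p r) - snd (p r)\<bar> \<partial>?P) = area_dist (cdf \<nu>) (cdf \<mu>)" if "r \<ge> 1" for r
      using nn_integral_PiM_component[OF \<pi>.prob_space_axioms _ m, of r "{1..}"] that cost by (simp add: case_prod_beta')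
    then show "(\<integral>\<^sup>+p. (\<Sum>r=1..Nof v. ennreal \<bar>Cof v r\<bar> * ennreal \<bar>fst (p r) - snd (p r)\<bar>) \<partial>?P)
        = (\<Sum>r=1..Nof v. ennreal \<bar>Cof v r\<bar> * area_dist (cdf \<nu>) (cdf \<mu>))"
      using mc by (subst nn_integral_sum) (auto simp: nn_integral_cmult)
  qed
  also have "\<dots> = lrho L 1 * area_dist (cdf \<nu>) (cdf \<mu>)"
  proof -
    have "(\<Sum>r=1..Nof v. ennreal \<bar>Cof v r\<bar> * c) = ennreal (\<Sum>r=1..Nof v. \<bar>Cof v r\<bar>) * c" for v c
      by (simp flip: sum_distrib_right)
    then show ?thesis
      using Cof_sum_measurable by (simp only: nn_integral_multc measurable_ennreal lrho_def powr_one' abs_idempotent)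
         (simp add: nn_integral_multc)
  qed
  finally show thesis using \<open>\<kappa> \<in> _\<close> that by blast
qed

text \<open>
  Under \<open>m\<close> independent copies of the coupling the first coordinates are a bootstrap step from \<open>\<nu>\<close>
  and the second ones are an i.i.d. sample from \<open>smooth L \<mu>\<close>.
\<close>

lemma bootstrap_step_contraction:
  assumes \<nu>: "real_distribution \<nu>" and \<mu>: "real_distribution \<mu>" and m: "m \<ge> 1"
  defines "F \<equiv> cdf (smooth L \<mu>)"
  shows "(\<integral>\<^sup>+z. area_dist (empirical_df m z) F \<partial>(\<Pi>\<^sub>M i\<in>{1..m}. smooth L \<nu>))
    \<le> lrho L 1 * area_dist (cdf \<nu>) (cdf \<mu>) + (\<integral>\<^sup>+z. area_dist (empirical_df m z) F \<partial>(\<Pi>\<^sub>M i\<in>{1..m}. smooth L \<mu>))"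
proof -
  obtain \<kappa> where \<kappa>: "\<kappa> \<in> couplings (smooth L \<nu>) (smooth L \<mu>)"
    and cost: "(\<integral>\<^sup>+(x, y). ennreal \<bar>x - y\<bar> \<partial>\<kappa>) \<le> lrho L 1 * area_dist (cdf \<nu>) (cdf \<mu>)"
    by (rule smooth_coupling[OF \<nu> \<mu>])
  have "prob_space \<kappa>" and sets_\<kappa>: "sets \<kappa> = sets (borel \<Otimes>\<^sub>M borel)"
    and marg: "distr \<kappa> borel fst = smooth L \<nu>" "distr \<kappa> borel snd = smooth L \<mu>"
    using \<kappa> by (auto simp: couplings_def)
  interpret \<kappa>: prob_space \<kappa> by fact
  interpret S: real_distribution "smooth L \<mu>" by (rule real_distribution_smooth[OF \<mu>])
  have F[measurable]: "F \<in> borel_measurable borel" unfolding F_def by simp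
  have fs[measurable]: "fst \<in> borel_measurable \<kappa>" "snd \<in> borel_measurable \<kappa>"
    by (simp_all add: sets_\<kappa> cong: measurable_cong_sets)
  let ?I = "{1..m}" let ?P = "\<Pi>\<^sub>M i\<in>?I. \<kappa>"
  have I: "?I \<noteq> {}" using m by simp
  have comp[measurable]: "(\<lambda>w. w i) \<in> measurable ?P \<kappa>" if "i \<in> ?I" for i using that by simp
  let ?A = "\<lambda>z. area_dist (empirical_df m z) F"
  note A = empirical_area_dist_measurable[OF F, of m]
  have marg_int: "(\<integral>\<^sup>+z. ?A z \<partial>(\<Pi>\<^sub>M i\<in>?I. distr \<kappa> borel f)) = (\<integral>\<^sup>+w. ?A (\<lambda>i. f (w i)) \<partial>?P)"
    and marg_meas: "(\<lambda>w. ?A (\<lambda>i. f (w i))) \<in> borel_measurable ?P"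
    if f: "f \<in> borel_measurable \<kappa>" for f
  proof -
    have m: "(\<lambda>w. \<lambda>i\<in>?I. f (w i)) \<in> measurable ?P (\<Pi>\<^sub>M i\<in>?I. borel)"
      by (intro measurable_restrict measurable_compose[OF comp f])
    show "(\<integral>\<^sup>+z. ?A z \<partial>(\<Pi>\<^sub>M i\<in>?I. distr \<kappa> borel f)) = (\<integral>\<^sup>+w. ?A (\<lambda>i. f (w i)) \<partial>?P)"
      unfolding distr_PiM_map[OF I \<kappa>.prob_space_axioms f, symmetric]
      by (subst nn_integral_distr[OF m], unfold measurable_distr_eq1, rule A, unfold empirical_df_restrict, rule refl)
    show "(\<lambda>w. ?A (\<lambda>i. f (w i))) \<in> borel_measurable ?P"
      using measurable_compose[OF m A] unfolding empirical_df_restrict .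
  qed
  have "(\<integral>\<^sup>+z. ?A z \<partial>(\<Pi>\<^sub>M i\<in>?I. smooth L \<nu>)) = (\<integral>\<^sup>+w. ?A (\<lambda>i. fst (w i)) \<partial>?P)"
    unfolding marg[symmetric] by (rule marg_int) simp
  \<comment> \<open>Triangle inequality through the empirical distribution function of the second
    coordinates; pairing members by index bounds the first part by the average cost of the
    \<open>m\<close> pairs.\<close>
  also have "\<dots> \<le> (\<integral>\<^sup>+w. (\<Sum>i\<in>?I. ennreal \<bar>fst (w i) - snd (w i)\<bar>) / of_nat m + ?A (\<lambda>i. snd (w i)) \<partial>?P)"
  proof (intro nn_integral_mono)
    fix w
    have e: "empirical_df m y \<in> borel_measurable borel" for y
      by (rule empirical_df_measurable[where y="\<lambda>_. y" and f="\<lambda>x. x"]) auto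
    show "?A (\<lambda>i. fst (w i)) \<le> (\<Sum>i\<in>?I. ennreal \<bar>fst (w i) - snd (w i)\<bar>) / of_nat m + ?A (\<lambda>i. snd (w i))"
      by (rule order.trans[OF area_dist_triangle[OF e e F] add_mono[OF area_dist_empirical_le order.refl]])
  qed
  also have "\<dots> = (\<integral>\<^sup>+w. (\<Sum>i\<in>?I. ennreal \<bar>fst (w i) - snd (w i)\<bar>) / of_nat m \<partial>?P) + (\<integral>\<^sup>+w. ?A (\<lambda>i. snd (w i)) \<partial>?P)"
    by (intro nn_integral_add marg_meas) auto
  also have "(\<integral>\<^sup>+w. ?A (\<lambda>i. snd (w i)) \<partial>?P) = (\<integral>\<^sup>+z. ?A z \<partial>(\<Pi>\<^sub>M i\<in>?I. smooth L \<mu>))"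
    unfolding marg[symmetric] by (rule marg_int[symmetric]) simp
  also have "(\<integral>\<^sup>+w. (\<Sum>i\<in>?I. ennreal \<bar>fst (w i) - snd (w i)\<bar>) / of_nat m \<partial>?P)
      = (\<Sum>i\<in>?I. (\<integral>\<^sup>+(x, y). ennreal \<bar>x - y\<bar> \<partial>\<kappa>)) / of_nat m"
  proof -
    have k: "(\<lambda>x. ennreal \<bar>fst x - snd x\<bar>) \<in> borel_measurable \<kappa>" by measurable
    have k': "(\<lambda>w. ennreal \<bar>fst (w i) - snd (w i)\<bar>) \<in> borel_measurable ?P" if "i \<in> ?I" for i
      by (rule measurable_compose[OF comp[OF that] k])
    have "(\<integral>\<^sup>+w. ennreal \<bar>fst (w i) - snd (w i)\<bar> \<partial>?P) = (\<integral>\<^sup>+(x, y). ennreal \<bar>x - y\<bar> \<partial>\<kappa>)" if "i \<in> ?I" for i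
      using nn_integral_PiM_component[OF \<kappa>.prob_space_axioms that k] by (simp add: case_prod_beta')
    then have E: "(\<Sum>i\<in>?I. \<integral>\<^sup>+w. ennreal \<bar>fst (w i) - snd (w i)\<bar> \<partial>?P) = (\<Sum>i\<in>?I. (\<integral>\<^sup>+(x, y). ennreal \<bar>x - y\<bar> \<partial>\<kappa>))"
      by (intro sum.cong refl)
    have S: "(\<lambda>w. \<Sum>i\<in>?I. ennreal \<bar>fst (w i) - snd (w i)\<bar>) \<in> borel_measurable ?P"
      by (intro borel_measurable_sum k')
    show ?thesis
      unfolding nn_integral_divide[OF S] E[symmetric] by (subst nn_integral_sum, erule k', rule refl)
  qed
  also have "\<dots> = (\<integral>\<^sup>+(x, y). ennreal \<bar>x - y\<bar> \<partial>\<kappa>)"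
    using m by (simp add: ennreal_mult_divide_eq mult.commute[of "of_nat m"])
  finally show ?thesis using add_right_mono[OF cost] by (rule order.trans)
qed

text \<open>The pool \<open>y\<close> is frozen here. Reading it at independent uniform indices
  samples from \<open>emp_law m y\<close>, and different members use different vectors and different
  indices, so they are independent.\<close>

lemma bootstrap_step_law:
  fixes m :: nat and y :: "nat \<Rightarrow> real"
  defines "U \<equiv> measure_pmf (pmf_of_set {1..m})"
  shows "distr ((\<Pi>\<^sub>M i\<in>{1..m}. L) \<Otimes>\<^sub>M (\<Pi>\<^sub>M i\<in>{1..m}. \<Pi>\<^sub>M r\<in>{1..}. U)) (\<Pi>\<^sub>M i\<in>{1..m}. borel)
      (\<lambda>(a, b). \<lambda>i\<in>{1..m}. branch (a i) (\<lambda>r. y (b i r)))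
    = (\<Pi>\<^sub>M i\<in>{1..m}. smooth L (emp_law m y))"
proof -
  have U: "prob_space U" unfolding U_def by (rule prob_space_measure_pmf)
  have y: "y \<in> borel_measurable U" by (simp add: U_def)
  have "smooth L (emp_law m y) = distr (L \<Otimes>\<^sub>M (\<Pi>\<^sub>M r\<in>{1..}. U)) borel (\<lambda>(v, p). branch v (\<lambda>r. y (p r)))"
    unfolding emp_law_def U_def[symmetric] by (rule smooth_distr[OF U y])
  then show ?thesis
    using distr_pair_PiM_zip[OF _ prob_L prob_space_PiM[OF U] branch_pair_measurable[OF y], of "{1..m}"] by simp
qed

end

subsection \<open>The bootstrap recursion\<close>

lemma Int_stable_generated_events: "Int_stable (generated_events S M X)"
proof (rule Int_stableI)
  fix a b assume "a \<in> generated_events S M X" "b \<in> generated_events S M X"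
  then obtain A B where "A \<in> sets M" "B \<in> sets M" "a = X -` A \<inter> space S" "b = X -` B \<inter> space S"
    by (auto simp: generated_events_def)
  then show "a \<inter> b \<in> generated_events S M X"
    by (auto simp: generated_events_def intro!: exI[of _ "A \<inter> B"])
qed

lemma (in prob_space) distr_pair_indep:
  assumes [measurable]: "X \<in> measurable M A" "Y \<in> measurable M B"
    and indep: "\<And>a b. a \<in> sets A \<Longrightarrow> b \<in> sets B \<Longrightarrow>
      prob ((X -` a \<inter> space M) \<inter> (Y -` b \<inter> space M)) = prob (X -` a \<inter> space M) * prob (Y -` b \<inter> space M)"
  shows "distr M (A \<Otimes>\<^sub>M B) (\<lambda>\<omega>. (X \<omega>, Y \<omega>)) = distr M A X \<Otimes>\<^sub>M distr M B Y"
proof (rule pair_measure_eqI[symmetric])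
  show "sigma_finite_measure (distr M A X)" "sigma_finite_measure (distr M B Y)"
    by (intro prob_space_imp_sigma_finite prob_space_distr; measurable)+
  show "sets (distr M A X \<Otimes>\<^sub>M distr M B Y) = sets (distr M (A \<Otimes>\<^sub>M B) (\<lambda>\<omega>. (X \<omega>, Y \<omega>)))"
    by simp
  fix a b assume ab: "a \<in> sets (distr M A X)" "b \<in> sets (distr M B Y)"
  then have [measurable]: "a \<in> sets A" "b \<in> sets B" by auto
  have "(\<lambda>\<omega>. (X \<omega>, Y \<omega>)) -` (a \<times> b) \<inter> space M = (X -` a \<inter> space M) \<inter> (Y -` b \<inter> space M)" by auto
  with indep[of a b] ab show "emeasure (distr M A X) a * emeasure (distr M B Y) b
      = emeasure (distr M (A \<Otimes>\<^sub>M B) (\<lambda>\<omega>. (X \<omega>, Y \<omega>))) (a \<times> b)"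
    by (simp add: emeasure_distr emeasure_eq_measure flip: ennreal_mult)
qed

text \<open>The generated events form three independent intersection-stable systems. Grouping them
  as {0} and {1, 2} and passing to generated sigma-algebras makes the first variable independent of
  the pair of the other two; within the pair, independence is read off directly.\<close>

lemma (in prob_space) distr_triple_indep:
  assumes X: "X \<in> measurable M A" and Y: "Y \<in> measurable M B" and Z: "Z \<in> measurable M C"
    and indep: "indep_sets (\<lambda>n. [generated_events M A X, generated_events M B Y, generated_events M C Z] ! n) {..<3}"
  shows "distr M (A \<Otimes>\<^sub>M (B \<Otimes>\<^sub>M C)) (\<lambda>\<omega>. (X \<omega>, (Y \<omega>, Z \<omega>)))
    = distr M A X \<Otimes>\<^sub>M (distr M B Y \<Otimes>\<^sub>M distr M C Z)"
proof -
  let ?E = "\<lambda>n. [generated_events M A X, generated_events M B Y, generated_events M C Z] ! n"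
  let ?I = "\<lambda>b. if b then {0::nat} else {1, 2}"
  have UI: "(\<Union>b. ?I b) = {..<3}" by (auto simp: UNIV_bool split: if_splits)
  have collect: "indep_sets (\<lambda>b. sigma_sets (space M) (\<Union>i\<in>?I b. ?E i)) UNIV"
  proof (rule indep_sets_collect_sigma)
    show "indep_sets ?E (\<Union>b\<in>UNIV. ?I b)" using indep unfolding UI .
    show "Int_stable (?E i)" if "i \<in> ?I b" for i b
      using that by (auto simp: Int_stable_generated_events split: if_splits)
    show "disjoint_family_on ?I UNIV" by (auto simp: disjoint_family_on_def split: if_splits)
  qed
  have YZ: "distr M (B \<Otimes>\<^sub>M C) (\<lambda>\<omega>. (Y \<omega>, Z \<omega>)) = distr M B Y \<Otimes>\<^sub>M distr M C Z"
  proof (rule distr_pair_indep[OF Y Z])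
    fix b c assume "b \<in> sets B" "c \<in> sets C"
    \<comment> \<open>The empty set only fills position 0 of the list, so that positions 1 and 2
      match those of the independent family.\<close>
    then have "\<forall>n\<in>{1,2}. [{}, Y -` b \<inter> space M, Z -` c \<inter> space M] ! n \<in> ?E n"
      by (auto simp: generated_events_def)
    then have "prob (\<Inter>n\<in>{1,2}. [{}, Y -` b \<inter> space M, Z -` c \<inter> space M] ! n)
        = (\<Prod>n\<in>{1,2}. prob ([{}, Y -` b \<inter> space M, Z -` c \<inter> space M] ! n))"
      by (intro indep_setsD[OF indep]) auto
    then show "prob ((Y -` b \<inter> space M) \<inter> (Z -` c \<inter> space M)) = prob (Y -` b \<inter> space M) * prob (Z -` c \<inter> space M)"
      by simp
  qed
  have "distr M (A \<Otimes>\<^sub>M (B \<Otimes>\<^sub>M C)) (\<lambda>\<omega>. (X \<omega>, (Y \<omega>, Z \<omega>)))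
      = distr M A X \<Otimes>\<^sub>M distr M (B \<Otimes>\<^sub>M C) (\<lambda>\<omega>. (Y \<omega>, Z \<omega>))"
  proof (rule distr_pair_indep[OF X])
    show "(\<lambda>\<omega>. (Y \<omega>, Z \<omega>)) \<in> measurable M (B \<Otimes>\<^sub>M C)" using Y Z by measurable
    fix a c assume a: "a \<in> sets A" and c: "c \<in> sets (B \<Otimes>\<^sub>M C)"
    let ?N = "sigma (space M) (?E 1 \<union> ?E 2)"
    have sub: "?E 1 \<union> ?E 2 \<subseteq> Pow (space M)" by (auto simp: generated_events_def)
    have "Y \<in> measurable ?N B" "Z \<in> measurable ?N C"
      using measurable_space[OF Y] measurable_space[OF Z] sub
      by (auto simp: measurable_def space_measure_of_conv generated_events_def intro!: sigma_sets.Basic)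
    then have "(\<lambda>\<omega>. (Y \<omega>, Z \<omega>)) \<in> measurable ?N (B \<Otimes>\<^sub>M C)" by measurable
    from measurable_sets[OF this c]
    have "(\<lambda>\<omega>. (Y \<omega>, Z \<omega>)) -` c \<inter> space M \<in> sigma_sets (space M) (?E 1 \<union> ?E 2)"
      using sub by (simp add: space_measure_of_conv)
    then have "\<forall>b\<in>UNIV. (if b then X -` a \<inter> space M else (\<lambda>\<omega>. (Y \<omega>, Z \<omega>)) -` c \<inter> space M)
        \<in> sigma_sets (space M) (\<Union>i\<in>?I b. ?E i)"
      using a by (auto simp: generated_events_def intro!: sigma_sets.Basic)
    then have "prob (\<Inter>b\<in>UNIV. if b then X -` a \<inter> space M else (\<lambda>\<omega>. (Y \<omega>, Z \<omega>)) -` c \<inter> space M)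
        = (\<Prod>b\<in>UNIV. prob (if b then X -` a \<inter> space M else (\<lambda>\<omega>. (Y \<omega>, Z \<omega>)) -` c \<inter> space M))"
      by (intro indep_setsD[OF collect]) auto
    then show "prob ((X -` a \<inter> space M) \<inter> ((\<lambda>\<omega>. (Y \<omega>, Z \<omega>)) -` c \<inter> space M))
        = prob (X -` a \<inter> space M) * prob ((\<lambda>\<omega>. (Y \<omega>, Z \<omega>)) -` c \<inter> space M)"
      by (simp add: UNIV_bool Int_commute mult.commute)
  qed
  then show ?thesis unfolding YZ .
qed

section \<open>Joint laws of the input families\<close>

lemma iid_family_measurable: "prob_space S \<Longrightarrow> iid_family S P X I \<Longrightarrow> i \<in> I \<Longrightarrow> X i \<in> measurable S P"
  by (auto simp: iid_family_def prob_space.indep_vars_def)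

lemma iid_family_measurable_PiM:
  "prob_space S \<Longrightarrow> iid_family S P X I \<Longrightarrow> I \<noteq> {} \<Longrightarrow> (\<lambda>\<omega>. \<lambda>i\<in>I. X i \<omega>) \<in> measurable S (\<Pi>\<^sub>M i\<in>I. P)"
  by (intro measurable_restrict iid_family_measurable)

lemma iid_family_distr_PiM:
  assumes S: "prob_space S" and X: "iid_family S P X I" and "I \<noteq> {}"
  shows "distr S (\<Pi>\<^sub>M i\<in>I. P) (\<lambda>\<omega>. \<lambda>i\<in>I. X i \<omega>) = (\<Pi>\<^sub>M i\<in>I. P)"
  using X prob_space.indep_vars_iff_distr_eq_PiM'[OF S \<open>I \<noteq> {}\<close>, of X "\<lambda>_. P"] iid_family_measurable[OF S X]
  by (auto simp: iid_family_def cong: PiM_cong)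

section \<open>Pools as functions of the inputs\<close>

definition step :: "nat \<Rightarrow> (nat \<Rightarrow> real) \<Rightarrow> (nat \<Rightarrow> bvec) \<Rightarrow> (nat \<Rightarrow> nat \<Rightarrow> nat) \<Rightarrow> nat \<Rightarrow> real" where
  "step m y a b = (\<lambda>i\<in>{1..m}. branch (a i) (\<lambda>r. y (b i r)))"

text \<open>
  Restricting every pool to \<open>{1..m}\<close> makes it \<open>undefined\<close>, hence constant, at all other indices. It is
  therefore measurable even though a resampling index may leave \<open>{1..m}\<close> on a null set.
\<close>

primrec rpool :: "nat \<Rightarrow> (nat \<Rightarrow> real) \<Rightarrow> (nat \<times> nat \<Rightarrow> bvec) \<Rightarrow> (nat \<times> nat \<times> nat \<Rightarrow> nat) \<Rightarrow> nat \<Rightarrow> nat \<Rightarrow> real" where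
  "rpool m q w \<iota> 0 = (\<lambda>i\<in>{1..m}. q i)"
| "rpool m q w \<iota> (Suc k) = step m (rpool m q w \<iota> k) (\<lambda>i\<in>{1..m}. w (Suc k, i)) (\<lambda>i\<in>{1..m}. \<lambda>r\<in>{1..}. \<iota> (Suc k, i, r))"

lemma rpool_eq_pool:
  assumes "\<And>p. p \<in> {1..} \<times> {1..m} \<times> {1..} \<Longrightarrow> \<iota> p \<in> {1..m}" "i \<in> {1..m}"
  shows "rpool m (\<lambda>i\<in>{1..m}. q i) (\<lambda>p\<in>{1..}\<times>{1..m}. w p) (\<lambda>p\<in>{1..}\<times>{1..m}\<times>{1..}. \<iota> p) k i = pool q w \<iota> k i"
  using assms(2)
proof (induction k arbitrary: i)
  case (Suc k)
  have "\<iota> (Suc k, i, r) \<in> {1..m}" if "r \<in> {1..Nof (w (Suc k, i))}" for r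
    using assms(1)[of "(Suc k, i, r)"] Suc.prems that by auto
  with Suc show ?case by (auto simp: step_def branch_def intro!: sum.cong)
qed simp

text \<open>The pool of level \<open>k\<close> reads vectors and indices of the levels 1 to
  \<open>k\<close> only. This is what makes it independent of the inputs of level
  \<open>Suc k\<close>.\<close>

lemma rpool_restrict:
  assumes "{1..k} \<times> {1..m} \<subseteq> A" "{1..k} \<times> {1..m} \<times> {1..} \<subseteq> B"
  shows "rpool m q (restrict w A) (restrict \<iota> B) k = rpool m q w \<iota> k"
  using assms
proof (induction k)
  case (Suc k)
  from Suc.prems have sub: "{1..k} \<times> {1..m} \<subseteq> A" "{1..k} \<times> {1..m} \<times> {1..} \<subseteq> B" by auto
  have "(Suc k, i) \<in> A" if "i \<in> {1..m}" for i
    using that by (intro subsetD[OF Suc.prems(1)]) auto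
  then have "(\<lambda>i\<in>{1..m}. restrict w A (Suc k, i)) = (\<lambda>i\<in>{1..m}. w (Suc k, i))"
    by (intro restrict_ext) (simp only: restrict_apply if_True)
  moreover have "(Suc k, i, r) \<in> B" if "i \<in> {1..m}" "r \<in> {1..}" for i r
    using that by (intro subsetD[OF Suc.prems(2)]) auto
  then have "(\<lambda>i\<in>{1..m}. \<lambda>r\<in>{1..}. restrict \<iota> B (Suc k, i, r)) = (\<lambda>i\<in>{1..m}. \<lambda>r\<in>{1..}. \<iota> (Suc k, i, r))"
    by (intro restrict_ext) (simp only: restrict_apply if_True)
  ultimately show ?case by (simp only: rpool.simps Suc.IH[OF sub])
qed simp

context branching_law
begin

lemma step_measurable:
  fixes U :: "nat measure" and m :: nat
  assumes U: "sets U = UNIV"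
    and y: "y \<in> measurable M (\<Pi>\<^sub>M i\<in>{1..m}. borel)"
    and a: "a \<in> measurable M (\<Pi>\<^sub>M i\<in>{1..m}. L)"
    and b: "b \<in> measurable M (\<Pi>\<^sub>M i\<in>{1..m}. \<Pi>\<^sub>M r\<in>{1..}. U)"
  shows "(\<lambda>\<omega>. step m (y \<omega>) (a \<omega>) (b \<omega>)) \<in> measurable M (\<Pi>\<^sub>M i\<in>{1..m}. borel)"
  unfolding step_def
proof (intro measurable_restrict branch_measurable)
  fix i assume i: "i \<in> {1..m}"
  show "(\<lambda>\<omega>. a \<omega> i) \<in> measurable M bvec_space"
    using i by (intro measurable_compose[OF a] measurable_compose[OF measurable_component_singleton[of _ _ "\<lambda>_. L"] id_measurable])
  fix r :: nat assume r: "r \<ge> 1"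
  have yj: "(\<lambda>\<omega>. y \<omega> j) \<in> borel_measurable M" for j
  proof (cases "j \<in> {1..m}")
    case False
    then have "y \<omega> j = undefined" if "\<omega> \<in> space M" for \<omega>
      using measurable_space[OF y that] by (auto simp: space_PiM PiE_def extensional_def)
    then show ?thesis by (subst measurable_cong[where g="\<lambda>_. undefined"]) auto
  qed (intro measurable_compose[OF y] measurable_component_singleton)
  have "(\<lambda>\<omega>. b \<omega> i r) \<in> measurable M U"
    using i r by (intro measurable_compose[OF b] measurable_compose[OF measurable_component_singleton[of _ _ "\<lambda>_. \<Pi>\<^sub>M r\<in>{1..}. U"]
        measurable_component_singleton[of _ _ "\<lambda>_. U"]]) auto
  then have "(\<lambda>\<omega>. b \<omega> i r) \<in> measurable M (count_space UNIV)"
    using measurable_cong_sets[of M M U "count_space UNIV"] U by simp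
  then show "(\<lambda>\<omega>. y \<omega> (b \<omega> i r)) \<in> borel_measurable M"
    by (intro measurable_compose_countable[OF yj])
qed

text \<open>The index sets are left open because the map is needed twice: on the full input space,
  and on the factor that contains only the levels up to \<open>k\<close>.\<close>

lemma rpool_measurable:
  fixes U :: "nat measure" and m k :: nat
  assumes U: "sets U = UNIV" and LQ: "sets LQ = sets borel"
    and sub: "{1..k} \<times> {1..m} \<subseteq> A" "{1..k} \<times> {1..m} \<times> {1..} \<subseteq> B"
  shows "(\<lambda>(q, w, \<iota>). rpool m q w \<iota> k) \<in> measurable ((\<Pi>\<^sub>M i\<in>{1..m}. LQ) \<Otimes>\<^sub>M ((\<Pi>\<^sub>M p\<in>A. L) \<Otimes>\<^sub>M (\<Pi>\<^sub>M p\<in>B. U))) (\<Pi>\<^sub>M i\<in>{1..m}. borel)"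
  using sub
proof (induction k)
  case 0
  have "(\<lambda>x. fst x i) \<in> borel_measurable ((\<Pi>\<^sub>M i\<in>{1..m}. LQ) \<Otimes>\<^sub>M ((\<Pi>\<^sub>M p\<in>A. L) \<Otimes>\<^sub>M (\<Pi>\<^sub>M p\<in>B. U)))" if "i \<in> {1..m}" for i
    using that by (intro measurable_compose[OF measurable_fst] measurable_compose[OF measurable_component_singleton[of _ _ "\<lambda>_. LQ"] measurable_ident_sets[OF LQ]])
  then show ?case unfolding split_beta rpool.simps by (intro measurable_restrict)
next
  case (Suc k)
  from Suc.prems have sub: "{1..k} \<times> {1..m} \<subseteq> A" "{1..k} \<times> {1..m} \<times> {1..} \<subseteq> B" by auto
  have w: "(\<lambda>w. \<lambda>i\<in>{1..m}. w (Suc k, i)) \<in> measurable (\<Pi>\<^sub>M p\<in>A. L) (\<Pi>\<^sub>M i\<in>{1..m}. L)"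
    using Suc.prems by (intro measurable_restrict measurable_component_singleton) auto
  have \<iota>: "(\<lambda>\<iota>. \<lambda>i\<in>{1..m}. \<lambda>r\<in>{1..}. \<iota> (Suc k, i, r)) \<in> measurable (\<Pi>\<^sub>M p\<in>B. U) (\<Pi>\<^sub>M i\<in>{1..m}. \<Pi>\<^sub>M r\<in>{1..}. U)"
    using Suc.prems by (intro measurable_restrict measurable_component_singleton) auto
  show ?case
    using Suc.IH[OF sub] unfolding split_beta rpool.simps
    by (intro step_measurable[OF U] measurable_compose[OF measurable_compose[OF measurable_snd measurable_fst] w]
        measurable_compose[OF measurable_compose[OF measurable_snd measurable_snd] \<iota>])
qed

end

section \<open>Separating blocks of inputs and conditioning on the past levels\<close>

lemma distr_PiM_split_map:
  assumes "I \<noteq> {}" and P: "prob_space L" and AB: "A \<inter> B = {}" "A \<subseteq> I" "B \<subseteq> I"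
    and g: "g \<in> measurable (\<Pi>\<^sub>M i\<in>B. L) N"
  shows "distr (\<Pi>\<^sub>M i\<in>I. L) ((\<Pi>\<^sub>M i\<in>A. L) \<Otimes>\<^sub>M N) (\<lambda>\<omega>. (restrict \<omega> A, g (restrict \<omega> B)))
    = (\<Pi>\<^sub>M i\<in>A. L) \<Otimes>\<^sub>M distr (\<Pi>\<^sub>M i\<in>B. L) N g"
proof -
  interpret A: prob_space "\<Pi>\<^sub>M i\<in>A. L" using P by (intro prob_space_PiM)
  interpret B: prob_space "\<Pi>\<^sub>M i\<in>B. L" using P by (intro prob_space_PiM)
  have r: "(\<lambda>\<omega>. (restrict \<omega> A, restrict \<omega> B)) \<in> measurable (\<Pi>\<^sub>M i\<in>I. L) ((\<Pi>\<^sub>M i\<in>A. L) \<Otimes>\<^sub>M (\<Pi>\<^sub>M i\<in>B. L))"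
    using AB by (intro measurable_Pair measurable_restrict_subset)
  have "(\<Pi>\<^sub>M i\<in>A. L) \<Otimes>\<^sub>M distr (\<Pi>\<^sub>M i\<in>B. L) N g = distr (\<Pi>\<^sub>M i\<in>A. L) (\<Pi>\<^sub>M i\<in>A. L) (\<lambda>x. x) \<Otimes>\<^sub>M distr (\<Pi>\<^sub>M i\<in>B. L) N g"
    unfolding distr_id by (rule refl)
  also have "\<dots> = distr ((\<Pi>\<^sub>M i\<in>A. L) \<Otimes>\<^sub>M (\<Pi>\<^sub>M i\<in>B. L)) ((\<Pi>\<^sub>M i\<in>A. L) \<Otimes>\<^sub>M N) (\<lambda>(x, y). (x, g y))"
    using g by (intro pair_measure_distr prob_space_imp_sigma_finite[OF B.prob_space_distr[OF g]]) auto
  also have "(\<Pi>\<^sub>M i\<in>A. L) \<Otimes>\<^sub>M (\<Pi>\<^sub>M i\<in>B. L)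
      = distr (\<Pi>\<^sub>M i\<in>I. L) ((\<Pi>\<^sub>M i\<in>A. L) \<Otimes>\<^sub>M (\<Pi>\<^sub>M i\<in>B. L)) (\<lambda>\<omega>. (restrict \<omega> A, restrict \<omega> B))"
    by (rule distr_PiM_split[symmetric]) (use assms in auto)
  also have "distr \<dots> ((\<Pi>\<^sub>M i\<in>A. L) \<Otimes>\<^sub>M N) (\<lambda>(x, y). (x, g y))
      = distr (\<Pi>\<^sub>M i\<in>I. L) ((\<Pi>\<^sub>M i\<in>A. L) \<Otimes>\<^sub>M N) (\<lambda>\<omega>. (restrict \<omega> A, g (restrict \<omega> B)))"
    using g by (subst distr_distr[OF _ r]) (auto simp: comp_def split_beta)
  finally show ?thesis by (rule sym)
qed

text \<open>In the application \<open>a\<close> and \<open>c\<close> are the vectors and indices of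
  past levels, \<open>b\<close> and \<open>d\<close> those of the newest level. Exchanging the two
  middle integrals puts the fresh inputs innermost, which amounts to conditioning on the
  past.\<close>

lemma
  assumes sf: "sigma_finite_measure A" "sigma_finite_measure B" "sigma_finite_measure C" "sigma_finite_measure D"
    and f: "(\<lambda>((a, b), (c, d)). f a b c d) \<in> borel_measurable ((A \<Otimes>\<^sub>M B) \<Otimes>\<^sub>M (C \<Otimes>\<^sub>M D))"
  shows nn_integral_middle_swap: "(\<integral>\<^sup>+((a, b), (c, d)). f a b c d \<partial>((A \<Otimes>\<^sub>M B) \<Otimes>\<^sub>M (C \<Otimes>\<^sub>M D)))
      = (\<integral>\<^sup>+(a, c). (\<integral>\<^sup>+(b, d). f a b c d \<partial>(B \<Otimes>\<^sub>M D)) \<partial>(A \<Otimes>\<^sub>M C))" (is ?eq)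
    and measurable_middle_swap: "(\<lambda>(a, c). \<integral>\<^sup>+(b, d). f a b c d \<partial>(B \<Otimes>\<^sub>M D)) \<in> borel_measurable (A \<Otimes>\<^sub>M C)" (is ?m)
proof -
  interpret A: sigma_finite_measure A by fact
  interpret B: sigma_finite_measure B by fact
  interpret C: sigma_finite_measure C by fact
  interpret D: sigma_finite_measure D by fact
  interpret BC: pair_sigma_finite B C ..
  interpret BD: pair_sigma_finite B D ..
  interpret CD: pair_sigma_finite C D ..
  have f'[measurable (raw)]: "(\<lambda>x. f (a x) (b x) (c x) (d x)) \<in> borel_measurable M"
    if "a \<in> measurable M A" "b \<in> measurable M B" "c \<in> measurable M C" "d \<in> measurable M D"
    for a b c d and M :: "'z measure"
    using measurable_compose[OF measurable_Pair[OF measurable_Pair[OF that(1,2)] measurable_Pair[OF that(3,4)]] f] by simp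
  show ?m unfolding case_prod_beta' by measurable
  have "(\<integral>\<^sup>+((a, b), (c, d)). f a b c d \<partial>((A \<Otimes>\<^sub>M B) \<Otimes>\<^sub>M (C \<Otimes>\<^sub>M D)))
      = (\<integral>\<^sup>+a. \<integral>\<^sup>+b. \<integral>\<^sup>+c. \<integral>\<^sup>+d. f a b c d \<partial>D \<partial>C \<partial>B \<partial>A)"
  proof -
    have "(\<integral>\<^sup>+((a, b), (c, d)). f a b c d \<partial>((A \<Otimes>\<^sub>M B) \<Otimes>\<^sub>M (C \<Otimes>\<^sub>M D)))
        = (\<integral>\<^sup>+x. \<integral>\<^sup>+y. f (fst x) (snd x) (fst y) (snd y) \<partial>(C \<Otimes>\<^sub>M D) \<partial>(A \<Otimes>\<^sub>M B))"
      unfolding case_prod_beta' by (subst CD.nn_integral_fst[symmetric]) simp_all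
    also have "\<dots> = (\<integral>\<^sup>+x. \<integral>\<^sup>+c. \<integral>\<^sup>+d. f (fst x) (snd x) c d \<partial>D \<partial>C \<partial>(A \<Otimes>\<^sub>M B))"
      by (intro nn_integral_cong, subst D.nn_integral_fst[symmetric]) (auto simp: space_pair_measure)
    also have "\<dots> = (\<integral>\<^sup>+a. \<integral>\<^sup>+b. \<integral>\<^sup>+c. \<integral>\<^sup>+d. f a b c d \<partial>D \<partial>C \<partial>B \<partial>A)"
      by (subst B.nn_integral_fst[symmetric]) simp_all
    finally show ?thesis .
  qed
  also have "\<dots> = (\<integral>\<^sup>+a. \<integral>\<^sup>+c. \<integral>\<^sup>+b. \<integral>\<^sup>+d. f a b c d \<partial>D \<partial>B \<partial>C \<partial>A)"
    by (intro nn_integral_cong BC.Fubini'[symmetric]) simp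
  also have "\<dots> = (\<integral>\<^sup>+(a, c). (\<integral>\<^sup>+(b, d). f a b c d \<partial>(B \<Otimes>\<^sub>M D)) \<partial>(A \<Otimes>\<^sub>M C))"
  proof -
    have "(\<integral>\<^sup>+(a, c). (\<integral>\<^sup>+(b, d). f a b c d \<partial>(B \<Otimes>\<^sub>M D)) \<partial>(A \<Otimes>\<^sub>M C))
        = (\<integral>\<^sup>+a. \<integral>\<^sup>+c. \<integral>\<^sup>+(b, d). f a b c d \<partial>(B \<Otimes>\<^sub>M D) \<partial>C \<partial>A)"
      unfolding case_prod_beta' by (subst C.nn_integral_fst[symmetric]) simp_all
    also have "\<dots> = (\<integral>\<^sup>+a. \<integral>\<^sup>+c. \<integral>\<^sup>+b. \<integral>\<^sup>+d. f a b c d \<partial>D \<partial>B \<partial>C \<partial>A)"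
      unfolding case_prod_beta' by (intro nn_integral_cong, subst D.nn_integral_fst[symmetric]) simp_all
    finally show ?thesis by simp
  qed
  finally show ?eq .
qed

context branching_law
begin

text \<open>Conditional expectation given the first \<open>k\<close> levels, written with iterated
  integrals. The inputs of level \<open>Suc k\<close> are independent of the pool of level
  \<open>k\<close>; integrating them out with that pool frozen is \<open>bootstrap_step_law\<close>.
  The initial values are kept fixed until the end, since they are independent of all later
  inputs.\<close>

lemma nn_integral_rpool_Suc:
  fixes m k :: nat
  assumes LQ: "prob_space LQ" "sets LQ = sets borel" and m: "m \<ge> 1"
    and A: "A \<in> borel_measurable (\<Pi>\<^sub>M i\<in>{1..m}. borel)"
  defines "U \<equiv> measure_pmf (pmf_of_set {1..m})"
  defines "C \<equiv> (\<Pi>\<^sub>M i\<in>{1..m}. LQ) \<Otimes>\<^sub>M ((\<Pi>\<^sub>M p\<in>{1..}\<times>{1..m}. L) \<Otimes>\<^sub>M (\<Pi>\<^sub>M p\<in>{1..}\<times>{1..m}\<times>{1..}. U))"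
  shows "(\<integral>\<^sup>+(q, w, \<iota>). A (rpool m q w \<iota> (Suc k)) \<partial>C)
    = (\<integral>\<^sup>+(q, w, \<iota>). (\<integral>\<^sup>+z. A z \<partial>(\<Pi>\<^sub>M i\<in>{1..m}. smooth L (emp_law m (rpool m q w \<iota> k)))) \<partial>C)" (is "?L = ?R")
    and "(\<lambda>(q, w, \<iota>). A (rpool m q w \<iota> k)) \<in> borel_measurable C"
proof -
  let ?I = "{1..m}"
  let ?WI = "{1::nat..}\<times>?I" and ?WA = "{1..k}\<times>?I" and ?WB = "{Suc k}\<times>?I"
  let ?JI = "{1::nat..}\<times>?I\<times>{1::nat..}" and ?JA = "{1..k}\<times>?I\<times>{1::nat..}" and ?JB = "{Suc k}\<times>?I\<times>{1::nat..}"
  let ?M0 = "\<Pi>\<^sub>M i\<in>?I. LQ"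
  let ?MW = "\<Pi>\<^sub>M p\<in>?WI. L" and ?PW = "\<Pi>\<^sub>M p\<in>?WA. L" and ?GW = "\<Pi>\<^sub>M i\<in>?I. L"
  let ?MJ = "\<Pi>\<^sub>M p\<in>?JI. U" and ?PJ = "\<Pi>\<^sub>M p\<in>?JA. U" and ?GJ = "\<Pi>\<^sub>M i\<in>?I. \<Pi>\<^sub>M r\<in>{1..}. U"
  let ?gw = "\<lambda>w. \<lambda>i\<in>?I. w (Suc k, i)" and ?gj = "\<lambda>\<iota>. \<lambda>i\<in>?I. \<lambda>r\<in>{1..}. \<iota> (Suc k, i, r)"
  have I: "?I \<noteq> {}" using m by simp
  have U: "prob_space U" "sets U = UNIV" by (auto simp: U_def intro: prob_space_measure_pmf)
  interpret M0: prob_space ?M0 using LQ by (intro prob_space_PiM)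
  interpret MW: prob_space ?MW using prob_L by (intro prob_space_PiM)
  interpret PW: prob_space ?PW using prob_L by (intro prob_space_PiM)
  interpret GW: prob_space ?GW using prob_L by (intro prob_space_PiM)
  interpret MJ: prob_space ?MJ using U by (intro prob_space_PiM)
  interpret PJ: prob_space ?PJ using U by (intro prob_space_PiM)
  interpret GJ: prob_space ?GJ using U by (intro prob_space_PiM)
  interpret WJ: pair_prob_space ?MW ?MJ ..
  interpret G: pair_prob_space ?GW ?GJ ..
  \<comment> \<open>Splits vectors and indices into the levels up to \<open>k\<close> and the level
    \<open>Suc k\<close>, the latter regrouped by pool member; higher levels are dropped. By
    \<open>law\<close> below, the four pieces are independent with the expected product
    laws.\<close>
  let ?T = "\<lambda>(w, \<iota>). ((restrict w ?WA, ?gw w), (restrict \<iota> ?JA, ?gj \<iota>))"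
  let ?P = "(?PW \<Otimes>\<^sub>M ?GW) \<Otimes>\<^sub>M (?PJ \<Otimes>\<^sub>M ?GJ)"
  have gw: "?gw \<in> measurable (\<Pi>\<^sub>M p\<in>B. L) ?GW" if "?WB \<subseteq> B" for B
    using that by (intro measurable_restrict measurable_component_singleton) auto
  have gj: "?gj \<in> measurable (\<Pi>\<^sub>M p\<in>B. U) ?GJ" if "?JB \<subseteq> B" for B
    using that by (intro measurable_restrict measurable_component_singleton) auto
  have Tw: "(\<lambda>w. (restrict w ?WA, ?gw w)) \<in> measurable ?MW (?PW \<Otimes>\<^sub>M ?GW)"
    by (intro measurable_Pair measurable_restrict_subset gw) auto
  have Tj: "(\<lambda>\<iota>. (restrict \<iota> ?JA, ?gj \<iota>)) \<in> measurable ?MJ (?PJ \<Otimes>\<^sub>M ?GJ)"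
    by (intro measurable_Pair measurable_restrict_subset gj) auto
  have T: "?T \<in> measurable (?MW \<Otimes>\<^sub>M ?MJ) ?P"
    using measurable_Pair[OF measurable_compose[OF measurable_fst Tw] measurable_compose[OF measurable_snd Tj]]
    by (simp add: case_prod_beta')
  have law_w: "distr ?MW (?PW \<Otimes>\<^sub>M ?GW) (\<lambda>w. (restrict w ?WA, ?gw w)) = ?PW \<Otimes>\<^sub>M ?GW"
  proof -
    have "distr ?MW (?PW \<Otimes>\<^sub>M ?GW) (\<lambda>w. (restrict w ?WA, ?gw (restrict w ?WB)))
        = ?PW \<Otimes>\<^sub>M distr (\<Pi>\<^sub>M p\<in>?WB. L) ?GW ?gw"
      by (rule distr_PiM_split_map[OF _ prob_L _ _ _ gw]) (use m in auto)
    also have "distr (\<Pi>\<^sub>M p\<in>?WB. L) ?GW ?gw = ?GW"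
      by (rule distr_PiM_reindex[where f="\<lambda>i. (Suc k, i)"]) (auto simp: inj_on_def prob_L)
    also have "(\<lambda>w. (restrict w ?WA, ?gw (restrict w ?WB))) = (\<lambda>w. (restrict w ?WA, ?gw w))"
      by (auto simp: fun_eq_iff)
    finally show ?thesis .
  qed
  have law_j: "distr ?MJ (?PJ \<Otimes>\<^sub>M ?GJ) (\<lambda>\<iota>. (restrict \<iota> ?JA, ?gj \<iota>)) = ?PJ \<Otimes>\<^sub>M ?GJ"
  proof -
    have "distr ?MJ (?PJ \<Otimes>\<^sub>M ?GJ) (\<lambda>\<iota>. (restrict \<iota> ?JA, ?gj (restrict \<iota> ?JB)))
        = ?PJ \<Otimes>\<^sub>M distr (\<Pi>\<^sub>M p\<in>?JB. U) ?GJ ?gj"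
      by (rule distr_PiM_split_map[OF _ U(1) _ _ _ gj]) (use m in auto)
    also have "distr (\<Pi>\<^sub>M p\<in>?JB. U) ?GJ ?gj = ?GJ"
      by (rule distr_PiM_group[OF U(1) I, where h="\<lambda>i r. (Suc k, i, r)"]) (auto simp: inj_on_def)
    also have "(\<lambda>\<iota>. (restrict \<iota> ?JA, ?gj (restrict \<iota> ?JB))) = (\<lambda>\<iota>. (restrict \<iota> ?JA, ?gj \<iota>))"
      by (auto simp: fun_eq_iff)
    finally show ?thesis .
  qed
  have law: "distr (?MW \<Otimes>\<^sub>M ?MJ) ?P ?T = ?P"
  proof -
    have "distr ?MW (?PW \<Otimes>\<^sub>M ?GW) (\<lambda>w. (restrict w ?WA, ?gw w)) \<Otimes>\<^sub>M distr ?MJ (?PJ \<Otimes>\<^sub>M ?GJ) (\<lambda>\<iota>. (restrict \<iota> ?JA, ?gj \<iota>))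
        = distr (?MW \<Otimes>\<^sub>M ?MJ) ?P ?T"
      by (intro pair_measure_distr Tw Tj prob_space_imp_sigma_finite[OF MJ.prob_space_distr[OF Tj]])
    then show ?thesis unfolding law_w law_j by (rule sym)
  qed
  have Tint: "(\<integral>\<^sup>+x. g (?T x) \<partial>(?MW \<Otimes>\<^sub>M ?MJ)) = (\<integral>\<^sup>+x. g x \<partial>?P)" if "g \<in> borel_measurable ?P" for g
    using nn_integral_distr[OF T, unfolded law, OF that] by (rule sym)
  have rp: "rpool m q w \<iota> k = rpool m q (restrict w ?WA) (restrict \<iota> ?JA) k" for q w \<iota>
    by (rule rpool_restrict[symmetric]) auto
  have A': "A \<in> borel_measurable (\<Pi>\<^sub>M i\<in>?I. smooth L \<nu>)" for \<nu>
    using A by (simp cong: measurable_cong_sets sets_PiM_cong)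
  have meas: "(\<lambda>(q, w, \<iota>). rpool m q w \<iota> n) \<in> measurable C (\<Pi>\<^sub>M i\<in>?I. borel)" for n
    unfolding C_def by (rule rpool_measurable[OF U(2) LQ(2)]) auto
  from measurable_compose[OF this A] have AC: "(\<lambda>(q, w, \<iota>). A (rpool m q w \<iota> n)) \<in> borel_measurable C" for n
    by (simp add: case_prod_beta')
  then show "(\<lambda>(q, w, \<iota>). A (rpool m q w \<iota> k)) \<in> borel_measurable C" .
  let ?H = "\<lambda>q wa ja. \<integral>\<^sup>+z. A z \<partial>(\<Pi>\<^sub>M i\<in>?I. smooth L (emp_law m (rpool m q wa ja k)))"
  let ?f = "\<lambda>q wa a ja b. A (step m (rpool m q wa ja k) a b)"
  have stepm: "(\<lambda>x. step m (rpool m q (wa x) (ja x) k) (a x) (b x)) \<in> measurable M (\<Pi>\<^sub>M i\<in>?I. borel)"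
    if "q \<in> space ?M0" "wa \<in> measurable M ?PW" "a \<in> measurable M ?GW" "ja \<in> measurable M ?PJ" "b \<in> measurable M ?GJ"
    for q wa a ja b and M :: "'z measure"
  proof (intro step_measurable[OF U(2) _ that(3,5)])
    have "(\<lambda>(q, w, \<iota>). rpool m q w \<iota> k) \<in> measurable (?M0 \<Otimes>\<^sub>M (?PW \<Otimes>\<^sub>M ?PJ)) (\<Pi>\<^sub>M i\<in>?I. borel)"
      by (rule rpool_measurable[OF U(2) LQ(2)]) auto
    from measurable_compose[OF measurable_Pair[OF measurable_const[OF that(1)] measurable_Pair[OF that(2,4)]] this]
    show "(\<lambda>x. rpool m q (wa x) (ja x) k) \<in> measurable M (\<Pi>\<^sub>M i\<in>?I. borel)" by simp
  qed
  have inner: "(\<integral>\<^sup>+(a, b). ?f q wa a ja b \<partial>(?GW \<Otimes>\<^sub>M ?GJ)) = ?H q wa ja" for q wa ja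
  proof -
    have s: "(\<lambda>(a, b). step m (rpool m q wa ja k) a b) \<in> measurable (?GW \<Otimes>\<^sub>M ?GJ) (\<Pi>\<^sub>M i\<in>?I. borel)" if "rpool m q wa ja k \<in> space (\<Pi>\<^sub>M i\<in>?I. borel)"
      unfolding case_prod_beta' by (rule step_measurable[OF U(2) measurable_const[OF that]]) auto
    have "rpool m q wa ja k \<in> space (\<Pi>\<^sub>M i\<in>?I. borel)"
      by (cases k) (auto simp: step_def space_PiM)
    note s = s[OF this]
    have "?H q wa ja = (\<integral>\<^sup>+z. A z \<partial>distr (?GW \<Otimes>\<^sub>M ?GJ) (\<Pi>\<^sub>M i\<in>?I. borel) (\<lambda>(a, b). step m (rpool m q wa ja k) a b))"
      unfolding step_def U_def bootstrap_step_law ..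
    also have "\<dots> = (\<integral>\<^sup>+(a, b). ?f q wa a ja b \<partial>(?GW \<Otimes>\<^sub>M ?GJ))"
      using A by (subst nn_integral_distr[OF s]) (auto simp: case_prod_beta')
    finally show ?thesis by simp
  qed
  have sf: "sigma_finite_measure ?PW" "sigma_finite_measure ?GW" "sigma_finite_measure ?PJ" "sigma_finite_measure ?GJ" ..
  have *: "(\<integral>\<^sup>+(w, \<iota>). A (rpool m q w \<iota> (Suc k)) \<partial>(?MW \<Otimes>\<^sub>M ?MJ)) = (\<integral>\<^sup>+(w, \<iota>). ?H q w \<iota> \<partial>(?MW \<Otimes>\<^sub>M ?MJ))"
    and **: "(\<lambda>(w, \<iota>). ?H q w \<iota>) \<in> borel_measurable (?MW \<Otimes>\<^sub>M ?MJ)"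
    if q: "q \<in> space ?M0" for q
  proof -
    have fm: "(\<lambda>((wa, a), (ja, b)). ?f q wa a ja b) \<in> borel_measurable ?P"
      unfolding case_prod_beta' by (intro measurable_compose[OF stepm[OF q] A]) measurable
    note hm = measurable_middle_swap[OF sf fm, unfolded inner]
    have hm': "(\<lambda>((wa, a :: nat \<Rightarrow> bvec), (ja, b :: nat \<Rightarrow> nat \<Rightarrow> nat)). ?H q wa ja) \<in> borel_measurable ?P"
      using measurable_compose[OF measurable_Pair[OF measurable_compose[OF measurable_fst measurable_fst] measurable_compose[OF measurable_snd measurable_fst]] hm]
      by (simp add: case_prod_beta')
    have "(\<integral>\<^sup>+(w, \<iota>). A (rpool m q w \<iota> (Suc k)) \<partial>(?MW \<Otimes>\<^sub>M ?MJ))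
        = (\<integral>\<^sup>+x. (\<lambda>((wa, a), (ja, b)). ?f q wa a ja b) (?T x) \<partial>(?MW \<Otimes>\<^sub>M ?MJ))"
      by (intro nn_integral_cong) (simp only: case_prod_beta' rpool.simps rp[symmetric] fst_conv snd_conv)
    also have "\<dots> = (\<integral>\<^sup>+((wa, a), (ja, b)). ?f q wa a ja b \<partial>?P)"
      by (rule Tint[OF fm])
    also have "\<dots> = (\<integral>\<^sup>+(wa, ja). ?H q wa ja \<partial>(?PW \<Otimes>\<^sub>M ?PJ))"
      unfolding nn_integral_middle_swap[OF sf fm] inner ..
    \<comment> \<open>The function \<open>?H\<close> ignores the fresh inputs, whose law has total
      mass 1. They can be inserted again, and the change of variables \<open>?T\<close> is then
      undone.\<close>
    also have "\<dots> = (\<integral>\<^sup>+((wa, a :: nat \<Rightarrow> bvec), (ja, b :: nat \<Rightarrow> nat \<Rightarrow> nat)). ?H q wa ja \<partial>?P)"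
      unfolding nn_integral_middle_swap[OF sf hm'] by (simp only: case_prod_beta' nn_integral_const G.emeasure_space_1 mult_1_right)
    also have "\<dots> = (\<integral>\<^sup>+x. (\<lambda>((wa, a :: nat \<Rightarrow> bvec), (ja, b :: nat \<Rightarrow> nat \<Rightarrow> nat)). ?H q wa ja) (?T x) \<partial>(?MW \<Otimes>\<^sub>M ?MJ))"
      by (rule Tint[OF hm', symmetric])
    also have "\<dots> = (\<integral>\<^sup>+(w, \<iota>). ?H q w \<iota> \<partial>(?MW \<Otimes>\<^sub>M ?MJ))"
      by (intro nn_integral_cong) (simp only: case_prod_beta' rpool.simps rp[symmetric] fst_conv snd_conv)
    finally show "(\<integral>\<^sup>+(w, \<iota>). A (rpool m q w \<iota> (Suc k)) \<partial>(?MW \<Otimes>\<^sub>M ?MJ)) = (\<integral>\<^sup>+(w, \<iota>). ?H q w \<iota> \<partial>(?MW \<Otimes>\<^sub>M ?MJ))" .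
    show "(\<lambda>(w, \<iota>). ?H q w \<iota>) \<in> borel_measurable (?MW \<Otimes>\<^sub>M ?MJ)"
      using measurable_compose[OF T hm'] by (simp only: case_prod_beta' rpool.simps rp[symmetric] fst_conv snd_conv)
  qed
  have HC: "(\<lambda>(q, w, \<iota>). ?H q w \<iota>) \<in> borel_measurable C"
  proof -
    have "(\<lambda>(x, y). A (step m (case x of (q, w, \<iota>) \<Rightarrow> rpool m q w \<iota> k) (fst y) (snd y))) \<in> borel_measurable (C \<Otimes>\<^sub>M (?GW \<Otimes>\<^sub>M ?GJ))"
      unfolding split_beta[where prod="x :: (_ \<times> _) \<times> _" for x]
      by (intro measurable_compose[OF step_measurable[OF U(2)] A] measurable_compose[OF measurable_fst meas])
         (auto intro!: measurable_compose[OF measurable_snd measurable_fst] measurable_compose[OF measurable_snd measurable_snd])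
    from G.borel_measurable_nn_integral[OF this] show ?thesis
      unfolding inner[symmetric] by (simp only: case_prod_beta')
  qed
  have "?L = (\<integral>\<^sup>+q. \<integral>\<^sup>+(w, \<iota>). A (rpool m q w \<iota> (Suc k)) \<partial>(?MW \<Otimes>\<^sub>M ?MJ) \<partial>?M0)"
    using WJ.nn_integral_fst[OF AC[of "Suc k", unfolded C_def]] unfolding C_def by (simp only: case_prod_beta' fst_conv snd_conv)
  also have "\<dots> = (\<integral>\<^sup>+q. \<integral>\<^sup>+(w, \<iota>). ?H q w \<iota> \<partial>(?MW \<Otimes>\<^sub>M ?MJ) \<partial>?M0)"
    by (intro nn_integral_cong *)
  also have "\<dots> = ?R"
    using WJ.nn_integral_fst[OF HC[unfolded C_def]] unfolding C_def by (simp only: case_prod_beta' fst_conv snd_conv)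
  finally show "?L = ?R" .
qed


text \<open>As \<open>H\<close> bounds the moments of all iterates, the sampling error
  \<open>c\<close> is the same at every level, and the mean distance obeys u(k+1) \<le> rho_1 u(k) +
  c. The recursion is kept in extended reals and iterated without summing the series, so it is valid
  for rho_1 = 1 as well.\<close>

lemma bootstrap_area_dist_bound:
  fixes m k :: nat and \<alpha> H :: real
  assumes LQ: "real_distribution LQ" and m: "m \<ge> 1" and \<alpha>: "1 < \<alpha>" "\<alpha> < 2" and H: "0 \<le> H"
    and mom: "\<And>k. (\<integral>\<^sup>+x. ennreal (\<bar>x\<bar> powr \<alpha>) \<partial>((smooth L ^^ k) LQ)) \<le> ennreal H"
  defines "U \<equiv> measure_pmf (pmf_of_set {1..m})"
  defines "C \<equiv> (\<Pi>\<^sub>M i\<in>{1..m}. LQ) \<Otimes>\<^sub>M ((\<Pi>\<^sub>M p\<in>{1..}\<times>{1..m}. L) \<Otimes>\<^sub>M (\<Pi>\<^sub>M p\<in>{1..}\<times>{1..m}\<times>{1..}. U))"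
  defines "c \<equiv> ennreal (2 * (2 * H / (\<alpha> - 1) + sqrt H / (1 - \<alpha> / 2)) * m powr (-1 + 1 / \<alpha>))"
  shows "(\<integral>\<^sup>+(q, w, \<iota>). area_dist (empirical_df m (rpool m q w \<iota> k)) (cdf ((smooth L ^^ k) LQ)) \<partial>C)
    \<le> c * (\<Sum>i\<le>k. lrho L 1 ^ i)"
proof -
  interpret LQ: real_distribution LQ by fact
  have \<mu>: "real_distribution ((smooth L ^^ k) LQ)" for k
    by (induction k) (auto simp: LQ real_distribution_smooth)
  have F: "cdf ((smooth L ^^ k) LQ) \<in> borel_measurable borel" for k
  proof -
    interpret real_distribution "(smooth L ^^ k) LQ" by (rule \<mu>)
    show ?thesis by simp
  qed
  have emp: "(\<integral>\<^sup>+z. area_dist (empirical_df m z) (cdf ((smooth L ^^ k) LQ)) \<partial>(\<Pi>\<^sub>M i\<in>{1..m}. (smooth L ^^ k) LQ)) \<le> c" for k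
    unfolding c_def by (rule area_dist_empirical_moment_bound[OF \<mu> \<alpha> H m mom])
  have U: "prob_space U" unfolding U_def by (rule prob_space_measure_pmf)
  interpret W: prob_space "\<Pi>\<^sub>M p\<in>{1..}\<times>{1..m}. L" using prob_L by (intro prob_space_PiM)
  interpret J: prob_space "\<Pi>\<^sub>M p\<in>{1..}\<times>{1..m}\<times>{1..}. U" using U by (intro prob_space_PiM)
  interpret WJ: pair_prob_space "\<Pi>\<^sub>M p\<in>{1..}\<times>{1..m}. L" "\<Pi>\<^sub>M p\<in>{1..}\<times>{1..m}\<times>{1..}. U" ..
  interpret Q: prob_space "\<Pi>\<^sub>M i\<in>{1..m}. LQ" using LQ.prob_space_axioms by (intro prob_space_PiM)
  interpret QWJ: pair_prob_space "\<Pi>\<^sub>M i\<in>{1..m}. LQ"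
    "(\<Pi>\<^sub>M p\<in>{1..}\<times>{1..m}. L) \<Otimes>\<^sub>M (\<Pi>\<^sub>M p\<in>{1..}\<times>{1..m}\<times>{1..}. U)" ..
  interpret C: prob_space C unfolding C_def by (rule QWJ.prob_space_axioms)
  note rec = nn_integral_rpool_Suc[OF LQ.prob_space_axioms LQ.events_eq_borel m, folded U_def, folded C_def]
  show ?thesis
  proof (induction k)
    case 0
    have A: "(\<lambda>z. area_dist (empirical_df m z) (cdf LQ)) \<in> borel_measurable (\<Pi>\<^sub>M i\<in>{1..m}. LQ)"
      using empirical_area_dist_measurable[OF F[of 0]] by (simp cong: measurable_cong_sets sets_PiM_cong)
    have "(\<integral>\<^sup>+(q, w, \<iota>). area_dist (empirical_df m (rpool m q w \<iota> 0)) (cdf ((smooth L ^^ 0) LQ)) \<partial>C)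
        = (\<integral>\<^sup>+x. area_dist (empirical_df m (fst x)) (cdf LQ) \<partial>C)"
      by (simp only: case_prod_beta' rpool.simps empirical_df_restrict funpow.simps id_apply)
    also have "\<dots> = (\<integral>\<^sup>+q. area_dist (empirical_df m q) (cdf LQ) \<partial>(\<Pi>\<^sub>M i\<in>{1..m}. LQ))"
      unfolding C_def
      by (subst WJ.nn_integral_fst[symmetric, OF measurable_compose[OF measurable_fst A]])
         (simp only: fst_conv nn_integral_const WJ.emeasure_space_1 mult_1_right)
    also have "\<dots> \<le> c" using emp[of 0] by simp
    also have "c = c * (\<Sum>i\<le>0. lrho L 1 ^ i)" by simp
    finally show ?case .
  next
    case (Suc k)
    let ?F = "\<lambda>k. cdf ((smooth L ^^ k) LQ)"
    have "(\<integral>\<^sup>+(q, w, \<iota>). area_dist (empirical_df m (rpool m q w \<iota> (Suc k))) (?F (Suc k)) \<partial>C)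
        = (\<integral>\<^sup>+(q, w, \<iota>). (\<integral>\<^sup>+z. area_dist (empirical_df m z) (?F (Suc k))
            \<partial>(\<Pi>\<^sub>M i\<in>{1..m}. smooth L (emp_law m (rpool m q w \<iota> k)))) \<partial>C)"
      by (rule rec(1)[OF empirical_area_dist_measurable[OF F]])
    also have "\<dots> \<le> (\<integral>\<^sup>+(q, w, \<iota>). lrho L 1 * area_dist (empirical_df m (rpool m q w \<iota> k)) (?F k) + c \<partial>C)"
    proof (intro nn_integral_mono, unfold case_prod_beta')
      fix x :: "(nat \<Rightarrow> real) \<times> (nat \<times> nat \<Rightarrow> bvec) \<times> (nat \<times> nat \<times> nat \<Rightarrow> nat)"
      let ?y = "rpool m (fst x) (fst (snd x)) (snd (snd x)) k"
      have "(\<integral>\<^sup>+z. area_dist (empirical_df m z) (?F (Suc k)) \<partial>(\<Pi>\<^sub>M i\<in>{1..m}. smooth L (emp_law m ?y)))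
          \<le> lrho L 1 * area_dist (cdf (emp_law m ?y)) (?F k)
            + (\<integral>\<^sup>+z. area_dist (empirical_df m z) (?F (Suc k)) \<partial>(\<Pi>\<^sub>M i\<in>{1..m}. (smooth L ^^ Suc k) LQ))"
        using bootstrap_step_contraction[OF real_distribution_emp_law \<mu> m] by simp
      also have "\<dots> \<le> lrho L 1 * area_dist (empirical_df m ?y) (?F k) + c"
        unfolding cdf_emp_law[OF m] by (intro add_left_mono emp)
      finally show "(\<integral>\<^sup>+z. area_dist (empirical_df m z) (?F (Suc k)) \<partial>(\<Pi>\<^sub>M i\<in>{1..m}. smooth L (emp_law m ?y)))
        \<le> lrho L 1 * area_dist (empirical_df m ?y) (?F k) + c" .
    qed
    also have "\<dots> = lrho L 1 * (\<integral>\<^sup>+(q, w, \<iota>). area_dist (empirical_df m (rpool m q w \<iota> k)) (?F k) \<partial>C) + c"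
      using rec(2)[OF empirical_area_dist_measurable[OF F], of k k] unfolding case_prod_beta'
      by (subst nn_integral_add)
         (auto simp: nn_integral_cmult C.emeasure_space_1)
    also have "\<dots> \<le> lrho L 1 * (c * (\<Sum>i\<le>k. lrho L 1 ^ i)) + c"
      by (intro add_right_mono mult_left_mono Suc.IH) simp
    also have "\<dots> = c * (\<Sum>i\<le>Suc k. lrho L 1 ^ i)"
      by (simp add: sum.atMost_Suc_shift sum_distrib_left algebra_simps del: sum.atMost_Suc)
    finally show ?case .
  qed
qed

text \<open>Passage from an arbitrary space carrying the inputs to the product space of their laws.
  The pool agrees with \<open>rpool\<close> almost surely, because almost surely every resampling
  index lies in \<open>{1..m}\<close>, and \<open>rpool\<close> is a measurable function of the
  joint input.\<close>

lemma nn_integral_bootstrap_pool: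
  fixes m k :: nat
  assumes LQ: "prob_space LQ" "sets LQ = sets borel" and m: "m \<ge> 1"
    and boot: "bootstrap_input S LQ L m Q0 W J"
    and F: "F \<in> borel_measurable borel"
  defines "U \<equiv> measure_pmf (pmf_of_set {1..m})"
  defines "C \<equiv> (\<Pi>\<^sub>M i\<in>{1..m}. LQ) \<Otimes>\<^sub>M ((\<Pi>\<^sub>M p\<in>{1..}\<times>{1..m}. L) \<Otimes>\<^sub>M (\<Pi>\<^sub>M p\<in>{1..}\<times>{1..m}\<times>{1..}. U))"
  shows "(\<integral>\<^sup>+\<omega>. area_dist (empirical_df m (pool (\<lambda>i. Q0 i \<omega>) (\<lambda>p. W p \<omega>) (\<lambda>p. J p \<omega>) k)) F \<partial>S)
    = (\<integral>\<^sup>+(q, w, \<iota>). area_dist (empirical_df m (rpool m q w \<iota> k)) F \<partial>C)"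
proof -
  let ?I0 = "{1..m}" and ?IW = "{1::nat..} \<times> {1..m}" and ?IJ = "{1::nat..} \<times> {1..m} \<times> {1::nat..}"
  let ?XQ = "\<lambda>\<omega>. \<lambda>i\<in>?I0. Q0 i \<omega>" and ?XW = "\<lambda>\<omega>. \<lambda>p\<in>?IW. W p \<omega>" and ?XJ = "\<lambda>\<omega>. \<lambda>p\<in>?IJ. J p \<omega>"
  let ?M0 = "\<Pi>\<^sub>M i\<in>?I0. LQ" and ?MW = "\<Pi>\<^sub>M p\<in>?IW. L" and ?MJ = "\<Pi>\<^sub>M p\<in>?IJ. U"
  have S: "prob_space S" and iid: "iid_family S LQ Q0 ?I0" "iid_family S L W ?IW" "iid_family S U J ?IJ"
    and ind: "prob_space.indep_sets S
      (\<lambda>n. [generated_events S ?M0 ?XQ, generated_events S ?MW ?XW, generated_events S ?MJ ?XJ] ! n) {..<3}"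
    using boot by (simp_all only: bootstrap_input_def Let_def U_def)
  interpret S: prob_space S by (rule S)
  note rv1 = iid_family_measurable and rv = iid_family_measurable_PiM[OF S] and law = iid_family_distr_PiM[OF S]
  have ne: "?I0 \<noteq> {}" "?IW \<noteq> {}" "?IJ \<noteq> {}" using m by auto
  let ?X = "\<lambda>\<omega>. (?XQ \<omega>, (?XW \<omega>, ?XJ \<omega>))"
  have X: "?X \<in> measurable S C" unfolding C_def
    by (intro measurable_Pair rv[OF iid(1) ne(1)] rv[OF iid(2) ne(2)] rv[OF iid(3) ne(3)])
  have lawX: "distr S C ?X = C"
    unfolding C_def
    using S.distr_triple_indep[OF rv[OF iid(1) ne(1)] rv[OF iid(2) ne(2)] rv[OF iid(3) ne(3)] ind]
    unfolding law[OF iid(1) ne(1)] law[OF iid(2) ne(2)] law[OF iid(3) ne(3)] .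
  have "AE \<omega> in S. J p \<omega> \<in> {1..m}" if "p \<in> ?IJ" for p
  proof -
    have "AE i in U. i \<in> {1..m}" unfolding U_def AE_measure_pmf_iff using m by (subst set_pmf_of_set) auto
    then have "AE i in distr S U (J p). i \<in> {1..m}" unfolding bspec[OF conjunct2[OF iid(3)[unfolded iid_family_def]] that] .
    then show ?thesis by (rule AE_distrD[OF rv1[OF S iid(3) that]])
  qed
  \<comment> \<open>The indices form a countable family, so their exceptional null sets can be
    united.\<close>
  then have "AE \<omega> in S. \<forall>p\<in>?IJ. J p \<omega> \<in> {1..m}" by (subst AE_ball_countable) auto
  then have "AE \<omega> in S. area_dist (empirical_df m (pool (\<lambda>i. Q0 i \<omega>) (\<lambda>p. W p \<omega>) (\<lambda>p. J p \<omega>) k)) F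
      = area_dist (empirical_df m (rpool m (?XQ \<omega>) (?XW \<omega>) (?XJ \<omega>) k)) F"
  proof eventually_elim
    case (elim \<omega>)
    then have "pool (\<lambda>i. Q0 i \<omega>) (\<lambda>p. W p \<omega>) (\<lambda>p. J p \<omega>) k i = rpool m (?XQ \<omega>) (?XW \<omega>) (?XJ \<omega>) k i"
      if "i \<in> {1..m}" for i using that by (intro rpool_eq_pool[symmetric]) auto
    then show ?case by (intro arg_cong2[where f=area_dist] empirical_df_cong refl)
  qed
  then have "(\<integral>\<^sup>+\<omega>. area_dist (empirical_df m (pool (\<lambda>i. Q0 i \<omega>) (\<lambda>p. W p \<omega>) (\<lambda>p. J p \<omega>) k)) F \<partial>S)
      = (\<integral>\<^sup>+\<omega>. (\<lambda>(q, w, \<iota>). area_dist (empirical_df m (rpool m q w \<iota> k)) F) (?X \<omega>) \<partial>S)"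
    unfolding prod.case by (rule nn_integral_cong_AE)
  also have "\<dots> = (\<integral>\<^sup>+(q, w, \<iota>). area_dist (empirical_df m (rpool m q w \<iota> k)) F \<partial>distr S C ?X)"
    using nn_integral_rpool_Suc(2)[OF LQ m empirical_area_dist_measurable[OF F], folded U_def, folded C_def]
    by (intro nn_integral_distr[symmetric, OF X]) (simp only: measurable_distr_eq1)
  finally show ?thesis unfolding lawX .
qed

end

subsection \<open>The weighted branching tree\<close>

text \<open>The definition extends words at the youngest letter, whereas the recursion for the laws
  branches at the root. In the reversed representation the oldest letter is the last one, so the
  subtree of the child \<open>r\<close> consists of the words \<open>w @ [r]\<close>.\<close>

lemma generation_Suc_root:
  "generation v (Suc n) = (\<Union>r\<in>{1..Nof (v [])}. (\<lambda>w. w @ [r]) ` generation (\<lambda>w. v (w @ [r])) n)"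
proof (induction n)
  case (Suc n)
  have "generation v (Suc (Suc n)) = {j # w | j w. w \<in> generation v (Suc n) \<and> 1 \<le> j \<and> j \<le> Nof (v w)}"
    by simp
  also have "\<dots> = (\<Union>r\<in>{1..Nof (v [])}. (\<lambda>w. w @ [r]) ` generation (\<lambda>w. v (w @ [r])) (Suc n))"
    unfolding Suc.IH by (auto simp: image_iff)
  finally show ?case .
qed (auto simp: image_iff)

lemma finite_generation: "finite (generation v n)"
proof (induction n)
  case (Suc n)
  have "generation v (Suc n) = (\<Union>w\<in>generation v n. (\<lambda>j. j # w) ` {1..Nof (v w)})" by auto
  then show ?case using Suc by simp
qed simp

lemma weight_snoc: "weight v (w @ [r]) = Cof (v []) r * weight (\<lambda>w. v (w @ [r])) w"
  by (induction w) auto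

text \<open>Decomposition at the first generation: each child carries a shifted copy of the tree,
  weighted by its coefficient, and the generation of the root contributes Q. It is the pathwise form
  of the distributional recursion for the process.\<close>

lemma tree_sum_Suc_root: "tree_sum v (Suc k) = branch (v []) (\<lambda>r. tree_sum (\<lambda>w. v (w @ [r])) k)"
proof -
  have level: "(\<Sum>w\<in>generation v (Suc j). Qof (v w) * weight v w)
      = (\<Sum>r=1..Nof (v []). Cof (v []) r * (\<Sum>w\<in>generation (\<lambda>w. v (w @ [r])) j. Qof (v (w @ [r])) * weight (\<lambda>w. v (w @ [r])) w))" for j
  proof -
    have "(\<Sum>w\<in>generation v (Suc j). Qof (v w) * weight v w)
        = (\<Sum>r=1..Nof (v []). \<Sum>w\<in>(\<lambda>w. w @ [r]) ` generation (\<lambda>w. v (w @ [r])) j. Qof (v w) * weight v w)"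
      unfolding generation_Suc_root by (rule sum.UNION_disjoint) (auto simp: finite_generation)
    also have "\<dots> = (\<Sum>r=1..Nof (v []). \<Sum>w\<in>generation (\<lambda>w. v (w @ [r])) j. Qof (v (w @ [r])) * weight v (w @ [r]))"
      by (rule sum.cong[OF refl]) (subst sum.reindex, auto simp: inj_on_def)
    finally show ?thesis by (simp add: weight_snoc sum_distrib_left mult_ac)
  qed
  show ?thesis
    unfolding tree_sum_def sum.atMost_Suc_shift level
    by (subst sum.swap) (simp add: branch_def sum_distrib_left)
qed

text \<open>The tree visits words with positive letters only, which are the words on which the
  i.i.d. family is specified.\<close>

lemma tree_sum_cong:
  assumes "\<And>w. w \<in> words \<Longrightarrow> v w = v' w"
  shows "tree_sum v k = tree_sum v' k"
  using assms
proof (induction k arbitrary: v v')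
  case 0
  then show ?case by (simp add: tree_sum_def words_def)
next
  case (Suc k)
  have "tree_sum (\<lambda>w. v (w @ [r])) k = tree_sum (\<lambda>w. v' (w @ [r])) k" if "r \<ge> 1" for r
    using that by (intro Suc.IH Suc.prems) (auto simp: words_def)
  moreover have "v [] = v' []" by (rule Suc.prems) (simp add: words_def)
  ultimately show ?case unfolding tree_sum_Suc_root by (auto intro: branch_cong)
qed

context branching_law
begin

text \<open>Every nonempty word is \<open>w @ [r]\<close> for exactly one pair of \<open>r\<close>
  and \<open>w\<close>. The vector at the root is therefore independent of the subtrees, and these
  are independent copies of the whole family.\<close>

lemma distr_root_subtrees:
  defines "P \<equiv> \<Pi>\<^sub>M w\<in>words. L"
  defines "T \<equiv> \<lambda>v :: nat list \<Rightarrow> bvec. (v [], \<lambda>r\<in>{1..}. \<lambda>w\<in>words. v (w @ [r]))"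
  shows "T \<in> measurable P (L \<Otimes>\<^sub>M (\<Pi>\<^sub>M r\<in>{1..}. P))"
    and "distr P (L \<Otimes>\<^sub>M (\<Pi>\<^sub>M r\<in>{1..}. P)) T = L \<Otimes>\<^sub>M (\<Pi>\<^sub>M r\<in>{1..}. P)"
proof -
  let ?PP = "\<Pi>\<^sub>M r\<in>{1::nat..}. P"
  let ?R = "\<Pi>\<^sub>M w\<in>{[] :: nat list}. L" and ?B = "words - {[]}"
  let ?g = "\<lambda>v :: nat list \<Rightarrow> bvec. \<lambda>r\<in>{1..}. \<lambda>w\<in>words. v (w @ [r])"
  have nil: "[] \<in> words" by (simp add: words_def)
  then have ne: "words \<noteq> {}" by blast
  have P: "prob_space P" unfolding P_def using prob_L by (intro prob_space_PiM)
  interpret R: prob_space ?R using prob_L by (intro prob_space_PiM)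
  interpret PP: prob_space ?PP using P by (intro prob_space_PiM)
  have g: "?g \<in> measurable (\<Pi>\<^sub>M w\<in>B. L) ?PP" if "?B \<subseteq> B" for B
    unfolding P_def using that
    by (intro measurable_restrict measurable_component_singleton that[THEN subsetD]) (auto simp: words_def)
  show T: "T \<in> measurable P (L \<Otimes>\<^sub>M ?PP)"
    unfolding T_def using g[of words] nil
    by (intro measurable_Pair) (auto simp: P_def intro!: measurable_component_singleton)
  have "distr P (?R \<Otimes>\<^sub>M ?PP) (\<lambda>v. (restrict v {[]}, ?g (restrict v ?B))) = ?R \<Otimes>\<^sub>M distr (\<Pi>\<^sub>M w\<in>?B. L) ?PP ?g"
    unfolding P_def by (rule distr_PiM_split_map[OF ne prob_L _ _ _ g[unfolded P_def]]) (use nil in auto)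
  also have "distr (\<Pi>\<^sub>M w\<in>?B. L) ?PP ?g = ?PP"
    unfolding P_def
    by (rule distr_PiM_group[OF prob_L _ ne, where h="\<lambda>r w. w @ [r]"]) (use nil in \<open>auto simp: inj_on_def words_def\<close>)
  also have "(\<lambda>v. (restrict v {[]}, ?g (restrict v ?B))) = (\<lambda>v. (restrict v {[]}, ?g v))"
    by (auto simp: fun_eq_iff words_def)
  finally have law: "distr P (?R \<Otimes>\<^sub>M ?PP) (\<lambda>v. (restrict v {[]}, ?g v)) = ?R \<Otimes>\<^sub>M ?PP" .
  have m: "(\<lambda>v. (restrict v {[]}, ?g v)) \<in> measurable P (?R \<Otimes>\<^sub>M ?PP)"
    unfolding P_def using nil by (intro measurable_Pair measurable_restrict_subset g[of words, unfolded P_def]) auto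
  have root: "(\<lambda>v. v []) \<in> measurable ?R L" by simp
  have root_law: "distr ?R L (\<lambda>v. v []) = L" by (rule distr_PiM_component) (simp_all add: prob_L)
  have "L \<Otimes>\<^sub>M ?PP = distr ?R L (\<lambda>v. v []) \<Otimes>\<^sub>M distr ?PP ?PP (\<lambda>y. y)"
    unfolding root_law distr_id ..
  also have "\<dots> = distr (?R \<Otimes>\<^sub>M ?PP) (L \<Otimes>\<^sub>M ?PP) (\<lambda>(x, y). (x [], y))"
    unfolding distr_id using PP.sigma_finite_measure_axioms
    by (subst distr_id[symmetric, of ?PP], intro pair_measure_distr root) (auto simp: distr_id)
  also have "\<dots> = distr P (L \<Otimes>\<^sub>M ?PP) (\<lambda>v. (\<lambda>(x, y). (x [], y)) (restrict v {[]}, ?g v))"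
    using root by (subst law[symmetric], subst distr_distr[OF _ m]) (auto simp: comp_def split_beta)
  finally show "distr P (L \<Otimes>\<^sub>M ?PP) T = L \<Otimes>\<^sub>M ?PP" by (simp add: T_def)
qed

text \<open>Both assertions are proved in one induction, since the smoothing step for the law needs
  measurability at the previous depth.\<close>

lemma tree_sum_law:
  "(\<lambda>v. tree_sum v k) \<in> borel_measurable (\<Pi>\<^sub>M w\<in>words. L) \<and>
    distr (\<Pi>\<^sub>M w\<in>words. L) borel (\<lambda>v. tree_sum v k) = (smooth L ^^ k) (distr L borel Qof)"
proof (induction k)
  case 0
  have nil: "[] \<in> words" by (simp add: words_def)
  then have c: "(\<lambda>v. v []) \<in> measurable (\<Pi>\<^sub>M w\<in>words. L) L" by simp
  have "distr L borel Qof = distr (distr (\<Pi>\<^sub>M w\<in>words. L) L (\<lambda>v. v [])) borel Qof"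
    using distr_PiM_component[of words "\<lambda>_. L" "[]"] nil prob_L by simp
  also have "\<dots> = distr (\<Pi>\<^sub>M w\<in>words. L) borel (\<lambda>v. Qof (v []))"
    by (subst distr_distr[OF Qof_measurable_L c]) (simp add: comp_def)
  finally show ?case
    using measurable_compose[OF c Qof_measurable_L] by (simp add: tree_sum_def)
next
  case (Suc k)
  let ?P = "\<Pi>\<^sub>M w\<in>words. L" and ?T = "\<lambda>v. (v [], \<lambda>r\<in>{1..}. \<lambda>w\<in>words. v (w @ [r]))"
  have P: "prob_space ?P" using prob_L by (intro prob_space_PiM)
  have m: "(\<lambda>v. tree_sum v k) \<in> borel_measurable ?P" using Suc.IH by simp
  have eq: "tree_sum v (Suc k) = (\<lambda>(v, p). branch v (\<lambda>r. tree_sum (p r) k)) (?T v)" for v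
  proof -
    have "tree_sum (\<lambda>w. v (w @ [r])) k = tree_sum (\<lambda>w\<in>words. v (w @ [r])) k" for r
      by (rule tree_sum_cong) simp
    then show ?thesis by (auto simp: tree_sum_Suc_root intro!: branch_cong)
  qed
  have "distr ?P borel (\<lambda>v. tree_sum v (Suc k))
      = distr (distr ?P (L \<Otimes>\<^sub>M (\<Pi>\<^sub>M r\<in>{1..}. ?P)) ?T) borel (\<lambda>(v, p). branch v (\<lambda>r. tree_sum (p r) k))"
    unfolding eq distr_distr[OF branch_pair_measurable[OF m] distr_root_subtrees(1)] by (simp add: comp_def)
  also have "\<dots> = smooth L (distr ?P borel (\<lambda>v. tree_sum v k))"
    unfolding distr_root_subtrees(2) smooth_distr[OF P m] ..
  finally show ?case
    using Suc.IH measurable_compose[OF distr_root_subtrees(1) branch_pair_measurable[OF m]]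
    by (simp add: eq)
qed

lemma R_df_eq_cdf:
  assumes T: "prob_space T" and V: "iid_family T L V words"
  shows "R_df T V k = cdf ((smooth L ^^ k) (distr L borel Qof))"
proof
  fix x
  let ?P = "\<Pi>\<^sub>M w\<in>words. L" and ?V = "\<lambda>\<omega>. \<lambda>w\<in>words. V w \<omega>"
  have "[] \<in> words" by (simp add: words_def)
  then have ne: "words \<noteq> {}" by blast
  have m: "(\<lambda>v. tree_sum v k) \<in> borel_measurable ?P" using tree_sum_law by simp
  have Vm: "?V \<in> measurable T ?P" by (rule iid_family_measurable_PiM[OF T V ne])
  have "distr T borel (\<lambda>\<omega>. tree_sum (?V \<omega>) k) = distr (distr T ?P ?V) borel (\<lambda>v. tree_sum v k)"
    by (subst distr_distr[OF m Vm]) (simp add: comp_def)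
  also have "\<dots> = (smooth L ^^ k) (distr L borel Qof)"
    unfolding iid_family_distr_PiM[OF T V ne] using tree_sum_law by simp
  finally have "cdf ((smooth L ^^ k) (distr L borel Qof)) x = measure (distr T borel (\<lambda>\<omega>. tree_sum (?V \<omega>) k)) {..x}"
    by (simp add: cdf_def)
  also have "\<dots> = measure T {\<omega> \<in> space T. tree_sum (?V \<omega>) k \<le> x}"
    using measurable_compose[OF Vm m] by (subst measure_distr) (auto intro!: arg_cong2[where f=measure])
  also have "(\<lambda>\<omega>. tree_sum (?V \<omega>) k) = (\<lambda>\<omega>. tree_sum (\<lambda>w. V w \<omega>) k)"
    by (intro ext tree_sum_cong) simp
  finally show "R_df T V k x = cdf ((smooth L ^^ k) (distr L borel Qof)) x"
    by (simp add: R_df_def fun_eq_iff)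
qed

end

section \<open>From the random vector to its law\<close>

lemma bvec_measurable:
  assumes "Q \<in> borel_measurable M" "N \<in> measurable M (count_space UNIV)" "\<And>r. r \<ge> 1 \<Longrightarrow> C r \<in> borel_measurable M"
  shows "(\<lambda>\<omega>. (Q \<omega>, N \<omega>, \<lambda>r\<in>{1..}. C r \<omega>)) \<in> measurable M bvec_space"
  unfolding bvec_space_def using assms by (intro measurable_Pair measurable_restrict) auto

lemma branching_law_bvec_law:
  assumes "prob_space M" "Q \<in> borel_measurable M" "N \<in> measurable M (count_space UNIV)" "\<And>r. r \<ge> 1 \<Longrightarrow> C r \<in> borel_measurable M"
  shows "branching_law (bvec_law M Q N C)"
  unfolding bvec_law_def
  by (intro branching_law.intro prob_space.prob_space_distr[OF assms(1)] bvec_measurable assms) simp_all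

lemma
  assumes M: "Q \<in> borel_measurable M" "N \<in> measurable M (count_space UNIV)" "\<And>r. r \<ge> 1 \<Longrightarrow> C r \<in> borel_measurable M"
  shows distr_Qof_bvec_law: "distr (bvec_law M Q N C) borel Qof = distr M borel Q"
    and nn_integral_bvec_law: "f \<in> borel_measurable bvec_space \<Longrightarrow>
      (\<integral>\<^sup>+v. f v \<partial>bvec_law M Q N C) = (\<integral>\<^sup>+\<omega>. f (Q \<omega>, N \<omega>, \<lambda>r\<in>{1..}. C r \<omega>) \<partial>M)"
  using bvec_measurable[OF M] unfolding bvec_law_def
  by (simp_all add: distr_distr comp_def nn_integral_distr)

lemma lrho_bvec_law:
  assumes M: "Q \<in> borel_measurable M" "N \<in> measurable M (count_space UNIV)" "\<And>r. r \<ge> 1 \<Longrightarrow> C r \<in> borel_measurable M"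
  shows "lrho (bvec_law M Q N C) \<gamma> = rho M N C \<gamma>"
proof -
  have "(\<lambda>v. \<Sum>i=1..Nof v. \<bar>Cof v i\<bar> powr \<gamma>) \<in> borel_measurable bvec_space"
  proof (rule random_sum_measurable)
    fix r :: nat assume "r \<ge> 1"
    then have [measurable]: "(\<lambda>v. Cof v r) \<in> borel_measurable bvec_space" by (rule Cof_component_measurable)
    show "(\<lambda>v. \<bar>Cof v r\<bar> powr \<gamma>) \<in> borel_measurable bvec_space" by measurable
  qed simp
  then show ?thesis
    unfolding lrho_def rho_def by (subst nn_integral_bvec_law[OF M]) auto
qed

subsection \<open>Moments of the smoothing transform\<close>

lemma mult_powr_minus_one: "0 \<le> y \<Longrightarrow> y * y powr (p - 1) = y powr p" for y p :: real
  by (cases "y = 0") (auto simp: powr_mult_base)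

text \<open>Write (u+v)^p as u (u+v)^(p-1) + v (u+v)^(p-1); as p-1 is not positive, shrinking the
  base to \<open>u\<close> or \<open>v\<close> only increases the terms.\<close>

lemma powr_subadditive:
  fixes u v p :: real
  assumes "0 \<le> u" "0 \<le> v" "0 \<le> p" "p \<le> 1"
  shows "(u + v) powr p \<le> u powr p + v powr p"
proof -
  have *: "x * (u + v) powr (p - 1) \<le> x powr p" if "0 \<le> x" "x \<le> u + v" for x
  proof (cases "x = 0")
    case False
    then have "(u + v) powr (p - 1) \<le> x powr (p - 1)" using that assms by (intro powr_mono2') auto
    then have "x * (u + v) powr (p - 1) \<le> x * x powr (p - 1)" using that by (intro mult_left_mono)
    also have "\<dots> = x powr p" using that False by (simp add: powr_mult_base)
    finally show ?thesis .
  qed simp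
  have "(u + v) powr p = u * (u + v) powr (p - 1) + v * (u + v) powr (p - 1)"
    using assms by (cases "u + v = 0") (auto simp: powr_mult_base simp flip: distrib_right)
  with *[of u] *[of v] assms show ?thesis by simp
qed

text \<open>Convexity of the power at the points \<open>s / \<theta>\<close> and
  \<open>t / (1 - \<theta>)\<close>. The free weight matters: with \<theta> near 1 the factor of the
  first term is as close to 1 as desired, at the expense of the second.\<close>

lemma powr_add_le_weighted:
  fixes s t \<theta> \<alpha> :: real
  assumes "0 \<le> s" "0 \<le> t" "0 < \<theta>" "\<theta> < 1" "1 \<le> \<alpha>"
  shows "(s + t) powr \<alpha> \<le> \<theta> powr (1 - \<alpha>) * s powr \<alpha> + (1 - \<theta>) powr (1 - \<alpha>) * t powr \<alpha>"
proof (cases "s = 0 \<or> t = 0")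
  case True
  have "x powr \<alpha> \<le> \<theta> powr (1 - \<alpha>) * x powr \<alpha>" if "0 < \<theta>" "\<theta> < 1" for x \<theta> :: real
    using powr_mono2'[of "1 - \<alpha>" \<theta> 1] mult_right_mono[of 1 "\<theta> powr (1 - \<alpha>)" "x powr \<alpha>"] that assms by simp
  from this[of \<theta> s] this[of "1 - \<theta>" t] True assms show ?thesis by auto
next
  case False
  have "(\<theta> * (s / \<theta>) + (1 - \<theta>) * (t / (1 - \<theta>))) powr \<alpha> \<le> \<theta> * (s / \<theta>) powr \<alpha> + (1 - \<theta>) * (t / (1 - \<theta>)) powr \<alpha>"
    using convex_onD[OF powr_convex[OF \<open>1 \<le> \<alpha>\<close>], of "1 - \<theta>" "s / \<theta>" "t / (1 - \<theta>)"] assms False by simp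
  moreover have "\<theta> * (s / \<theta>) powr \<alpha> = \<theta> powr (1 - \<alpha>) * s powr \<alpha>" if "0 < \<theta>" "0 \<le> s" for \<theta> s :: real
    using that by (simp add: powr_divide powr_diff)
  ultimately show ?thesis using assms by simp
qed

text \<open>
  All products on the right-hand side involve only pairwise different indices, so for independent
  \<open>x r\<close> its expectation uses first and \<open>\<alpha>\<close>-th moments only, and the \<open>\<alpha>\<close>-th moment enters with
  the coefficient \<open>\<Sum>r\<in>J. a r powr \<alpha>\<close> without a further constant.
\<close>

lemma sum_powr_expand:
  fixes a x :: "'i \<Rightarrow> real" and \<alpha> :: real
  assumes J: "finite J" and a: "\<And>r. r \<in> J \<Longrightarrow> 0 \<le> a r" and x: "\<And>r. r \<in> J \<Longrightarrow> 0 \<le> x r" and \<alpha>: "1 < \<alpha>" "\<alpha> < 2"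
  defines "\<sigma> \<equiv> \<Sum>r\<in>J. a r"
  shows "(\<Sum>r\<in>J. a r * x r) powr \<alpha> \<le> (\<Sum>r\<in>J. a r powr \<alpha> * x r powr \<alpha>)
    + \<sigma> powr (\<alpha> - 1) * (\<Sum>r\<in>J. a r * x r)
    + \<sigma> powr (\<alpha> - 2) * (\<Sum>r\<in>J. \<Sum>q\<in>J - {r}. a r * a q * (x r * x q))"
proof (cases "\<sigma> = 0")
  case True
  then have "a r = 0" if "r \<in> J" for r using that a J by (simp add: \<sigma>_def sum_nonneg_eq_0_iff)
  then show ?thesis by simp
next
  case False
  then have \<sigma>: "0 < \<sigma>" using a by (simp add: \<sigma>_def sum_nonneg less_le)
  define s where "s = (\<Sum>r\<in>J. a r * x r)"
  have s0: "0 \<le> s" unfolding s_def using a x by (intro sum_nonneg mult_nonneg_nonneg)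
  have "s powr \<alpha> = s * s powr (\<alpha> - 1)"
    using s0 by (simp add: mult_powr_minus_one)
  also have "\<dots> = (\<Sum>r\<in>J. a r * x r * s powr (\<alpha> - 1))" by (simp add: s_def sum_distrib_right)
  also have "\<dots> \<le> (\<Sum>r\<in>J. a r powr \<alpha> * x r powr \<alpha> + \<sigma> powr (\<alpha> - 1) * (a r * x r)
      + \<sigma> powr (\<alpha> - 2) * (\<Sum>q\<in>J - {r}. a r * a q * (x r * x q)))"
  proof (intro sum_mono)
    fix r assume r: "r \<in> J"
    define t where "t = (\<Sum>q\<in>J - {r}. a q * x q)"
    have t0: "0 \<le> t" unfolding t_def using a x by (intro sum_nonneg mult_nonneg_nonneg) auto
    have u0: "0 \<le> a r * x r" using a x r by simp
    \<comment> \<open>The own term of \<open>r\<close> is separated from \<open>t\<close>, which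
      involves the other indices only. Subadditivity applies as the exponent is below 1, and the own
      term then gives the pure \<alpha>-th power with coefficient 1.\<close>
    have "s powr (\<alpha> - 1) = (a r * x r + t) powr (\<alpha> - 1)"
      unfolding s_def t_def using J r by (simp add: sum.remove)
    also have "\<dots> \<le> (a r * x r) powr (\<alpha> - 1) + t powr (\<alpha> - 1)"
      using u0 t0 \<alpha> by (intro powr_subadditive) auto
    \<comment> \<open>An affine bound in \<open>t\<close> leaves only products of first moments to
      be computed. With \<sigma> as threshold every remainder becomes homogeneous of degree \<alpha>
      in the coefficients, hence integrable by the assumption on their sum.\<close>
    also have "t powr (\<alpha> - 1) \<le> \<sigma> powr (\<alpha> - 1) + \<sigma> powr (\<alpha> - 2) * t"
    proof (cases "t \<le> \<sigma>")
      case True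
      then have "t powr (\<alpha> - 1) \<le> \<sigma> powr (\<alpha> - 1)" using t0 \<alpha> by (intro powr_mono2) auto
      moreover have "0 \<le> \<sigma> powr (\<alpha> - 2) * t" using t0 by simp
      ultimately show ?thesis by linarith
    next
      case False
      then have "t powr (\<alpha> - 2) \<le> \<sigma> powr (\<alpha> - 2)" using \<sigma> \<alpha> by (intro powr_mono2') auto
      then have "t * t powr (\<alpha> - 2) \<le> \<sigma> powr (\<alpha> - 2) * t" unfolding mult.commute[of _ t] using t0 by (rule mult_left_mono)
      moreover have "t * t powr (\<alpha> - 2) = t powr (\<alpha> - 1)" using False \<sigma> by (simp add: powr_mult_base)
      ultimately show ?thesis by (simp add: add_increasing)
    qed
    finally have "a r * x r * s powr (\<alpha> - 1)
        \<le> a r * x r * ((a r * x r) powr (\<alpha> - 1) + (\<sigma> powr (\<alpha> - 1) + \<sigma> powr (\<alpha> - 2) * t))"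
      using u0 by (intro mult_left_mono) auto
    also have "\<dots> = a r * x r * (a r * x r) powr (\<alpha> - 1) + \<sigma> powr (\<alpha> - 1) * (a r * x r)
        + \<sigma> powr (\<alpha> - 2) * (\<Sum>q\<in>J - {r}. a r * a q * (x r * x q))"
      by (simp add: t_def algebra_simps sum_distrib_left)
    also have "a r * x r * (a r * x r) powr (\<alpha> - 1) = a r powr \<alpha> * x r powr \<alpha>"
      unfolding mult_powr_minus_one[OF u0] using a[OF r] x[OF r] by (simp add: powr_mult)
    finally show "a r * x r * s powr (\<alpha> - 1) \<le> a r powr \<alpha> * x r powr \<alpha> + \<sigma> powr (\<alpha> - 1) * (a r * x r)
      + \<sigma> powr (\<alpha> - 2) * (\<Sum>q\<in>J - {r}. a r * a q * (x r * x q))" .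
  qed
  also have "\<dots> = (\<Sum>r\<in>J. a r powr \<alpha> * x r powr \<alpha>) + \<sigma> powr (\<alpha> - 1) * s
      + \<sigma> powr (\<alpha> - 2) * (\<Sum>r\<in>J. \<Sum>q\<in>J - {r}. a r * a q * (x r * x q))"
    by (simp add: sum.distrib sum_distrib_left s_def)
  finally show ?thesis unfolding s_def .
qed

text \<open>Expectation of \<open>sum_powr_expand\<close>: products over different indices factorize
  and are bounded by \<open>A\<close> squared, the linear term by \<open>A\<close>, and both
  prefactors combine to the \<alpha>-th power of the sum of the coefficients.\<close>

lemma nn_integral_sum_powr_PiM:
  fixes a :: "'i \<Rightarrow> real" and \<alpha> A :: real
  assumes \<mu>: "prob_space \<mu>" and sets_\<mu>: "sets \<mu> = sets borel" and J: "finite J" "J \<subseteq> I"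
    and a: "\<And>r. r \<in> J \<Longrightarrow> 0 \<le> a r" and \<alpha>: "1 < \<alpha>" "\<alpha> < 2"
    and A: "0 \<le> A" "(\<integral>\<^sup>+x. ennreal \<bar>x\<bar> \<partial>\<mu>) \<le> ennreal A"
  shows "(\<integral>\<^sup>+\<omega>. ennreal ((\<Sum>r\<in>J. a r * \<bar>\<omega> r\<bar>) powr \<alpha>) \<partial>(\<Pi>\<^sub>M r\<in>I. \<mu>))
    \<le> ennreal (\<Sum>r\<in>J. a r powr \<alpha>) * (\<integral>\<^sup>+x. ennreal (\<bar>x\<bar> powr \<alpha>) \<partial>\<mu>) + ennreal ((\<Sum>r\<in>J. a r) powr \<alpha> * (A + A\<^sup>2))"
proof -
  let ?P = "\<Pi>\<^sub>M r\<in>I. \<mu>" and ?\<sigma> = "\<Sum>r\<in>J. a r"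
  let ?x = "\<lambda>\<omega> r. ennreal \<bar>\<omega> r\<bar>"
  have idm: "(\<lambda>x. x) \<in> borel_measurable \<mu>" by (rule measurable_ident_sets[OF sets_\<mu>])
  have absm: "(\<lambda>x. ennreal \<bar>x\<bar>) \<in> borel_measurable \<mu>" and powm: "(\<lambda>x. ennreal (\<bar>x\<bar> powr \<alpha>)) \<in> borel_measurable \<mu>"
    using idm by measurable
  have pm[measurable]: "(\<lambda>\<omega>. \<omega> r) \<in> borel_measurable ?P" if "r \<in> J" for r
    using measurable_compose[OF measurable_component_singleton[of r I "\<lambda>_. \<mu>"] idm] that J by auto
  have \<sigma>0: "0 \<le> ?\<sigma>" using a by (rule sum_nonneg)
  have "(\<integral>\<^sup>+\<omega>. ennreal ((\<Sum>r\<in>J. a r * \<bar>\<omega> r\<bar>) powr \<alpha>) \<partial>?P)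
      \<le> (\<integral>\<^sup>+\<omega>. (\<Sum>r\<in>J. ennreal (a r powr \<alpha>) * ennreal (\<bar>\<omega> r\<bar> powr \<alpha>))
        + ennreal (?\<sigma> powr (\<alpha> - 1)) * (\<Sum>r\<in>J. ennreal (a r) * ?x \<omega> r)
        + ennreal (?\<sigma> powr (\<alpha> - 2)) * (\<Sum>r\<in>J. \<Sum>q\<in>J - {r}. ennreal (a r * a q) * (?x \<omega> r * ?x \<omega> q)) \<partial>?P)"
  proof (intro nn_integral_mono)
    fix \<omega> :: "'i \<Rightarrow> real"
    let ?S1 = "\<Sum>r\<in>J. a r powr \<alpha> * \<bar>\<omega> r\<bar> powr \<alpha>" and ?S2 = "\<Sum>r\<in>J. a r * \<bar>\<omega> r\<bar>"
    let ?S3 = "\<Sum>r\<in>J. \<Sum>q\<in>J - {r}. a r * a q * (\<bar>\<omega> r\<bar> * \<bar>\<omega> q\<bar>)"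
    have nn: "0 \<le> ?S1" "0 \<le> ?S2" "0 \<le> ?S3" using a by (auto intro!: sum_nonneg mult_nonneg_nonneg)
    have e1: "ennreal ?S1 = (\<Sum>r\<in>J. ennreal (a r powr \<alpha>) * ennreal (\<bar>\<omega> r\<bar> powr \<alpha>))"
      by (subst sum_ennreal[symmetric]) (auto simp: ennreal_mult)
    have e2: "ennreal ?S2 = (\<Sum>r\<in>J. ennreal (a r) * ?x \<omega> r)"
      using a by (subst sum_ennreal[symmetric]) (auto simp: ennreal_mult intro!: sum.cong)
    have e3: "ennreal ?S3 = (\<Sum>r\<in>J. \<Sum>q\<in>J - {r}. ennreal (a r * a q) * (?x \<omega> r * ?x \<omega> q))"
    proof -
      have "ennreal ?S3 = (\<Sum>r\<in>J. ennreal (\<Sum>q\<in>J - {r}. a r * a q * (\<bar>\<omega> r\<bar> * \<bar>\<omega> q\<bar>)))"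
        using a by (intro sum_ennreal[symmetric] sum_nonneg mult_nonneg_nonneg) auto
      also have "\<dots> = (\<Sum>r\<in>J. \<Sum>q\<in>J - {r}. ennreal (a r * a q * (\<bar>\<omega> r\<bar> * \<bar>\<omega> q\<bar>)))"
        using a by (intro sum.cong[OF refl] sum_ennreal[symmetric] mult_nonneg_nonneg) auto
      also have "\<dots> = (\<Sum>r\<in>J. \<Sum>q\<in>J - {r}. ennreal (a r * a q) * (?x \<omega> r * ?x \<omega> q))"
        using a by (intro sum.cong[OF refl]) (simp add: ennreal_mult)
      finally show ?thesis .
    qed
    have "ennreal ((\<Sum>r\<in>J. a r * \<bar>\<omega> r\<bar>) powr \<alpha>) \<le> ennreal (?S1 + ?\<sigma> powr (\<alpha> - 1) * ?S2 + ?\<sigma> powr (\<alpha> - 2) * ?S3)"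
      by (intro ennreal_leI sum_powr_expand J a \<alpha>) auto
    also have "\<dots> = ennreal ?S1 + ennreal (?\<sigma> powr (\<alpha> - 1)) * ennreal ?S2 + ennreal (?\<sigma> powr (\<alpha> - 2)) * ennreal ?S3"
      using nn by (simp add: ennreal_mult)
    finally show "ennreal ((\<Sum>r\<in>J. a r * \<bar>\<omega> r\<bar>) powr \<alpha>) \<le> (\<Sum>r\<in>J. ennreal (a r powr \<alpha>) * ennreal (\<bar>\<omega> r\<bar> powr \<alpha>))
        + ennreal (?\<sigma> powr (\<alpha> - 1)) * (\<Sum>r\<in>J. ennreal (a r) * ?x \<omega> r)
        + ennreal (?\<sigma> powr (\<alpha> - 2)) * (\<Sum>r\<in>J. \<Sum>q\<in>J - {r}. ennreal (a r * a q) * (?x \<omega> r * ?x \<omega> q))"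
      unfolding e1 e2 e3 .
  qed
  also have "\<dots> = (\<Sum>r\<in>J. ennreal (a r powr \<alpha>) * (\<integral>\<^sup>+\<omega>. ennreal (\<bar>\<omega> r\<bar> powr \<alpha>) \<partial>?P))
      + ennreal (?\<sigma> powr (\<alpha> - 1)) * (\<Sum>r\<in>J. ennreal (a r) * (\<integral>\<^sup>+\<omega>. ?x \<omega> r \<partial>?P))
      + ennreal (?\<sigma> powr (\<alpha> - 2)) * (\<Sum>r\<in>J. \<Sum>q\<in>J - {r}. ennreal (a r * a q) * (\<integral>\<^sup>+\<omega>. ?x \<omega> r * ?x \<omega> q \<partial>?P))"
  proof -
    have "(\<integral>\<^sup>+\<omega>. (\<Sum>q\<in>J - {r}. ennreal (a r * a q) * (?x \<omega> r * ?x \<omega> q)) \<partial>?P)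
        = (\<Sum>q\<in>J - {r}. ennreal (a r * a q) * (\<integral>\<^sup>+\<omega>. ?x \<omega> r * ?x \<omega> q \<partial>?P))" if "r \<in> J" for r
      using that by (subst nn_integral_sum) (auto simp: nn_integral_cmult)
    then show ?thesis
      by (simp add: nn_integral_add nn_integral_sum nn_integral_cmult cong: sum.cong)
  qed
  \<comment> \<open>Once the expectations have been replaced by \<open>A\<close>, the diagonal is
    added to the double sum to complete it to the square of the sum of the coefficients.\<close>
  also have "\<dots> \<le> (\<Sum>r\<in>J. ennreal (a r powr \<alpha>) * (\<integral>\<^sup>+x. ennreal (\<bar>x\<bar> powr \<alpha>) \<partial>\<mu>))
      + ennreal (?\<sigma> powr (\<alpha> - 1)) * (\<Sum>r\<in>J. ennreal (a r) * ennreal A)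
      + ennreal (?\<sigma> powr (\<alpha> - 2)) * (\<Sum>r\<in>J. \<Sum>q\<in>J. ennreal (a r * a q) * (ennreal A * ennreal A))"
  proof (intro add_mono mult_left_mono sum_mono)
    fix r assume r: "r \<in> J"
    then have rI: "r \<in> I" using J by auto
    show "(\<integral>\<^sup>+\<omega>. ennreal (\<bar>\<omega> r\<bar> powr \<alpha>) \<partial>?P) \<le> (\<integral>\<^sup>+x. ennreal (\<bar>x\<bar> powr \<alpha>) \<partial>\<mu>)"
      using nn_integral_PiM_component[OF \<mu> rI powm] by simp
    show "(\<integral>\<^sup>+\<omega>. ?x \<omega> r \<partial>?P) \<le> ennreal A"
      using nn_integral_PiM_component[OF \<mu> rI absm] A by simp
    have "(\<Sum>q\<in>J - {r}. ennreal (a r * a q) * (\<integral>\<^sup>+\<omega>. ?x \<omega> r * ?x \<omega> q \<partial>?P))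
        \<le> (\<Sum>q\<in>J - {r}. ennreal (a r * a q) * (ennreal A * ennreal A))"
    proof (intro sum_mono mult_left_mono)
      fix q assume "q \<in> J - {r}"
      then have "q \<in> I" "r \<noteq> q" using J by auto
      then show "(\<integral>\<^sup>+\<omega>. ?x \<omega> r * ?x \<omega> q \<partial>?P) \<le> ennreal A * ennreal A"
        using nn_integral_PiM_pair[OF \<mu> rI _ _ absm] A by (simp add: mult_mono)
    qed simp
    also have "\<dots> \<le> (\<Sum>q\<in>J. ennreal (a r * a q) * (ennreal A * ennreal A))"
      using J by (intro sum_mono2) auto
    finally show "(\<Sum>q\<in>J - {r}. ennreal (a r * a q) * (\<integral>\<^sup>+\<omega>. ?x \<omega> r * ?x \<omega> q \<partial>?P))
      \<le> (\<Sum>q\<in>J. ennreal (a r * a q) * (ennreal A * ennreal A))" .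
  qed auto
  also have "\<dots> = ennreal (\<Sum>r\<in>J. a r powr \<alpha>) * (\<integral>\<^sup>+x. ennreal (\<bar>x\<bar> powr \<alpha>) \<partial>\<mu>) + ennreal (?\<sigma> powr \<alpha> * (A + A\<^sup>2))"
  proof -
    have 1: "(\<Sum>r\<in>J. ennreal (a r powr \<alpha>) * (\<integral>\<^sup>+x. ennreal (\<bar>x\<bar> powr \<alpha>) \<partial>\<mu>))
        = ennreal (\<Sum>r\<in>J. a r powr \<alpha>) * (\<integral>\<^sup>+x. ennreal (\<bar>x\<bar> powr \<alpha>) \<partial>\<mu>)"
      by (simp flip: sum_distrib_right)
    have 2: "(\<Sum>r\<in>J. ennreal (a r) * ennreal A) = ennreal (?\<sigma> * A)"
      using a \<sigma>0 A by (simp add: ennreal_mult flip: sum_distrib_right)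
    have 3: "(\<Sum>r\<in>J. \<Sum>q\<in>J. ennreal (a r * a q) * (ennreal A * ennreal A)) = ennreal (?\<sigma> * ?\<sigma> * A\<^sup>2)"
    proof -
      have "(\<Sum>r\<in>J. \<Sum>q\<in>J. ennreal (a r * a q) * (ennreal A * ennreal A)) = (\<Sum>r\<in>J. \<Sum>q\<in>J. ennreal (a r * a q * A\<^sup>2))"
        using a A by (intro sum.cong refl) (simp add: ennreal_mult power2_eq_square)
      also have "\<dots> = ennreal (\<Sum>r\<in>J. \<Sum>q\<in>J. a r * a q * A\<^sup>2)"
      proof -
        have "(\<Sum>q\<in>J. ennreal (a r * a q * A\<^sup>2)) = ennreal (\<Sum>q\<in>J. a r * a q * A\<^sup>2)" if "r \<in> J" for r
          using a A that by (intro sum_ennreal) simp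
        moreover have "(\<Sum>r\<in>J. ennreal (\<Sum>q\<in>J. a r * a q * A\<^sup>2)) = ennreal (\<Sum>r\<in>J. \<Sum>q\<in>J. a r * a q * A\<^sup>2)"
          using a A by (intro sum_ennreal sum_nonneg) simp
        ultimately show ?thesis by (simp cong: sum.cong del: sum_ennreal)
      qed
      also have "(\<Sum>r\<in>J. \<Sum>q\<in>J. a r * a q * A\<^sup>2) = ?\<sigma> * ?\<sigma> * A\<^sup>2"
        unfolding sum_product by (simp add: sum_distrib_right)
      finally show ?thesis .
    qed
    have 4: "?\<sigma> powr (\<alpha> - 1) * (?\<sigma> * A) + ?\<sigma> powr (\<alpha> - 2) * (?\<sigma> * ?\<sigma> * A\<^sup>2) = ?\<sigma> powr \<alpha> * (A + A\<^sup>2)"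
    proof (cases "?\<sigma> = 0")
      case False
      then have "?\<sigma> powr (\<alpha> - 1) * ?\<sigma> = ?\<sigma> powr \<alpha>" "?\<sigma> powr (\<alpha> - 2) * (?\<sigma> * ?\<sigma>) = ?\<sigma> powr \<alpha>"
        using \<sigma>0 by (simp_all add: powr_diff powr_numeral power2_eq_square)
      then show ?thesis by (simp add: distrib_left flip: mult.assoc)
    qed simp
    show ?thesis
      unfolding 1 2 3 4[symmetric] using \<sigma>0 A by (simp add: ennreal_mult add.assoc)
  qed
  finally show ?thesis .
qed

lemma affine_recursion_bounded:
  fixes u :: "nat \<Rightarrow> ennreal" and r c :: ennreal
  assumes "u 0 < \<infinity>" "r < 1" "c < \<infinity>" and step: "\<And>k. u (Suc k) \<le> r * u k + c"
  obtains H :: real where "0 \<le> H" "\<And>k. u k \<le> ennreal H"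
proof -
  obtain u0 where u0: "u 0 = ennreal u0" "0 \<le> u0" using assms(1) by (cases "u 0") auto
  obtain r' where r': "r = ennreal r'" "0 \<le> r'" "r' < 1" using assms(2) by (cases r) auto
  obtain c' where c': "c = ennreal c'" "0 \<le> c'" using assms(3) by (cases c) auto
  \<comment> \<open>The quotient is the fixed point of x -> r' x + c'; this map sends any value
    above its fixed point to at most that value, so the bound \<open>H\<close> is inherited along
    the recursion.\<close>
  define H where "H = max u0 (c' / (1 - r'))"
  have H0: "0 \<le> H" using u0 by (simp add: H_def)
  have "c' \<le> H * (1 - r')" using r' by (simp add: H_def flip: pos_divide_le_eq)
  then have H: "r' * H + c' \<le> H" by (simp add: algebra_simps)
  have "u k \<le> ennreal H" for k
  proof (induction k)
    case 0
    show ?case by (simp add: u0 H_def ennreal_leI)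
  next
    case (Suc k)
    have "u (Suc k) \<le> r * ennreal H + c"
      using step[of k] Suc.IH by (meson add_right_mono mult_left_mono order.trans zero_le)
    also have "\<dots> = ennreal (r' * H + c')" using r' c' H0 by (simp add: ennreal_mult)
    also have "\<dots> \<le> ennreal H" by (rule ennreal_leI[OF H])
    finally show ?case .
  qed
  with H0 show thesis by (rule that)
qed

context branching_law
begin

lemma nn_integral_smooth:
  assumes \<nu>: "prob_space \<nu>" "sets \<nu> = sets borel" and f: "f \<in> borel_measurable borel"
  shows "(\<integral>\<^sup>+x. f x \<partial>smooth L \<nu>) = (\<integral>\<^sup>+v. \<integral>\<^sup>+\<omega>. f (branch v \<omega>) \<partial>(\<Pi>\<^sub>M r\<in>{1..}. \<nu>) \<partial>L)"
proof -
  interpret PK: prob_space "\<Pi>\<^sub>M r\<in>{1::nat..}. \<nu>" using \<nu> by (intro prob_space_PiM)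
  note B = branch_pair_measurable[OF measurable_ident_sets[OF \<nu>(2)]]
  have "(\<integral>\<^sup>+x. f x \<partial>smooth L \<nu>) = (\<integral>\<^sup>+x. f (case x of (v, x) \<Rightarrow> branch v x) \<partial>(L \<Otimes>\<^sub>M (\<Pi>\<^sub>M r\<in>{1..}. \<nu>)))"
    unfolding smooth_def using B f by (subst nn_integral_distr) auto
  also have "\<dots> = (\<integral>\<^sup>+v. \<integral>\<^sup>+\<omega>. f (branch v \<omega>) \<partial>(\<Pi>\<^sub>M r\<in>{1..}. \<nu>) \<partial>L)"
    using PK.nn_integral_fst[OF measurable_compose[OF B f]] by simp
  finally show ?thesis .
qed

lemma smooth_first_moment:
  assumes \<nu>: "prob_space \<nu>" "sets \<nu> = sets borel"
  shows "(\<integral>\<^sup>+x. ennreal \<bar>x\<bar> \<partial>smooth L \<nu>) \<le> lrho L 1 * (\<integral>\<^sup>+x. ennreal \<bar>x\<bar> \<partial>\<nu>) + (\<integral>\<^sup>+v. ennreal \<bar>Qof v\<bar> \<partial>L)"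
proof -
  let ?P = "\<Pi>\<^sub>M r\<in>{1::nat..}. \<nu>" and ?E = "\<integral>\<^sup>+x. ennreal \<bar>x\<bar> \<partial>\<nu>"
  interpret PK: prob_space ?P using \<nu> by (intro prob_space_PiM)
  have absm: "(\<lambda>x. ennreal \<bar>x\<bar>) \<in> borel_measurable \<nu>"
    using measurable_ident_sets[OF \<nu>(2)] by measurable
  have cm: "(\<lambda>\<omega>. ennreal \<bar>\<omega> r\<bar>) \<in> borel_measurable ?P" if "r \<ge> 1" for r
    using that measurable_compose[OF measurable_component_singleton[of r "{1..}" "\<lambda>_. \<nu>"] absm] by simp
  have "(\<integral>\<^sup>+x. ennreal \<bar>x\<bar> \<partial>smooth L \<nu>) = (\<integral>\<^sup>+v. \<integral>\<^sup>+\<omega>. ennreal \<bar>branch v \<omega>\<bar> \<partial>?P \<partial>L)"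
    by (rule nn_integral_smooth[OF \<nu>]) simp
  also have "\<dots> \<le> (\<integral>\<^sup>+v. ennreal (\<Sum>r=1..Nof v. \<bar>Cof v r\<bar>) * ?E + ennreal \<bar>Qof v\<bar> \<partial>L)"
  proof (intro nn_integral_mono)
    fix v
    have "(\<integral>\<^sup>+\<omega>. ennreal \<bar>branch v \<omega>\<bar> \<partial>?P) \<le> (\<integral>\<^sup>+\<omega>. (\<Sum>r=1..Nof v. ennreal \<bar>Cof v r\<bar> * ennreal \<bar>\<omega> r\<bar>) + ennreal \<bar>Qof v\<bar> \<partial>?P)"
    proof (intro nn_integral_mono)
      fix \<omega> :: "nat \<Rightarrow> real"
      have "\<bar>branch v \<omega>\<bar> \<le> (\<Sum>r=1..Nof v. \<bar>Cof v r\<bar> * \<bar>\<omega> r\<bar>) + \<bar>Qof v\<bar>"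
        unfolding branch_def by (rule order.trans[OF abs_triangle_ineq add_right_mono[OF order.trans[OF sum_abs]]]) (simp add: abs_mult)
      then have "ennreal \<bar>branch v \<omega>\<bar> \<le> ennreal (\<Sum>r=1..Nof v. \<bar>Cof v r\<bar> * \<bar>\<omega> r\<bar>) + ennreal \<bar>Qof v\<bar>"
        by (simp add: ennreal_leI sum_nonneg flip: ennreal_plus)
      then show "ennreal \<bar>branch v \<omega>\<bar> \<le> (\<Sum>r=1..Nof v. ennreal \<bar>Cof v r\<bar> * ennreal \<bar>\<omega> r\<bar>) + ennreal \<bar>Qof v\<bar>"
        by (simp flip: ennreal_mult)
    qed
    also have "\<dots> = (\<Sum>r=1..Nof v. ennreal \<bar>Cof v r\<bar> * ?E) + ennreal \<bar>Qof v\<bar>"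
    proof -
      have "(\<integral>\<^sup>+\<omega>. ennreal \<bar>Cof v r\<bar> * ennreal \<bar>\<omega> r\<bar> \<partial>?P) = ennreal \<bar>Cof v r\<bar> * ?E" if "r \<in> {1..Nof v}" for r
        using that nn_integral_PiM_component[OF \<nu>(1) _ absm, of r "{1..}"] cm by (simp add: nn_integral_cmult)
      then have "(\<Sum>r=1..Nof v. \<integral>\<^sup>+\<omega>. ennreal \<bar>Cof v r\<bar> * ennreal \<bar>\<omega> r\<bar> \<partial>?P) = (\<Sum>r=1..Nof v. ennreal \<bar>Cof v r\<bar> * ?E)"
        by (intro sum.cong refl)
      moreover have "(\<integral>\<^sup>+\<omega>. (\<Sum>r=1..Nof v. ennreal \<bar>Cof v r\<bar> * ennreal \<bar>\<omega> r\<bar>) + ennreal \<bar>Qof v\<bar> \<partial>?P)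
          = (\<Sum>r=1..Nof v. \<integral>\<^sup>+\<omega>. ennreal \<bar>Cof v r\<bar> * ennreal \<bar>\<omega> r\<bar> \<partial>?P) + ennreal \<bar>Qof v\<bar>"
      proof -
        have cm': "(\<lambda>\<omega>. ennreal \<bar>Cof v r\<bar> * ennreal \<bar>\<omega> r\<bar>) \<in> borel_measurable ?P" if "r \<in> {1..Nof v}" for r
          using that by (intro borel_measurable_times_ennreal borel_measurable_const cm) simp
        then have S: "(\<lambda>\<omega>. \<Sum>r=1..Nof v. ennreal \<bar>Cof v r\<bar> * ennreal \<bar>\<omega> r\<bar>) \<in> borel_measurable ?P"
          by (rule borel_measurable_sum)
        show ?thesis
          unfolding nn_integral_add[OF S borel_measurable_const] nn_integral_const PK.emeasure_space_1 mult_1_right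
          by (subst nn_integral_sum, erule cm', rule refl)
      qed
      ultimately show ?thesis by (simp only:)
    qed
    also have "\<dots> = ennreal (\<Sum>r=1..Nof v. \<bar>Cof v r\<bar>) * ?E + ennreal \<bar>Qof v\<bar>"
      by (simp flip: sum_distrib_right)
    finally show "(\<integral>\<^sup>+\<omega>. ennreal \<bar>branch v \<omega>\<bar> \<partial>?P) \<le> ennreal (\<Sum>r=1..Nof v. \<bar>Cof v r\<bar>) * ?E + ennreal \<bar>Qof v\<bar>" .
  qed
  also have "\<dots> = lrho L 1 * ?E + (\<integral>\<^sup>+v. ennreal \<bar>Qof v\<bar> \<partial>L)"
    using Cof_sum_measurable by (simp add: nn_integral_add nn_integral_multc lrho_def)
  finally show ?thesis .
qed

text \<open>The term Q is split off with weight \<theta>, so the \<alpha>-th moment of \<nu> is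
  multiplied by \<open>lrho L \<alpha>\<close> and the adjustable factor
  \<open>\<theta> powr (1 - \<alpha>)\<close> only. All other contributions go into an additive
  constant that depends on \<nu> through the first moment bound \<open>A\<close>.\<close>

lemma smooth_powr_moment:
  fixes \<alpha> \<theta> A :: real
  assumes \<nu>: "prob_space \<nu>" "sets \<nu> = sets borel" and \<alpha>: "1 < \<alpha>" "\<alpha> < 2" and \<theta>: "0 < \<theta>" "\<theta> < 1"
    and A: "0 \<le> A" "(\<integral>\<^sup>+x. ennreal \<bar>x\<bar> \<partial>\<nu>) \<le> ennreal A"
  shows "(\<integral>\<^sup>+x. ennreal (\<bar>x\<bar> powr \<alpha>) \<partial>smooth L \<nu>)
    \<le> ennreal (\<theta> powr (1 - \<alpha>)) * lrho L \<alpha> * (\<integral>\<^sup>+x. ennreal (\<bar>x\<bar> powr \<alpha>) \<partial>\<nu>)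
      + (ennreal (\<theta> powr (1 - \<alpha>) * (A + A\<^sup>2)) * (\<integral>\<^sup>+v. ennreal ((\<Sum>r=1..Nof v. \<bar>Cof v r\<bar>) powr \<alpha>) \<partial>L)
      + ennreal ((1 - \<theta>) powr (1 - \<alpha>)) * (\<integral>\<^sup>+v. ennreal (\<bar>Qof v\<bar> powr \<alpha>) \<partial>L))"
proof -
  let ?P = "\<Pi>\<^sub>M r\<in>{1::nat..}. \<nu>" and ?E = "\<integral>\<^sup>+x. ennreal (\<bar>x\<bar> powr \<alpha>) \<partial>\<nu>"
  let ?a = "\<theta> powr (1 - \<alpha>)" and ?b = "(1 - \<theta>) powr (1 - \<alpha>)"
  let ?\<sigma> = "\<lambda>v. \<Sum>r=1..Nof v. \<bar>Cof v r\<bar>" and ?\<rho> = "\<lambda>v. \<Sum>r=1..Nof v. \<bar>Cof v r\<bar> powr \<alpha>"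
  interpret PK: prob_space ?P using \<nu> by (intro prob_space_PiM)
  have cm: "(\<lambda>\<omega>. \<omega> r) \<in> borel_measurable ?P" if "r \<ge> 1" for r
    using that measurable_compose[OF measurable_component_singleton[of r "{1..}" "\<lambda>_. \<nu>"] measurable_ident_sets[OF \<nu>(2)]] by simp
  have Sm: "(\<lambda>\<omega>. (\<Sum>r=1..n. c r * \<bar>\<omega> r\<bar>)) \<in> borel_measurable ?P" for n and c :: "nat \<Rightarrow> real"
    by (intro borel_measurable_sum borel_measurable_times borel_measurable_const borel_measurable_abs cm) simp
  have "(\<integral>\<^sup>+x. ennreal (\<bar>x\<bar> powr \<alpha>) \<partial>smooth L \<nu>) = (\<integral>\<^sup>+v. \<integral>\<^sup>+\<omega>. ennreal (\<bar>branch v \<omega>\<bar> powr \<alpha>) \<partial>?P \<partial>L)"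
    by (rule nn_integral_smooth[OF \<nu>]) simp
  also have "\<dots> \<le> (\<integral>\<^sup>+v. ennreal ?a * (ennreal (?\<rho> v) * ?E + ennreal (?\<sigma> v powr \<alpha> * (A + A\<^sup>2)))
      + ennreal ?b * ennreal (\<bar>Qof v\<bar> powr \<alpha>) \<partial>L)"
  proof (intro nn_integral_mono)
    fix v
    let ?S = "\<lambda>\<omega>. \<Sum>r=1..Nof v. \<bar>Cof v r\<bar> * \<bar>\<omega> r\<bar>"
    have "(\<integral>\<^sup>+\<omega>. ennreal (\<bar>branch v \<omega>\<bar> powr \<alpha>) \<partial>?P)
        \<le> (\<integral>\<^sup>+\<omega>. ennreal ?a * ennreal (?S \<omega> powr \<alpha>) + ennreal ?b * ennreal (\<bar>Qof v\<bar> powr \<alpha>) \<partial>?P)"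
    proof (intro nn_integral_mono)
      fix \<omega> :: "nat \<Rightarrow> real"
      have "\<bar>branch v \<omega>\<bar> \<le> ?S \<omega> + \<bar>Qof v\<bar>"
        unfolding branch_def by (rule order.trans[OF abs_triangle_ineq add_right_mono[OF order.trans[OF sum_abs]]]) (simp add: abs_mult)
      then have "\<bar>branch v \<omega>\<bar> powr \<alpha> \<le> (?S \<omega> + \<bar>Qof v\<bar>) powr \<alpha>" using \<alpha> by (intro powr_mono2) auto
      also have "\<dots> \<le> ?a * ?S \<omega> powr \<alpha> + ?b * \<bar>Qof v\<bar> powr \<alpha>"
        using \<alpha> \<theta> by (intro powr_add_le_weighted sum_nonneg) auto
      finally show "ennreal (\<bar>branch v \<omega>\<bar> powr \<alpha>) \<le> ennreal ?a * ennreal (?S \<omega> powr \<alpha>) + ennreal ?b * ennreal (\<bar>Qof v\<bar> powr \<alpha>)"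
        by (simp add: ennreal_leI flip: ennreal_plus ennreal_mult)
    qed
    also have "\<dots> = ennreal ?a * (\<integral>\<^sup>+\<omega>. ennreal (?S \<omega> powr \<alpha>) \<partial>?P) + ennreal ?b * ennreal (\<bar>Qof v\<bar> powr \<alpha>)"
    proof -
      have "(\<lambda>\<omega>. ennreal (?S \<omega> powr \<alpha>)) \<in> borel_measurable ?P" using Sm by measurable
      then show ?thesis
        by (subst nn_integral_add) (auto simp only: nn_integral_cmult nn_integral_const PK.emeasure_space_1 mult_1_right
            borel_measurable_const intro!: borel_measurable_times_ennreal)
    qed
    also have "(\<integral>\<^sup>+\<omega>. ennreal (?S \<omega> powr \<alpha>) \<partial>?P) \<le> ennreal (?\<rho> v) * ?E + ennreal (?\<sigma> v powr \<alpha> * (A + A\<^sup>2))"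
      by (rule nn_integral_sum_powr_PiM[OF \<nu> _ _ _ \<alpha> A]) auto
    finally show "(\<integral>\<^sup>+\<omega>. ennreal (\<bar>branch v \<omega>\<bar> powr \<alpha>) \<partial>?P)
        \<le> ennreal ?a * (ennreal (?\<rho> v) * ?E + ennreal (?\<sigma> v powr \<alpha> * (A + A\<^sup>2))) + ennreal ?b * ennreal (\<bar>Qof v\<bar> powr \<alpha>)"
      by (simp add: add_mono mult_left_mono)
  qed
  also have "\<dots> = ennreal ?a * (lrho L \<alpha> * ?E + (\<integral>\<^sup>+v. ennreal (?\<sigma> v powr \<alpha>) \<partial>L) * ennreal (A + A\<^sup>2))
      + ennreal ?b * (\<integral>\<^sup>+v. ennreal (\<bar>Qof v\<bar> powr \<alpha>) \<partial>L)"
  proof -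
    have [measurable]: "?\<sigma> \<in> borel_measurable L" "?\<rho> \<in> borel_measurable L" by (rule Cof_sum_measurable Cof_power_sum_measurable)+
    have split: "ennreal (?\<sigma> v powr \<alpha> * (A + A\<^sup>2)) = ennreal (?\<sigma> v powr \<alpha>) * ennreal (A + A\<^sup>2)" for v
      using A by (simp add: ennreal_mult)
    have lin: "(\<integral>\<^sup>+v. a * (f v * e + g v * c) + b * h v \<partial>L) = a * ((\<integral>\<^sup>+v. f v \<partial>L) * e + (\<integral>\<^sup>+v. g v \<partial>L) * c) + b * (\<integral>\<^sup>+v. h v \<partial>L)"
      if [measurable]: "f \<in> borel_measurable L" "g \<in> borel_measurable L" "h \<in> borel_measurable L"
      for f g h and a b c e :: ennreal
      by (simp add: nn_integral_add nn_integral_cmult nn_integral_multc)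
    show ?thesis unfolding split lrho_def by (rule lin) measurable
  qed
  also have "\<dots> = ennreal ?a * lrho L \<alpha> * ?E + (ennreal (?a * (A + A\<^sup>2)) * (\<integral>\<^sup>+v. ennreal (?\<sigma> v powr \<alpha>) \<partial>L)
      + ennreal ?b * (\<integral>\<^sup>+v. ennreal (\<bar>Qof v\<bar> powr \<alpha>) \<partial>L))"
    using A by (simp add: ennreal_mult algebra_simps)
  finally show ?thesis .
qed

text \<open>For centered \<nu> the summands are orthogonal given the branching vector, so the
  squared coefficients add up. This gives contraction from \<open>lrho L 2\<close> even when
  \<open>lrho L 1\<close> equals 1.\<close>

lemma smooth_second_moment:
  assumes \<nu>: "prob_space \<nu>" "sets \<nu> = sets borel" and fin: "(\<integral>\<^sup>+x. ennreal (x\<^sup>2) \<partial>\<nu>) < \<infinity>" and mean: "(\<integral>x. x \<partial>\<nu>) = 0"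
  shows "(\<integral>\<^sup>+x. ennreal (x\<^sup>2) \<partial>smooth L \<nu>) = lrho L 2 * (\<integral>\<^sup>+x. ennreal (x\<^sup>2) \<partial>\<nu>) + (\<integral>\<^sup>+v. ennreal ((Qof v)\<^sup>2) \<partial>L)"
proof -
  let ?P = "\<Pi>\<^sub>M r\<in>{1::nat..}. \<nu>" and ?\<rho> = "\<lambda>v. \<Sum>r=1..Nof v. \<bar>Cof v r\<bar> powr 2"
  have idm: "(\<lambda>x. x) \<in> borel_measurable \<nu>" by (rule measurable_ident_sets[OF \<nu>(2)])
  have sq: "integrable \<nu> (\<lambda>x. x\<^sup>2)"
    using fin idm by (intro integrableI_nonneg) auto
  have E: "(\<integral>\<^sup>+x. ennreal (x\<^sup>2) \<partial>\<nu>) = ennreal (\<integral>x. x\<^sup>2 \<partial>\<nu>)"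
    by (rule nn_integral_eq_integral[OF sq]) simp
  have "(\<integral>\<^sup>+x. ennreal (x\<^sup>2) \<partial>smooth L \<nu>) = (\<integral>\<^sup>+v. \<integral>\<^sup>+\<omega>. ennreal ((branch v \<omega>)\<^sup>2) \<partial>?P \<partial>L)"
    by (rule nn_integral_smooth[OF \<nu>]) simp
  also have "\<dots> = (\<integral>\<^sup>+v. ennreal (?\<rho> v) * ennreal (\<integral>x. x\<^sup>2 \<partial>\<nu>) + ennreal ((Qof v)\<^sup>2) \<partial>L)"
  proof (intro nn_integral_cong)
    fix v
    have "(\<integral>\<^sup>+\<omega>. ennreal ((branch v \<omega>)\<^sup>2) \<partial>?P) = ennreal (\<integral>\<omega>. (branch v \<omega>)\<^sup>2 \<partial>?P)"
      unfolding branch_def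
      by (intro nn_integral_eq_integral integrable_square_sum_PiM[OF \<nu>(1) _ _ idm sq mean]) auto
    also have "(\<integral>\<omega>. (branch v \<omega>)\<^sup>2 \<partial>?P) = (\<Sum>r=1..Nof v. (Cof v r)\<^sup>2) * (\<integral>x. x\<^sup>2 \<partial>\<nu>) + (Qof v)\<^sup>2"
      unfolding branch_def by (rule integral_square_sum_PiM[OF \<nu>(1) _ _ idm sq mean]) auto
    also have "(\<Sum>r=1..Nof v. (Cof v r)\<^sup>2) = ?\<rho> v" by simp
    finally show "(\<integral>\<^sup>+\<omega>. ennreal ((branch v \<omega>)\<^sup>2) \<partial>?P) = ennreal (?\<rho> v) * ennreal (\<integral>x. x\<^sup>2 \<partial>\<nu>) + ennreal ((Qof v)\<^sup>2)"
      by (simp add: ennreal_mult sum_nonneg)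
  qed
  also have "\<dots> = lrho L 2 * ennreal (\<integral>x. x\<^sup>2 \<partial>\<nu>) + (\<integral>\<^sup>+v. ennreal ((Qof v)\<^sup>2) \<partial>L)"
    using Cof_power_sum_measurable[of 2] unfolding lrho_def by (subst nn_integral_add) (auto simp: nn_integral_multc)
  finally show ?thesis unfolding E .
qed

text \<open>Propagates the centering that \<open>smooth_second_moment\<close> requires.
  Integrability of the transformed law is what licenses Fubini.\<close>

lemma smooth_mean_zero:
  assumes \<nu>: "prob_space \<nu>" "sets \<nu> = sets borel" and int: "integrable \<nu> (\<lambda>x. x)" and mean: "(\<integral>x. x \<partial>\<nu>) = 0"
    and int': "integrable (smooth L \<nu>) (\<lambda>x. x)" and Q: "(\<integral>v. Qof v \<partial>L) = 0"
  shows "(\<integral>x. x \<partial>smooth L \<nu>) = 0"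
proof -
  let ?P = "\<Pi>\<^sub>M r\<in>{1::nat..}. \<nu>"
  interpret PK: prob_space ?P using \<nu> by (intro prob_space_PiM)
  interpret LP: pair_prob_space L ?P ..
  note B = branch_pair_measurable[OF measurable_ident_sets[OF \<nu>(2)]]
  have B': "integrable (L \<Otimes>\<^sub>M ?P) (\<lambda>(v, \<omega>). branch v \<omega>)"
    using int' B unfolding smooth_def by (subst (asm) integrable_distr_eq) auto
  have "(\<integral>x. x \<partial>smooth L \<nu>) = (\<integral>x. (case x of (v, \<omega>) \<Rightarrow> branch v \<omega>) \<partial>(L \<Otimes>\<^sub>M ?P))"
    unfolding smooth_def using B by (subst integral_distr) auto
  also have "\<dots> = (\<integral>v. \<integral>\<omega>. branch v \<omega> \<partial>?P \<partial>L)"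
    using LP.integral_fst'[OF B'] by simp
  also have "\<dots> = (\<integral>v. Qof v \<partial>L)"
  proof (intro Bochner_Integration.integral_cong refl)
    fix v
    have "integrable ?P (\<lambda>\<omega>. Cof v r * \<omega> r)" "(\<integral>\<omega>. Cof v r * \<omega> r \<partial>?P) = 0" if "r \<in> {1..Nof v}" for r
      using that integrable_PiM_component[OF \<nu>(1) _ int, of r "{1..}"] integral_PiM_component[OF \<nu>(1) _ int, of r "{1..}"] mean by auto
    then show "(\<integral>\<omega>. branch v \<omega> \<partial>?P) = Qof v"
      unfolding branch_def
      by (subst Bochner_Integration.integral_add)
         (auto simp only: Bochner_Integration.integral_sum lebesgue_integral_const PK.prob_space scaleR_one sum.neutral_const
           PK.integrable_const add_0_left cong: sum.cong intro!: Bochner_Integration.integrable_sum)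
  qed
  finally show ?thesis using Q by simp
qed

end

section \<open>Exponents and weights for the moment recursions\<close>

lemma (in prob_space) nn_integral_powr_finite:
  fixes f :: "'a \<Rightarrow> real"
  assumes f: "\<And>x. 0 \<le> f x" "f \<in> borel_measurable M" and fin: "(\<integral>\<^sup>+x. ennreal (f x powr \<beta>) \<partial>M) < \<infinity>" and le: "0 \<le> \<gamma>" "\<gamma> \<le> \<beta>"
  shows "(\<integral>\<^sup>+x. ennreal (f x powr \<gamma>) \<partial>M) < \<infinity>"
proof -
  have "(\<integral>\<^sup>+x. ennreal (f x powr \<gamma>) \<partial>M) \<le> (\<integral>\<^sup>+x. 1 + ennreal (f x powr \<beta>) \<partial>M)"
  proof (intro nn_integral_mono)
    fix x
    have "f x powr \<gamma> \<le> 1 + f x powr \<beta>"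
    proof (cases "f x \<le> 1")
      case True
      then show ?thesis using powr_le1[of \<gamma> "f x"] f(1)[of x] le by (simp add: add_increasing2)
    next
      case False
      then show ?thesis using powr_mono[of \<gamma> \<beta> "f x"] le by (simp add: add_increasing)
    qed
    then show "ennreal (f x powr \<gamma>) \<le> 1 + ennreal (f x powr \<beta>)"
      by (metis ennreal_1 ennreal_leI ennreal_plus powr_ge_zero zero_le_one)
  qed
  also have "\<dots> = 1 + (\<integral>\<^sup>+x. ennreal (f x powr \<beta>) \<partial>M)"
    using f(2) by (subst nn_integral_add) (auto simp: emeasure_space_1)
  also have "\<dots> < \<infinity>" using fin by simp
  finally show ?thesis .
qed

lemma ennreal_contraction_weight:
  fixes \<alpha> :: real and r :: ennreal
  assumes \<alpha>: "1 < \<alpha>" and r: "r < 1"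
  obtains \<theta> :: real where "0 < \<theta>" "\<theta> < 1" "ennreal (\<theta> powr (1 - \<alpha>)) * r < 1"
proof -
  obtain r' where r': "r = ennreal r'" "0 \<le> r'" "r' < 1" using r by (cases r) auto
  \<comment> \<open>The floor 1/2 keeps \<open>s\<close> positive when \<open>r'\<close> is
    0.\<close>
  define s where "s = max r' (1 / 2)"
  have s: "0 < s" "s < 1" "r' \<le> s" using r' by (auto simp: s_def)
  \<comment> \<open>Chosen so that \<open>\<theta> powr (1 - \<alpha>)\<close> is s^(-1/2): its
    product with \<open>r'\<close> is then at most the square root of \<open>s\<close>, still below
    1.\<close>
  define \<theta> where "\<theta> = s powr (1 / (2 * (\<alpha> - 1)))"
  have "1 / (2 * t) * - t = - 1 / 2" if "0 < t" for t :: real using that by simp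
  from this[of "\<alpha> - 1"] \<alpha> have "\<theta> powr (1 - \<alpha>) = s powr (- 1 / 2)"
    unfolding \<theta>_def powr_powr minus_diff_eq by simp
  then have "\<theta> powr (1 - \<alpha>) * r' \<le> s powr (- 1 / 2) * s" using s by (simp add: mult_left_mono)
  also have "\<dots> = s powr (1 / 2)" using s by (simp add: powr_mult_base mult.commute[of _ s])
  also have "\<dots> < 1" using s powr_less_mono2[of "1 / 2" s 1] by simp
  finally have lt: "\<theta> powr (1 - \<alpha>) * r' < 1" .
  show thesis
  proof (rule that)
    show "0 < \<theta>" using s by (simp add: \<theta>_def)
    show "\<theta> < 1" using s \<alpha> powr_less_mono2[of "1 / (2 * (\<alpha> - 1))" s 1] by (simp add: \<theta>_def)
    show "ennreal (\<theta> powr (1 - \<alpha>)) * r < 1"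
      using lt r' by (simp add: ennreal_less_one_iff flip: ennreal_mult)
  qed
qed

context branching_law
begin

text \<open>Convexity of \<gamma> -> rho_\<gamma>. With \<alpha> = \<theta> + \<beta>(1-\<theta>),
  Young's inequality bounds each term of the sum by the corresponding combination of its powers 1
  and \<beta>.\<close>

lemma lrho_less_one:
  assumes \<alpha>: "1 \<le> \<alpha>" "\<alpha> \<le> \<beta>" "1 < \<beta>" and \<rho>: "lrho L 1 < 1" "lrho L \<beta> < 1"
  shows "lrho L \<alpha> < 1"
proof -
  define \<theta> where "\<theta> = (\<beta> - \<alpha>) / (\<beta> - 1)"
  have \<theta>: "0 \<le> \<theta>" "\<theta> \<le> 1" using \<alpha> by (auto simp: \<theta>_def field_simps)
  have \<theta>_mult: "\<theta> * (\<beta> - 1) = \<beta> - \<alpha>" using \<alpha> by (simp add: \<theta>_def)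
  have \<alpha>_eq: "\<alpha> = \<theta> + \<beta> * (1 - \<theta>)" using \<alpha> \<theta>_mult by (simp add: algebra_simps)
  have c: "\<bar>c\<bar> powr \<alpha> \<le> \<theta> * \<bar>c\<bar> powr 1 + (1 - \<theta>) * \<bar>c\<bar> powr \<beta>" for c :: real
  proof (cases "c = 0")
    case False
    then have "\<bar>c\<bar> powr \<alpha> = \<bar>c\<bar> powr \<theta> * (\<bar>c\<bar> powr \<beta>) powr (1 - \<theta>)"
      using powr_add[of "\<bar>c\<bar>" \<theta> "\<beta> * (1 - \<theta>)"] by (simp add: powr_powr flip: \<alpha>_eq)
    also have "\<dots> \<le> \<theta> * \<bar>c\<bar> + (1 - \<theta>) * \<bar>c\<bar> powr \<beta>"
      using False \<theta> by (intro Youngs_inequality_0) auto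
    finally show ?thesis by simp
  qed simp
  obtain a where a: "lrho L 1 = ennreal a" "0 \<le> a" "a < 1" using \<rho>(1) by (cases "lrho L 1") auto
  obtain b where b: "lrho L \<beta> = ennreal b" "0 \<le> b" "b < 1" using \<rho>(2) by (cases "lrho L \<beta>") auto
  let ?S = "\<lambda>\<gamma> v. \<Sum>i=1..Nof v. \<bar>Cof v i\<bar> powr \<gamma>"
  have "lrho L \<alpha> \<le> (\<integral>\<^sup>+v. ennreal \<theta> * ennreal (?S 1 v) + ennreal (1 - \<theta>) * ennreal (?S \<beta> v) \<partial>L)"
    unfolding lrho_def
  proof (intro nn_integral_mono)
    fix v
    have "?S \<alpha> v \<le> \<theta> * ?S 1 v + (1 - \<theta>) * ?S \<beta> v"
      unfolding sum_distrib_left sum.distrib[symmetric] by (intro sum_mono c)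
    then have "ennreal (?S \<alpha> v) \<le> ennreal (\<theta> * ?S 1 v + (1 - \<theta>) * ?S \<beta> v)" by (rule ennreal_leI)
    also have "\<dots> = ennreal \<theta> * ennreal (?S 1 v) + ennreal (1 - \<theta>) * ennreal (?S \<beta> v)"
      using \<theta> by (subst ennreal_plus) (auto intro!: mult_nonneg_nonneg sum_nonneg simp: ennreal_mult sum_nonneg)
    finally show "ennreal (?S \<alpha> v) \<le> ennreal \<theta> * ennreal (?S 1 v) + ennreal (1 - \<theta>) * ennreal (?S \<beta> v)" .
  qed
  also have "\<dots> = ennreal \<theta> * lrho L 1 + ennreal (1 - \<theta>) * lrho L \<beta>"
  proof -
    have lin: "(\<integral>\<^sup>+v. p * f v + q * g v \<partial>L) = p * (\<integral>\<^sup>+v. f v \<partial>L) + q * (\<integral>\<^sup>+v. g v \<partial>L)"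
      if [measurable]: "f \<in> borel_measurable L" "g \<in> borel_measurable L" for p q :: ennreal and f g
      by (simp add: nn_integral_add nn_integral_cmult)
    show ?thesis
      unfolding lrho_def by (intro lin measurable_compose[OF Cof_power_sum_measurable measurable_ennreal])
  qed
  also have "\<dots> = ennreal (\<theta> * a + (1 - \<theta>) * b)" using a b \<theta> by (simp add: ennreal_mult)
  also have "\<theta> * a + (1 - \<theta>) * b < 1"
  proof (cases "\<theta> = 0")
    case False
    then have "\<theta> * a < \<theta>" "(1 - \<theta>) * b \<le> 1 - \<theta>" using a b \<theta> mult_left_mono[of b 1 "1 - \<theta>"] by auto
    then show ?thesis by linarith
  qed (use b in simp)
  then have "ennreal (\<theta> * a + (1 - \<theta>) * b) < 1" using a b \<theta> by (simp add: ennreal_less_one_iff del: ennreal_plus)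
  finally show ?thesis .
qed

lemma iterated_law:
  "prob_space ((smooth L ^^ k) (distr L borel Qof))" "sets ((smooth L ^^ k) (distr L borel Qof)) = sets borel"
proof -
  have "prob_space ((smooth L ^^ k) (distr L borel Qof)) \<and> sets ((smooth L ^^ k) (distr L borel Qof)) = sets borel"
    by (induction k) (auto simp: prob_space_smooth intro!: L.prob_space_distr)
  then show "prob_space ((smooth L ^^ k) (distr L borel Qof))" "sets ((smooth L ^^ k) (distr L borel Qof)) = sets borel"
    by auto
qed

text \<open>Two affine recursions in succession: first moments contract with
  \<open>lrho L 1\<close>, and their bound \<open>A\<close> supplies the additive constant for the
  \<alpha>-th moments, which contract once \<theta> has been adapted to
  \<open>lrho L \<alpha> < 1\<close>.\<close>

lemma iterated_moments_bounded_contractive: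
  assumes \<alpha>: "1 < \<alpha>" "\<alpha> < 2" "\<alpha> \<le> \<beta>"
    and Q: "(\<integral>\<^sup>+v. ennreal (\<bar>Qof v\<bar> powr \<beta>) \<partial>L) < \<infinity>"
    and C: "(\<integral>\<^sup>+v. ennreal ((\<Sum>r=1..Nof v. \<bar>Cof v r\<bar>) powr \<beta>) \<partial>L) < \<infinity>"
    and \<rho>: "lrho L 1 < 1" "lrho L \<beta> < 1"
  obtains H :: real where "0 \<le> H" "\<And>k. (\<integral>\<^sup>+x. ennreal (\<bar>x\<bar> powr \<alpha>) \<partial>((smooth L ^^ k) (distr L borel Qof))) \<le> ennreal H"
proof -
  let ?\<mu> = "\<lambda>k. (smooth L ^^ k) (distr L borel Qof)"
  have Qm: "(\<integral>\<^sup>+v. ennreal (\<bar>Qof v\<bar> powr \<gamma>) \<partial>L) < \<infinity>" if "0 \<le> \<gamma>" "\<gamma> \<le> \<beta>" for \<gamma>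
    using L.nn_integral_powr_finite[OF _ _ Q that] by simp
  have Cm: "(\<integral>\<^sup>+v. ennreal ((\<Sum>r=1..Nof v. \<bar>Cof v r\<bar>) powr \<alpha>) \<partial>L) < \<infinity>"
    using \<alpha> by (intro L.nn_integral_powr_finite[OF _ Cof_sum_measurable C] sum_nonneg) auto
  have Q1: "(\<integral>\<^sup>+v. ennreal \<bar>Qof v\<bar> \<partial>L) < \<infinity>" using Qm[of 1] \<alpha> by simp
  obtain A where A: "0 \<le> A" "\<And>k. (\<integral>\<^sup>+x. ennreal \<bar>x\<bar> \<partial>?\<mu> k) \<le> ennreal A"
  proof (rule affine_recursion_bounded[of "\<lambda>k. \<integral>\<^sup>+x. ennreal \<bar>x\<bar> \<partial>?\<mu> k" "lrho L 1" "\<integral>\<^sup>+v. ennreal \<bar>Qof v\<bar> \<partial>L"])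
    show "(\<integral>\<^sup>+x. ennreal \<bar>x\<bar> \<partial>?\<mu> 0) < \<infinity>" using Q1 by (simp add: nn_integral_distr)
    show "(\<integral>\<^sup>+x. ennreal \<bar>x\<bar> \<partial>?\<mu> (Suc k)) \<le> lrho L 1 * (\<integral>\<^sup>+x. ennreal \<bar>x\<bar> \<partial>?\<mu> k) + (\<integral>\<^sup>+v. ennreal \<bar>Qof v\<bar> \<partial>L)" for k
      using smooth_first_moment[OF iterated_law] by simp
  qed (use \<rho> Q1 in auto)
  have "lrho L \<alpha> < 1" using \<alpha> \<rho> by (intro lrho_less_one[of \<alpha> \<beta>]) auto
  then obtain \<theta> where \<theta>: "0 < \<theta>" "\<theta> < 1" "ennreal (\<theta> powr (1 - \<alpha>)) * lrho L \<alpha> < 1"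
    by (rule ennreal_contraction_weight[OF \<alpha>(1)])
  let ?c = "ennreal (\<theta> powr (1 - \<alpha>) * (A + A\<^sup>2)) * (\<integral>\<^sup>+v. ennreal ((\<Sum>r=1..Nof v. \<bar>Cof v r\<bar>) powr \<alpha>) \<partial>L)
      + ennreal ((1 - \<theta>) powr (1 - \<alpha>)) * (\<integral>\<^sup>+v. ennreal (\<bar>Qof v\<bar> powr \<alpha>) \<partial>L)"
  have Qa: "(\<integral>\<^sup>+v. ennreal (\<bar>Qof v\<bar> powr \<alpha>) \<partial>L) < \<infinity>" using \<alpha> by (intro Qm) auto
  show thesis
  proof (rule affine_recursion_bounded[of "\<lambda>k. \<integral>\<^sup>+x. ennreal (\<bar>x\<bar> powr \<alpha>) \<partial>?\<mu> k" "ennreal (\<theta> powr (1 - \<alpha>)) * lrho L \<alpha>" ?c])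
    show "(\<integral>\<^sup>+x. ennreal (\<bar>x\<bar> powr \<alpha>) \<partial>?\<mu> 0) < \<infinity>" using Qa by (simp add: nn_integral_distr)
    show "?c < \<infinity>" using Cm Qa by (simp add: ennreal_mult_less_top)
    show "(\<integral>\<^sup>+x. ennreal (\<bar>x\<bar> powr \<alpha>) \<partial>?\<mu> (Suc k))
      \<le> ennreal (\<theta> powr (1 - \<alpha>)) * lrho L \<alpha> * (\<integral>\<^sup>+x. ennreal (\<bar>x\<bar> powr \<alpha>) \<partial>?\<mu> k) + ?c" for k
      using smooth_powr_moment[OF iterated_law \<alpha>(1,2) \<theta>(1,2) A(1) A(2)] by simp
  qed (use \<theta> that in auto)
qed

text \<open>Second moments take the place of first ones: centering and \<open>lrho L 2 < 1\<close>
  bound them, and \<bar>x\<bar>^\<alpha> \<le> 1 + x^2 passes the bound on to the exponent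
  \<alpha>.\<close>

lemma iterated_moments_bounded_centered:
  assumes \<alpha>: "1 < \<alpha>" "\<alpha> < 2"
    and Q: "(\<integral>\<^sup>+v. ennreal (\<bar>Qof v\<bar> powr 2) \<partial>L) < \<infinity>" "(\<integral>v. Qof v \<partial>L) = 0" and \<rho>: "lrho L 2 < 1"
  obtains H :: real where "0 \<le> H" "\<And>k. (\<integral>\<^sup>+x. ennreal (\<bar>x\<bar> powr \<alpha>) \<partial>((smooth L ^^ k) (distr L borel Qof))) \<le> ennreal H"
proof -
  let ?\<mu> = "\<lambda>k. (smooth L ^^ k) (distr L borel Qof)"
  let ?u = "\<lambda>k. \<integral>\<^sup>+x. ennreal (x\<^sup>2) \<partial>?\<mu> k"
  have Q2: "(\<integral>\<^sup>+v. ennreal ((Qof v)\<^sup>2) \<partial>L) < \<infinity>" using Q(1) by simp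
  have int: "integrable (?\<mu> k) (\<lambda>x. x)" if "?u k < \<infinity>" for k
  proof -
    interpret prob_space "?\<mu> k" by (rule iterated_law)
    have idm: "(\<lambda>x. x) \<in> borel_measurable (?\<mu> k)" by (rule measurable_ident_sets[OF iterated_law(2)])
    then have "integrable (?\<mu> k) (\<lambda>x. x\<^sup>2)" using that by (intro integrableI_nonneg) auto
    then show ?thesis by (rule square_integrable_imp_integrable[OF idm])
  qed
  \<comment> \<open>Finiteness and centering are proved together: the next second moment is computed
    from both, and the next mean from integrability at both levels.\<close>
  have fin: "?u k < \<infinity> \<and> (\<integral>x. x \<partial>?\<mu> k) = 0" for k
  proof (induction k)
    case 0
    show ?case using Q2 Q(2) by (simp add: nn_integral_distr integral_distr)
  next
    case (Suc k)
    have "?u (Suc k) = lrho L 2 * ?u k + (\<integral>\<^sup>+v. ennreal ((Qof v)\<^sup>2) \<partial>L)"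
      using smooth_second_moment[OF iterated_law] Suc.IH by simp
    then have fin: "?u (Suc k) < \<infinity>" using Suc.IH Q2 \<rho> by (auto simp: ennreal_mult_less_top intro: less_trans)
    moreover have "(\<integral>x. x \<partial>?\<mu> (Suc k)) = 0"
      using smooth_mean_zero[OF iterated_law int[of k] _ _ Q(2)] int[OF fin] Suc.IH by simp
    ultimately show ?case by simp
  qed
  have rec: "?u (Suc k) \<le> lrho L 2 * ?u k + (\<integral>\<^sup>+v. ennreal ((Qof v)\<^sup>2) \<partial>L)" for k
    using smooth_second_moment[OF iterated_law] fin by simp
  have u0: "?u 0 < \<infinity>" using fin[of 0] by (rule conjunct1)
  obtain B where B: "0 \<le> B" "\<And>k. ?u k \<le> ennreal B"
    using affine_recursion_bounded[of ?u, OF u0 \<rho> Q2 rec] by blast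
  have "(\<integral>\<^sup>+x. ennreal (\<bar>x\<bar> powr \<alpha>) \<partial>?\<mu> k) \<le> ennreal (1 + B)" for k
  proof -
    interpret prob_space "?\<mu> k" by (rule iterated_law)
    have idm: "(\<lambda>x. x) \<in> borel_measurable (?\<mu> k)" by (rule measurable_ident_sets[OF iterated_law(2)])
    have "(\<integral>\<^sup>+x. ennreal (\<bar>x\<bar> powr \<alpha>) \<partial>?\<mu> k) \<le> (\<integral>\<^sup>+x. 1 + ennreal (x\<^sup>2) \<partial>?\<mu> k)"
    proof (intro nn_integral_mono)
      fix x :: real
      have "\<bar>x\<bar> powr \<alpha> \<le> 1 + x\<^sup>2"
      proof (cases "\<bar>x\<bar> \<le> 1")
        case True
        then show ?thesis using powr_le1[of \<alpha> "\<bar>x\<bar>"] \<alpha> by (simp add: add_increasing2)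
      next
        case False
        then show ?thesis using powr_mono[of \<alpha> 2 "\<bar>x\<bar>"] \<alpha> by (simp add: add_increasing)
      qed
      then show "ennreal (\<bar>x\<bar> powr \<alpha>) \<le> 1 + ennreal (x\<^sup>2)"
        by (metis ennreal_1 ennreal_leI ennreal_plus zero_le_power2 zero_le_one)
    qed
    also have "\<dots> = 1 + ?u k" using idm by (subst nn_integral_add) (auto simp: emeasure_space_1)
    also have "\<dots> \<le> 1 + ennreal B" by (intro add_left_mono B)
    also have "\<dots> = ennreal (1 + B)" using B by simp
    finally show ?thesis .
  qed
  with B(1) show thesis by (intro that[of "1 + B"]) auto
qed

end

subsection \<open>The convergence rate\<close>

theorem theorem4p3:
  fixes M :: "'a measure" and Q :: "'a \<Rightarrow> real" and N :: "'a \<Rightarrow> nat" and C :: "nat \<Rightarrow> 'a \<Rightarrow> real"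
    and T :: "'t measure" and V :: "nat list \<Rightarrow> 't \<Rightarrow> bvec"
    and \<alpha> \<beta> :: real
  assumes "prob_space M"
    and "Q \<in> borel_measurable M"
    and "N \<in> measurable M (count_space UNIV)"
    and "\<And>r. r \<ge> 1 \<Longrightarrow> C r \<in> borel_measurable M"
    and "prob_space T"
    and "iid_family T (bvec_law M Q N C) V words"
    and "\<beta> > 1"
    and "(\<integral>\<^sup>+\<omega>. ennreal (\<bar>Q \<omega>\<bar> powr \<beta>) \<partial>M) < \<infinity>"
    and "(\<integral>\<^sup>+\<omega>. ennreal ((\<Sum>i=1..N \<omega>. \<bar>C i \<omega>\<bar>) powr \<beta>) \<partial>M) < \<infinity>"
    and "max (rho M N C 1) (rho M N C \<beta>) < 1 \<or>
         (\<beta> = 2 \<and> rho M N C 1 = 1 \<and> rho M N C \<beta> < 1 \<and> prob_space.expectation M Q = 0)"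
    and "1 < \<alpha>" and "\<alpha> < 2" and "\<alpha> \<le> \<beta>"
  shows "\<exists>K::real. \<forall>(k::nat) (m::nat) (S::'s measure) Q0 W J.
           m \<ge> 1 \<longrightarrow>
           bootstrap_input S (distr M borel Q) (bvec_law M Q N C) m Q0 W J \<longrightarrow>
           (\<integral>\<^sup>+\<omega>. d1 (empirical_df m (pool (\<lambda>i. Q0 i \<omega>) (\<lambda>p. W p \<omega>) (\<lambda>p. J p \<omega>) k))
                     (R_df T V k) \<partial>S)
           \<le> ennreal (K * real m powr (-1 + 1 / \<alpha>)) * (\<Sum>i\<le>k. rho M N C 1 ^ i)"
proof -
  note meas = assms(2-4)
  let ?L = "bvec_law M Q N C"
  interpret M: prob_space M by fact
  interpret branching_law ?L by (rule branching_law_bvec_law[OF assms(1-4)])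
  let ?LQ = "distr ?L borel Qof" and ?\<mu> = "\<lambda>k. (smooth ?L ^^ k) (distr ?L borel Qof)"
  have LQ: "?LQ = distr M borel Q" by (rule distr_Qof_bvec_law[OF meas])
  have \<rho>: "lrho ?L \<gamma> = rho M N C \<gamma>" for \<gamma> by (rule lrho_bvec_law[OF meas])
  have Q\<beta>: "(\<integral>\<^sup>+v. ennreal (\<bar>Qof v\<bar> powr \<beta>) \<partial>?L) < \<infinity>"
    using assms(8) by (subst nn_integral_bvec_law[OF meas]) auto
  have C\<beta>: "(\<integral>\<^sup>+v. ennreal ((\<Sum>r=1..Nof v. \<bar>Cof v r\<bar>) powr \<beta>) \<partial>?L) < \<infinity>"
  proof -
    have [measurable]: "(\<lambda>v. \<Sum>r=1..Nof v. \<bar>Cof v r\<bar>) \<in> borel_measurable bvec_space"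
      by (intro random_sum_measurable borel_measurable_abs Cof_component_measurable) auto
    have "(\<lambda>v. ennreal ((\<Sum>r=1..Nof v. \<bar>Cof v r\<bar>) powr \<beta>)) \<in> borel_measurable bvec_space"
      by measurable
    from nn_integral_bvec_law[OF meas this] show ?thesis using assms(9) by simp
  qed
  have mean: "(\<integral>v. Qof v \<partial>?L) = M.expectation Q"
    using bvec_measurable[OF meas] unfolding bvec_law_def by (subst integral_distr) auto
  \<comment> \<open>The two alternatives of the hypothesis are used here only; from now on the
    uniform bound \<open>H\<close> represents them.\<close>
  obtain H where H: "0 \<le> H" "\<And>k. (\<integral>\<^sup>+x. ennreal (\<bar>x\<bar> powr \<alpha>) \<partial>?\<mu> k) \<le> ennreal H"
  proof (cases "max (rho M N C 1) (rho M N C \<beta>) < 1")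
    case True
    then show thesis
      using iterated_moments_bounded_contractive[OF assms(11-13) Q\<beta> C\<beta>] that by (auto simp: \<rho>)
  next
    case False
    with assms(10) have "\<beta> = 2" "rho M N C 2 < 1" "M.expectation Q = 0" by auto
    then show thesis
      using iterated_moments_bounded_centered[OF assms(11,12)] Q\<beta> that by (auto simp: \<rho> mean)
  qed
  \<comment> \<open>The constant of \<open>area_dist_empirical_moment_bound\<close> with this
    \<open>H\<close>: it depends on \<alpha> and the law of the branching vector, not on the level,
    the pool size or the space carrying the bootstrap.\<close>
  define K where "K = 2 * (2 * H / (\<alpha> - 1) + sqrt H / (1 - \<alpha> / 2))"
  show ?thesis
  proof (intro exI[of _ K] allI impI)
    fix k m :: nat and S :: "'s measure" and Q0 W J
    assume m: "m \<ge> 1" and boot: "bootstrap_input S (distr M borel Q) ?L m Q0 W J"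
    let ?y = "\<lambda>\<omega>. pool (\<lambda>i. Q0 i \<omega>) (\<lambda>p. W p \<omega>) (\<lambda>p. J p \<omega>) k"
    let ?U = "measure_pmf (pmf_of_set {1..m})"
    have rd: "real_distribution (?\<mu> j)" for j
      using iterated_law[of j] sets_eq_imp_space_eq[OF iterated_law(2)[of j]]
      by (simp add: real_distribution_def real_distribution_axioms_def)
    interpret \<mu>: real_distribution "?\<mu> k" by (rule rd)
    have F: "cdf (?\<mu> k) \<in> borel_measurable borel" by simp
    \<comment> \<open>Both distribution functions are rewritten as \<open>cdf\<close> of probability
      laws, so that the quantile coupling bounds the distance for every outcome separately.\<close>
    have "(\<integral>\<^sup>+\<omega>. d1 (empirical_df m (?y \<omega>)) (R_df T V k) \<partial>S)
        \<le> (\<integral>\<^sup>+\<omega>. area_dist (empirical_df m (?y \<omega>)) (cdf (?\<mu> k)) \<partial>S)"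
      unfolding R_df_eq_cdf[OF assms(5,6)] cdf_emp_law[OF m, symmetric]
      by (intro nn_integral_mono d1_le_area_dist rd real_distribution_emp_law)
    also have "\<dots> = (\<integral>\<^sup>+(q, w, \<iota>). area_dist (empirical_df m (rpool m q w \<iota> k)) (cdf (?\<mu> k))
        \<partial>((\<Pi>\<^sub>M i\<in>{1..m}. ?LQ) \<Otimes>\<^sub>M ((\<Pi>\<^sub>M p\<in>{1..}\<times>{1..m}. ?L) \<Otimes>\<^sub>M (\<Pi>\<^sub>M p\<in>{1..}\<times>{1..m}\<times>{1..}. ?U))))"
      by (rule nn_integral_bootstrap_pool[OF _ _ m _ F])
         (use boot iterated_law[of 0] in \<open>simp_all add: LQ\<close>)
    also have "\<dots> \<le> ennreal (K * m powr (-1 + 1 / \<alpha>)) * (\<Sum>i\<le>k. lrho ?L 1 ^ i)"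
      unfolding K_def using rd[of 0] by (intro bootstrap_area_dist_bound m assms(11,12) H) simp
    finally show "(\<integral>\<^sup>+\<omega>. d1 (empirical_df m (?y \<omega>)) (R_df T V k) \<partial>S)
      \<le> ennreal (K * real m powr (-1 + 1 / \<alpha>)) * (\<Sum>i\<le>k. rho M N C 1 ^ i)"
      unfolding \<rho> .
  qed
qed

end
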